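(* Let $n \geq 1$ and let $\varphi_1, \varphi_2 \in H^{\infty}(\mathbb{D}^n)$ be non-constant inner functions. Then the following hold: (1) Suppose $n = 1$. Then $[P_{\varphi_1 H^2(\mathbb{D})}, P_{\varphi_2 H^2(\mathbb{D})}] = 0$ if and only if either $\varphi_1$ divides $\varphi_2$ or $\varphi_2$ divides $\varphi_1$. (2) Suppose $n > 1$. Then $[P_{\varphi_1 H^2(\mathbb{D}^n)}, P_{\varphi_2 H^2(\mathbb{D}^n)}] = 0$ if and only if there exist inner functions $\tilde{\varphi}_1, \tilde{\varphi}_2, \psi \in H^{\infty}(\mathbb{D}^n)$ such that $\tilde{\varphi}_1$ and $\tilde{\varphi}_2$ are separated, and such that $$\varphi_1 = \tilde{\varphi}_1 \psi \quad \text{and} \quad \varphi_2 = \tilde{\varphi}_2 \psi.$$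
   Context: $\mathbb{D}^n$ is the open unit polydisc in $\mathbb{C}^n$ and $\mathbb{T}^n$ its distinguished boundary. $H^\infty(\mathbb{D}^n)$ is the algebra of bounded analytic functions on $\mathbb{D}^n$. $H^2(\mathbb{D}^n)$ is the Hardy space of analytic functions $f$ on $\mathbb{D}^n$ with $\|f\|^2 = \sup_{0 \le r < 1} \int_{\mathbb{T}^n} |f(rz_1,\ldots,rz_n)|^2\, dm(z) < \infty$, where $m$ is normalized Lebesgue measure on $\mathbb{T}^n$. A function $\varphi \in H^\infty(\mathbb{D}^n)$ is inner if its radial boundary values satisfy $|\varphi(z)| = 1$ for almost every $z \in \mathbb{T}^n$; in that case $\varphi H^2(\mathbb{D}^n)$ is a closed subspace of $H^2(\mathbb{D}^n)$. For a closed subspace $\mathcal{S}$ of a Hilbert space, $P_{\mathcal{S}}$ denotes the orthogonal projection onto $\mathcal{S}$. For bounded operators $A, B$, $[A,B] = AB - BA$. For inner functions $\varphi_1, \varphi_2$, $\varphi_1$ divides $\varphi_2$ if $\varphi_2 = \varphi \varphi_1$ for some $\varphi \in H^\infty(\mathbb{D}^n)$. For $n>1$, two functions on $\mathbb{D}^n$ are separated if they do not depend on common variables, i.e. no coordinate $z_i$ is such that both functions depend on $z_i$. *)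

theory Defs
  imports "HOL-Analysis.Analysis"
begin

text \<open>The dimension \<open>n\<close> is \<open>CARD('n)\<close>, and \<open>\<complex>\<^sup>n\<close> is the type \<open>complex ^ 'n\<close>.\<close>

definition polydisc :: "(complex ^ 'n) set" where
  "polydisc = {z. \<forall>i. cmod (z $ i) < 1}"

text \<open>Normalized Lebesgue measure on the distinguished boundary, as a Borel measure on all of
  \<open>complex ^ 'n\<close> that is concentrated on the torus: the image of the uniform distribution
  on \<open>[0, 2\<pi>]\<^sup>n\<close> under \<open>\<theta> \<mapsto> (e\<^sup>i\<^sup>\<theta>\<^sub>1, \<dots>, e\<^sup>i\<^sup>\<theta>\<^sub>n)\<close>.\<close>

definition torus_measure :: "(complex ^ 'n) measure" where
  "torus_measure =
     distr (uniform_measure lborel (cbox 0 (\<chi> i. 2 * pi) :: (real ^ 'n) set)) borel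
       (\<lambda>\<theta>. \<chi> i. cis (\<theta> $ i))"

text \<open>Analytic in several variables: the Frechet derivative exists at every point of the polydisc
  and is complex linear.\<close>

definition analytic_polydisc :: "(complex ^ 'n \<Rightarrow> complex) \<Rightarrow> bool" where
  "analytic_polydisc f \<longleftrightarrow>
     (\<forall>z\<in>polydisc. \<exists>L. (f has_derivative L) (at z) \<and> (\<forall>c v. L (c *s v) = c * L v))"

text \<open>Members of \<open>H_infty\<close> are arbitrary outside the polydisc, so identities between them are
  always asserted on \<open>polydisc\<close> only.\<close>

definition H_infty :: "(complex ^ 'n \<Rightarrow> complex) set" where
  "H_infty = {f. analytic_polydisc f \<and> bounded (f ` polydisc)}"

definition square_mean :: "(complex ^ 'n \<Rightarrow> complex) \<Rightarrow> real \<Rightarrow> real" where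
  "square_mean f r = (\<integral>z. (cmod (f (r *\<^sub>R z)))\<^sup>2 \<partial>torus_measure)"

text \<open>Members of \<open>H2\<close> are required to vanish outside the polydisc, so that equality of functions
  on the polydisc is equality in HOL and orthogonal projections are uniquely determined.\<close>

definition H2 :: "(complex ^ 'n \<Rightarrow> complex) set" where
  "H2 = {f. analytic_polydisc f \<and> (\<forall>z. z \<notin> polydisc \<longrightarrow> f z = 0) \<and>
            bdd_above (square_mean f ` {0..<1})}"

definition H2_norm :: "(complex ^ 'n \<Rightarrow> complex) \<Rightarrow> real" where
  "H2_norm f = sqrt (SUP r\<in>{0..<1}. square_mean f r)"

text \<open>The inner product inducing \<open>H2_norm\<close>, recovered by polarization; it is linear in the first
  argument.\<close>

definition H2_inner :: "(complex ^ 'n \<Rightarrow> complex) \<Rightarrow> (complex ^ 'n \<Rightarrow> complex) \<Rightarrow> complex" where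
  "H2_inner f g = (\<Sum>k<4. \<i> ^ k * of_real ((H2_norm (\<lambda>z. f z + \<i> ^ k * g z))\<^sup>2)) / 4"

definition H2_proj ::
    "(complex ^ 'n \<Rightarrow> complex) set \<Rightarrow> (complex ^ 'n \<Rightarrow> complex) \<Rightarrow> (complex ^ 'n \<Rightarrow> complex)" where
  "H2_proj S f = (THE g. g \<in> S \<and> (\<forall>h\<in>S. H2_inner (\<lambda>z. f z - g z) h = 0))"

definition mult_H2 :: "(complex ^ 'n \<Rightarrow> complex) \<Rightarrow> (complex ^ 'n \<Rightarrow> complex) set" where
  "mult_H2 \<phi> = (\<lambda>f z. \<phi> z * f z) ` H2"

definition commutator ::
    "((complex ^ 'n \<Rightarrow> complex) \<Rightarrow> (complex ^ 'n \<Rightarrow> complex)) \<Rightarrow>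
     ((complex ^ 'n \<Rightarrow> complex) \<Rightarrow> (complex ^ 'n \<Rightarrow> complex)) \<Rightarrow>
     (complex ^ 'n \<Rightarrow> complex) \<Rightarrow> (complex ^ 'n \<Rightarrow> complex)" where
  "commutator A B f = (\<lambda>z. A (B f) z - B (A f) z)"

definition inner_function :: "(complex ^ 'n \<Rightarrow> complex) \<Rightarrow> bool" where
  "inner_function \<phi> \<longleftrightarrow> \<phi> \<in> H_infty \<and>
     (AE z in torus_measure. \<exists>w. ((\<lambda>r. \<phi> (r *\<^sub>R z)) \<longlongrightarrow> w) (at_left 1) \<and> cmod w = 1)"

definition inner_divides :: "(complex ^ 'n \<Rightarrow> complex) \<Rightarrow> (complex ^ 'n \<Rightarrow> complex) \<Rightarrow> bool" where
  "inner_divides \<phi>1 \<phi>2 \<longleftrightarrow> (\<exists>\<phi>\<in>H_infty. \<forall>z\<in>polydisc. \<phi>2 z = \<phi> z * \<phi>1 z)"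

definition depends_on_coord :: "(complex ^ 'n \<Rightarrow> complex) \<Rightarrow> 'n \<Rightarrow> bool" where
  "depends_on_coord f i \<longleftrightarrow>
     (\<exists>z\<in>polydisc. \<exists>w\<in>polydisc. (\<forall>j. j \<noteq> i \<longrightarrow> z $ j = w $ j) \<and> f z \<noteq> f w)"

definition separated :: "(complex ^ 'n \<Rightarrow> complex) \<Rightarrow> (complex ^ 'n \<Rightarrow> complex) \<Rightarrow> bool" where
  "separated f g \<longleftrightarrow> (\<nexists>i. depends_on_coord f i \<and> depends_on_coord g i)"

end

theory Submission
  imports
    Defs
    "HOL-Complex_Analysis.Conformal_Mappings"
    "HOL-Probability.Probability_Measure"
    "HOL-Library.Function_Algebras"
begin

text \<open>
  Write \<open>a\<close> and \<open>b\<close> for the two inner functions. Multiplication by an inner function is an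
  isometry of \<open>H2\<close>, so the projection onto \<open>a * H2\<close> is \<open>h \<mapsto> a * adj a h\<close>, where \<open>adj a\<close> is the
  adjoint of the multiplication. The theorem is about the Toeplitz operator \<open>T h = adj a (b * h)\<close>:
  the projections commute precisely when \<open>T\<close> is a partial isometry, and then its
  initial space \<open>N\<close> consists of all \<open>f\<close> such that \<open>b * f = a * F\<close> for some \<open>F\<close> in \<open>H2\<close>.

  The space \<open>N\<close> is invariant under all coordinate multiplications. The heart of the proof is that
  commutation forces these shifts to be doubly commuting on \<open>N\<close> (\<open>R_coord_other\<close>). As in Beurling's theorem, a unit vector
  \<open>f\<close> in the wandering subspace of doubly commuting shifts is inner and generates \<open>N\<close>, and its image \<open>F\<close> under \<open>T\<close> is
  inner as well (\<open>wandering_exists\<close>, \<open>wandering_isometric\<close>, \<open>isometric_not_orthogonal\<close>). Hence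
  \<open>T h = F * adj f h\<close>, \<open>a = f * \<psi>\<close> and \<open>b = F * \<psi>\<close>. Compressing a Toeplitz operator by a coordinate
  shift reproduces it, and for \<open>F * adj f\<close> this is only possible if each coordinate is absent from
  \<open>f\<close> or from \<open>F\<close> (\<open>structure_theorem\<close>). In one variable this means that one of them is constant,
  that is, that one inner function divides the other.

  Conversely, if \<open>f\<close> and \<open>F\<close> are separated, then \<open>adj f\<close> commutes with multiplication by \<open>F\<close>
  (\<open>adj_times_separated\<close>), and the projections commute.

  The Hilbert space argument produces factors that are inner in the sense that multiplication by them is
  isometric. That they have radial limits of modulus one is inherited from \<open>a\<close> and \<open>b\<close>: the
  quotient of \<open>f\<close> and \<open>F\<close> has radial limits, and as \<open>f\<close> and \<open>F\<close> have no variable in common, one of them can be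
  integrated out (\<open>inner_factor_limit\<close>).

  All this rests on the description of \<open>H2\<close> by square summable Taylor coefficients (\<open>H2_iff\<close>), which
  follows from Cauchy's formula on the torus, and on the resulting Riesz representation theorem
  (\<open>Riesz_H2\<close>), which provides the adjoints.
\<close>

section \<open>The torus measure\<close>

definition torus_rot :: "complex ^ 'n \<Rightarrow> complex ^ 'n \<Rightarrow> complex ^ 'n" where
  "torus_rot \<eta> \<zeta> = (\<chi> i. \<eta> $ i * \<zeta> $ i)"

definition torus :: "(complex ^ 'n) set" where
  "torus = {\<zeta>. \<forall>i. cmod (\<zeta> $ i) = 1}"

definition cis_vec :: "real ^ 'n \<Rightarrow> complex ^ 'n" where
  "cis_vec \<theta> = (\<chi> i. cis (\<theta> $ i))"

lemma continuous_cis_vec: "continuous_on UNIV (cis_vec :: real ^ 'n \<Rightarrow> _)"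
  unfolding cis_vec_def cis_conv_exp by (intro continuous_intros)

lemma measurable_cis_vec [measurable]: "cis_vec \<in> borel_measurable borel"
  by (rule borel_measurable_continuous_onI[OF continuous_cis_vec])

lemma torus_measure_eq:
  "torus_measure = distr (uniform_measure lborel (cbox 0 (\<chi> i. 2 * pi))) borel (cis_vec :: real ^ 'n \<Rightarrow> _)"
  unfolding torus_measure_def cis_vec_def ..

lemma emeasure_angle_box:
  "emeasure lborel (cbox 0 (\<chi> i. 2 * pi) :: (real ^ 'n) set) = ennreal ((2 * pi) ^ CARD('n))"
proof -
  have "emeasure lborel (cbox 0 (\<chi> i. 2 * pi) :: (real ^ 'n) set) =
      (\<Prod>b\<in>Basis. ((\<chi> i. 2 * pi) - 0 :: real ^ 'n) \<bullet> b)"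
    by (rule emeasure_lborel_cbox) (auto simp: Basis_vec_def inner_axis)
  also have "(\<Prod>b\<in>Basis. ((\<chi> i. 2 * pi) - 0 :: real ^ 'n) \<bullet> b) = (\<Prod>b\<in>(Basis :: (real ^ 'n) set). 2 * pi)"
    by (rule prod.cong) (auto simp: Basis_vec_def inner_axis)
  finally show ?thesis by simp
qed

lemma prob_space_torus: "prob_space (torus_measure :: (complex ^ 'n) measure)"
  unfolding torus_measure_eq
  by (intro prob_space.prob_space_distr prob_space_uniform_measure)
     (auto simp: emeasure_angle_box)

interpretation torus: prob_space "torus_measure :: (complex ^ 'n) measure"
  by (rule prob_space_torus)

lemma space_torus_measure [simp]: "space torus_measure = UNIV"
  by (simp add: torus_measure_eq)

lemma sets_torus_measure [simp, measurable_cong]: "sets torus_measure = sets borel"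
  by (simp add: torus_measure_eq)

lemma AE_torus: "AE \<zeta> in torus_measure. \<zeta> \<in> (torus :: (complex ^ 'n) set)"
proof -
  have c: "closed (torus :: (complex ^ 'n) set)"
    unfolding torus_def by (intro closed_Collect_all closed_Collect_eq continuous_intros)
  then have "{\<zeta> \<in> space borel. \<zeta> \<in> (torus :: (complex ^ 'n) set)} \<in> sets borel" by simp
  then show ?thesis unfolding torus_measure_eq
    by (subst AE_distr_iff) (auto simp: torus_def cis_vec_def)
qed

lemma emeasure_lborel_shift:
  fixes c :: "'a :: euclidean_space"
  assumes "D \<in> sets borel"
  shows "emeasure lborel {\<theta>. c + \<theta> \<in> D} = emeasure lborel D"
proof -
  have "emeasure lborel D = emeasure (distr lborel borel ((+) c)) D"
    by (simp add: lborel_distr_plus)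
  also have "\<dots> = emeasure lborel {\<theta>. c + \<theta> \<in> D}"
    using assms by (subst emeasure_distr) (auto simp: vimage_def)
  finally show ?thesis ..
qed

text \<open>The half-open box is a fundamental domain for the translations by \<open>2 * pi\<close>; rotating one
  coordinate cuts it into two pieces and moves one of them by a full period, with no overlap.\<close>

definition angle_box :: "(real ^ 'n) set" where
  "angle_box = {\<theta>. \<forall>i. 0 \<le> \<theta> $ i \<and> \<theta> $ i < 2 * pi}"

lemma angle_box_borel [measurable]: "angle_box \<in> sets borel"
proof -
  have "angle_box = (\<Inter>i. {\<theta> :: real ^ 'n. 0 \<le> \<theta> $ i} \<inter> {\<theta>. \<theta> $ i < 2 * pi})"
    unfolding angle_box_def by auto
  also have "\<dots> \<in> sets borel"
    by (intro sets.countable_INT'' sets.Int borel_closed borel_open closed_Collect_le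
        open_Collect_less continuous_intros) auto
  finally show ?thesis .
qed

lemma emeasure_cbox_eq_angle_box:
  assumes "C \<in> sets borel"
  shows "emeasure lborel (cbox 0 (\<chi> i. 2 * pi) \<inter> C) = emeasure lborel (angle_box \<inter> C :: (real ^ 'n) set)"
proof -
  have "AE \<theta> in lborel. \<forall>i::'n. \<theta> $ i \<noteq> 2 * pi"
  proof (subst AE_all_countable, intro allI)
    fix i :: 'n
    have "negligible {\<theta> :: real ^ 'n. axis i 1 \<bullet> \<theta> = 2 * pi}"
      by (rule negligible_hyperplane) (auto simp: axis_eq_0_iff)
    then have "negligible {\<theta> :: real ^ 'n. \<theta> $ i = 2 * pi}"
      by (simp add: inner_axis' )
    then have "{\<theta> :: real ^ 'n. \<theta> $ i = 2 * pi} \<in> null_sets lebesgue"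
      by (simp add: negligible_iff_null_sets)
    moreover have "{\<theta> :: real ^ 'n. \<theta> $ i = 2 * pi} \<in> sets borel"
      by (intro borel_closed closed_Collect_eq continuous_intros)
    ultimately have "{\<theta> :: real ^ 'n. \<theta> $ i = 2 * pi} \<in> null_sets lborel"
      by (auto simp: null_sets_def)
    from AE_not_in[OF this] show "AE \<theta> in lborel. \<theta> $ i \<noteq> 2 * pi" by simp
  qed
  then show ?thesis
    using assms
    by (intro emeasure_eq_AE) (auto simp: angle_box_def mem_box_cart less_le)
qed

lemma emeasure_torus:
  assumes "A \<in> sets borel"
  shows "emeasure torus_measure A =
     emeasure lborel (angle_box \<inter> cis_vec -` A :: (real ^ 'n) set) / ennreal ((2 * pi) ^ CARD('n))"
proof -
  have C: "cis_vec -` A \<in> sets (borel :: (real ^ 'n) measure)"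
    using measurable_sets[OF measurable_cis_vec assms] by simp
  have "emeasure torus_measure A =
     emeasure (uniform_measure lborel (cbox 0 (\<chi> i. 2 * pi))) (cis_vec -` A :: (real ^ 'n) set)"
    unfolding torus_measure_eq using assms
    by (subst emeasure_distr) (auto simp:)
  also have "\<dots> = emeasure lborel (angle_box \<inter> cis_vec -` A :: (real ^ 'n) set) / ennreal ((2 * pi) ^ CARD('n))"
    using C by (subst emeasure_uniform_measure) (auto simp: emeasure_angle_box emeasure_cbox_eq_angle_box)
  finally show ?thesis .
qed

lemma continuous_rotate: "continuous_on UNIV (torus_rot \<eta>)"
  unfolding torus_rot_def by (intro continuous_intros)

lemma measurable_rotate [measurable]: "torus_rot \<eta> \<in> borel_measurable borel"
  by (rule borel_measurable_continuous_onI[OF continuous_rotate])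

text \<open>Shifting the angle box by \<open>t\<close> in direction \<open>j\<close> pushes a slab of width \<open>t\<close> out of it. The
  slab re-enters as the missing slab \<open>V\<close> after a translation by \<open>2 * pi\<close>, which \<open>cis_vec\<close> does not
  see, and Lebesgue measure is translation invariant.\<close>

lemma torus_rotate_coord:
  fixes j :: "'n :: finite"
  assumes "0 \<le> t" "t < 2 * pi"
  shows "distr torus_measure borel (torus_rot (\<chi> i. if i = j then cis t else 1)) = torus_measure"
proof (rule measure_eqI)
  fix A :: "(complex ^ 'n) set" assume "A \<in> sets (distr torus_measure borel (torus_rot (\<chi> i. if i = j then cis t else 1)))"
  then have A: "A \<in> sets borel" by simp
  let ?e = "axis j t :: real ^ 'n" and ?p = "axis j (2 * pi) :: real ^ 'n"
  define C where "C = (cis_vec -` A :: (real ^ 'n) set)"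
  have C [measurable]: "C \<in> sets borel"
    using measurable_sets[OF measurable_cis_vec A] by (simp add: C_def)
  have per: "?p + \<theta> \<in> C \<longleftrightarrow> \<theta> \<in> C" for \<theta>
  proof -
    have "cis_vec (?p + \<theta>) = cis_vec \<theta>"
      by (auto simp: cis_vec_def vec_eq_iff axis_def cis_mult[symmetric])
    then show ?thesis by (simp add: C_def)
  qed
  have rot: "torus_rot (\<chi> i. if i = j then cis t else 1) (cis_vec \<theta>) = cis_vec (?e + \<theta>)" for \<theta>
    by (auto simp: cis_vec_def torus_rot_def vec_eq_iff axis_def cis_mult)
  define U where "U = angle_box \<inter> {\<theta> :: real ^ 'n. t \<le> \<theta> $ j} \<inter> C"
  define V where "V = angle_box \<inter> {\<theta> :: real ^ 'n. \<theta> $ j < t} \<inter> C"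
  have [measurable]: "{\<theta> :: real ^ 'n. t \<le> \<theta> $ j} \<in> sets borel" "{\<theta> :: real ^ 'n. \<theta> $ j < t} \<in> sets borel"
    by (auto intro!: borel_closed borel_open closed_Collect_le open_Collect_less continuous_intros)
  have UV [measurable]: "U \<in> sets borel" "V \<in> sets borel" unfolding U_def V_def by auto
  \<comment> \<open>\<open>V'\<close> is the slab that left the box; its translate by a period is \<open>V\<close>.\<close>
  define V' where "V' = {\<theta>. - ?p + \<theta> \<in> V}"
  have V': "V' \<in> sets borel"
    unfolding V'_def by measurable
  have eqV: "emeasure lborel V' = emeasure lborel V"
    unfolding V'_def by (rule emeasure_lborel_shift) (rule UV)
  have shifted: "{\<theta>. ?e + \<theta> \<in> U \<union> V'} = angle_box \<inter> cis_vec -` (torus_rot (\<chi> i. if i = j then cis t else 1) -` A)"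
  proof -
    have pC: "- ?p + \<theta> \<in> C \<longleftrightarrow> \<theta> \<in> C" for \<theta>
      using per[of "- ?p + \<theta>"] by simp
    have box: "(?e + \<theta> \<in> angle_box \<and> t \<le> (?e + \<theta>) $ j) \<or> (- ?p + (?e + \<theta>) \<in> angle_box \<and> (- ?p + (?e + \<theta>)) $ j < t)
        \<longleftrightarrow> \<theta> \<in> angle_box" for \<theta>
    proof -
      have oth: "(?e + \<theta>) $ i = \<theta> $ i" "(- ?p + (?e + \<theta>)) $ i = \<theta> $ i" if "i \<noteq> j" for i
        using that by (auto simp: axis_def)
      have at: "(?e + \<theta>) $ j = t + \<theta> $ j" "(- ?p + (?e + \<theta>)) $ j = t + \<theta> $ j - 2 * pi"
        by (auto simp: axis_def)
      have split: "\<theta>' \<in> angle_box \<longleftrightarrow> (0 \<le> \<theta>' $ j \<and> \<theta>' $ j < 2 * pi) \<and> (\<forall>i. i \<noteq> j \<longrightarrow> 0 \<le> \<theta>' $ i \<and> \<theta>' $ i < 2 * pi)"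
        for \<theta>' :: "real ^ 'n" unfolding angle_box_def by auto
      show ?thesis unfolding split at using oth assms by (auto simp del: vector_add_component vector_minus_component)
    qed
    have "?e + \<theta> \<in> U \<union> V' \<longleftrightarrow> \<theta> \<in> angle_box \<and> ?e + \<theta> \<in> C" for \<theta>
      unfolding U_def V_def V'_def using box[of \<theta>] pC[of "?e + \<theta>"] by blast
    then have "{\<theta>. ?e + \<theta> \<in> U \<union> V'} = {\<theta>. \<theta> \<in> angle_box \<and> ?e + \<theta> \<in> C}" by simp
    also have "\<dots> = angle_box \<inter> cis_vec -` (torus_rot (\<chi> i. if i = j then cis t else 1) -` A)"
      unfolding C_def vimage_def Int_def mem_Collect_eq rot ..
    finally show ?thesis .
  qed
  have "emeasure lborel (angle_box \<inter> cis_vec -` (torus_rot (\<chi> i. if i = j then cis t else 1) -` A)) = emeasure lborel (U \<union> V')"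
    unfolding shifted[symmetric] by (rule emeasure_lborel_shift) (use UV V' in auto)
  also have "\<dots> = emeasure lborel U + emeasure lborel V'"
  proof (intro plus_emeasure[symmetric])
    have "\<theta> $ j < 2 * pi" if "\<theta> \<in> U" for \<theta>
      using that by (simp add: U_def angle_box_def)
    moreover have "2 * pi \<le> \<theta> $ j" if "\<theta> \<in> V'" for \<theta>
    proof -
      have "0 \<le> (- ?p + \<theta>) $ j" using that unfolding V'_def V_def angle_box_def by blast
      then show ?thesis by (simp add: axis_def)
    qed
    ultimately show "U \<inter> V' = {}" by fastforce
  qed (use UV V' in auto)
  also have "\<dots> = emeasure lborel U + emeasure lborel V" by (simp add: eqV)
  also have "\<dots> = emeasure lborel (U \<union> V)"
    using UV by (intro plus_emeasure) (auto simp: U_def V_def)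
  also have "U \<union> V = angle_box \<inter> cis_vec -` A"
    by (auto simp: U_def V_def C_def)
  finally show "emeasure (distr torus_measure borel (torus_rot (\<chi> i. if i = j then cis t else 1))) A = emeasure torus_measure A"
    using A measurable_sets[OF measurable_rotate A]
    by (subst emeasure_distr) (auto simp: emeasure_torus)
qed simp

lemma torus_rotate:
  fixes \<eta> :: "complex ^ 'n"
  assumes "\<eta> \<in> torus"
  shows "distr torus_measure borel (torus_rot \<eta>) = torus_measure"
proof -
  have "distr torus_measure borel (torus_rot (\<chi> i. if i \<in> S then \<eta> $ i else 1)) = torus_measure"
    if "finite S" for S :: "'n set"
    using that
  proof induction
    case empty
    have "torus_rot (\<chi> i. 1) = (\<lambda>x :: complex ^ 'n. x)" by (auto simp: torus_rot_def)
    then show ?case by (simp add: distr_id2)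
  next
    case (insert j S)
    define t where "t = Arg2pi (\<eta> $ j)"
    have t: "0 \<le> t" "t < 2 * pi" "cis t = \<eta> $ j"
      using Arg2pi[of "\<eta> $ j"] assms by (auto simp: t_def torus_def cis_conv_exp is_Arg_def)
    have "torus_rot (\<chi> i. if i \<in> insert j S then \<eta> $ i else 1) =
      torus_rot (\<chi> i. if i = j then cis t else 1) \<circ> torus_rot (\<chi> i. if i \<in> S then \<eta> $ i else 1)"
      using insert.hyps t by (auto simp: torus_rot_def fun_eq_iff vec_eq_iff)
    then have "distr torus_measure borel (torus_rot (\<chi> i. if i \<in> insert j S then \<eta> $ i else 1)) =
      distr (distr torus_measure borel (torus_rot (\<chi> i. if i \<in> S then \<eta> $ i else 1))) borel
        (torus_rot (\<chi> i. if i = j then cis t else 1))"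
      by (subst distr_distr) simp_all
    then show ?case
      by (simp only: insert.IH torus_rotate_coord[OF t(1,2), of j])
  qed
  from this[of UNIV] show ?thesis by simp
qed

definition monom_fun :: "('n::finite \<Rightarrow> nat) \<Rightarrow> complex ^ 'n \<Rightarrow> complex" where
  "monom_fun \<alpha> z = (\<Prod>i\<in>UNIV. z $ i ^ \<alpha> i)"

lemma continuous_monom_fun [continuous_intros]: "continuous_on A (monom_fun \<alpha>)"
  unfolding monom_fun_def by (intro continuous_intros)

lemma measurable_monom_fun [measurable]: "monom_fun \<alpha> \<in> borel_measurable borel"
  by (rule borel_measurable_continuous_onI[OF continuous_monom_fun])

lemma measurable_cnj_comp [measurable (raw)]:
  "f \<in> borel_measurable M \<Longrightarrow> (\<lambda>x. cnj (f x)) \<in> borel_measurable M"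
  by (rule borel_measurable_continuous_on[where f = cnj]) (intro continuous_intros)

lemma norm_monom_fun_torus: "\<zeta> \<in> torus \<Longrightarrow> cmod (monom_fun \<alpha> \<zeta>) = 1"
  by (simp add: monom_fun_def torus_def prod_norm[symmetric] norm_power prod_eq_1_iff)

lemma monom_fun_rotate: "monom_fun \<alpha> (torus_rot \<eta> \<zeta>) = monom_fun \<alpha> \<eta> * monom_fun \<alpha> \<zeta>"
  by (simp add: monom_fun_def torus_rot_def power_mult_distrib prod.distrib)

lemma integral_torus_rotate:
  fixes f :: "complex ^ 'n \<Rightarrow> complex"
  assumes "\<eta> \<in> torus" "f \<in> borel_measurable borel"
  shows "(\<integral>\<zeta>. f (torus_rot \<eta> \<zeta>) \<partial>torus_measure) = (\<integral>\<zeta>. f \<zeta> \<partial>torus_measure)"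
proof -
  have "(\<integral>\<zeta>. f \<zeta> \<partial>torus_measure) = (\<integral>\<zeta>. f \<zeta> \<partial>distr torus_measure borel (torus_rot \<eta>))"
    by (simp add: torus_rotate[OF assms(1)])
  also have "\<dots> = (\<integral>\<zeta>. f (torus_rot \<eta> \<zeta>) \<partial>torus_measure)"
    by (rule integral_distr) (use assms in auto)
  finally show ?thesis ..
qed

text \<open>A rotation of a coordinate in which the exponents differ multiplies the integral by a constant
  \<open>c\<close> but leaves it unchanged. The angle is chosen such that \<open>c = -1\<close>.\<close>

lemma integral_monom_fun:
  fixes \<alpha> \<beta> :: "'n::finite \<Rightarrow> nat"
  shows "(\<integral>\<zeta>. monom_fun \<alpha> \<zeta> * cnj (monom_fun \<beta> \<zeta>) \<partial>torus_measure) = (if \<alpha> = \<beta> then 1 else 0)"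
proof (cases "\<alpha> = \<beta>")
  case True
  have "(\<integral>\<zeta>. monom_fun \<alpha> \<zeta> * cnj (monom_fun \<beta> \<zeta>) \<partial>torus_measure) = (\<integral>\<zeta>. 1 \<partial>(torus_measure :: (complex ^ 'n) measure))"
    by (rule integral_cong_AE)
       (use AE_torus in \<open>auto simp: True complex_norm_square[symmetric] norm_monom_fun_torus elim!: eventually_mono\<close>)
  then show ?thesis using True by (simp add: torus.prob_space[unfolded space_torus_measure])
next
  case False
  then obtain i where i: "\<alpha> i \<noteq> \<beta> i" by auto
  define t where "t = pi / (real (\<alpha> i) - real (\<beta> i))"
  define \<eta> :: "complex ^ 'n" where "\<eta> = (\<chi> k. if k = i then cis t else 1)"
  have \<eta>: "\<eta> \<in> torus" by (auto simp: \<eta>_def torus_def)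
  let ?I = "(\<integral>\<zeta>. monom_fun \<alpha> \<zeta> * cnj (monom_fun \<beta> \<zeta>) \<partial>torus_measure)"
  define c where "c = monom_fun \<alpha> \<eta> * cnj (monom_fun \<beta> \<eta>)"
  have m: "monom_fun \<gamma> \<eta> = cis (real (\<gamma> i) * t)" for \<gamma>
  proof -
    have "monom_fun \<gamma> \<eta> = (\<Prod>k\<in>UNIV. if k = i then cis t ^ \<gamma> i else 1)"
      unfolding monom_fun_def \<eta>_def by (intro prod.cong) auto
    then show ?thesis by (simp add: Complex.DeMoivre)
  qed
  have "c = cis ((real (\<alpha> i) - real (\<beta> i)) * t)"
    by (simp add: c_def m cis_cnj cis_mult algebra_simps)
  also have "(real (\<alpha> i) - real (\<beta> i)) * t = pi" using i by (simp add: t_def)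
  finally have "c \<noteq> 1" by simp
  have "?I = (\<integral>\<zeta>. monom_fun \<alpha> (torus_rot \<eta> \<zeta>) * cnj (monom_fun \<beta> (torus_rot \<eta> \<zeta>)) \<partial>torus_measure)"
    by (rule integral_torus_rotate[OF \<eta>, symmetric]) measurable
  also have "\<dots> = (\<integral>\<zeta>. c * (monom_fun \<alpha> \<zeta> * cnj (monom_fun \<beta> \<zeta>)) \<partial>torus_measure)"
    by (simp add: monom_fun_rotate c_def mult_ac)
  also have "\<dots> = c * ?I" by simp
  finally have "(1 - c) * ?I = 0" by (simp add: algebra_simps)
  then show ?thesis using False \<open>c \<noteq> 1\<close> by simp
qed

section \<open>Cauchy's formula on the polydisc\<close>

text \<open>Zero outside the polydisc makes these functions Borel measurable on the whole space, so that
  their integrals over circles are genuine integrals.\<close>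

definition disc_fun :: "(complex ^ 'n \<Rightarrow> complex) \<Rightarrow> bool" where
  "disc_fun f \<longleftrightarrow> analytic_polydisc f \<and> (\<forall>z. z \<notin> polydisc \<longrightarrow> f z = 0)"

lemma open_polydisc: "open (polydisc :: (complex ^ 'n) set)"
proof -
  have eq: "polydisc = (\<Inter>i. {z :: complex ^ 'n. cmod (z $ i) < 1})"
    by (auto simp: polydisc_def)
  show ?thesis unfolding eq by (intro open_INT finite ballI open_Collect_less continuous_intros)
qed

lemma convex_polydisc: "convex (polydisc :: (complex ^ 'n) set)"
proof (rule convexI)
  fix x y :: "complex ^ 'n" and u v :: real
  assume xy: "x \<in> polydisc" "y \<in> polydisc" and uv: "0 \<le> u" "0 \<le> v" "u + v = 1"
  show "u *\<^sub>R x + v *\<^sub>R y \<in> polydisc"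
    unfolding polydisc_def
  proof safe
    fix i
    have "u *\<^sub>R x $ i + v *\<^sub>R y $ i \<in> ball 0 1"
      using xy uv by (intro convexD[OF convex_ball]) (auto simp: polydisc_def)
    then show "cmod ((u *\<^sub>R x + v *\<^sub>R y) $ i) < 1" by simp
  qed
qed

lemma analytic_polydisc_continuous: "analytic_polydisc f \<Longrightarrow> continuous_on polydisc f"
  unfolding analytic_polydisc_def
  by (meson continuous_at_imp_continuous_on has_derivative_continuous)

lemma disc_fun_measurable:
  assumes "disc_fun f"
  shows "f \<in> borel_measurable borel"
proof -
  have "(\<lambda>z. if z \<in> polydisc then f z else 0) \<in> borel_measurable borel"
    by (intro borel_measurable_continuous_on_if continuous_intros analytic_polydisc_continuous
        borel_open open_polydisc) (use assms in \<open>auto simp: disc_fun_def\<close>)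
  also have "(\<lambda>z. if z \<in> polydisc then f z else 0) = f"
    using assms by (auto simp: disc_fun_def)
  finally show ?thesis .
qed

lemma analytic_polydisc_line_holomorphic:
  assumes "analytic_polydisc f"
  shows "(\<lambda>l. f (z + l *s v)) holomorphic_on {l. z + l *s v \<in> polydisc}"
  unfolding holomorphic_on_def field_differentiable_def
proof safe
  fix l assume "z + l *s v \<in> polydisc"
  then obtain L where L: "(f has_derivative L) (at (z + l *s v))" "\<And>c v. L (c *s v) = c * L v"
    using assms unfolding analytic_polydisc_def by blast
  have "linear (\<lambda>l. l *s v)"
    by (rule linearI) (auto simp: vec_eq_iff algebra_simps)
  then have "bounded_linear (\<lambda>l. l *s v)"
    by (simp add: linear_conv_bounded_linear)
  from has_derivative_add[OF has_derivative_const bounded_linear_imp_has_derivative[OF this]]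
  have "((\<lambda>l. z + l *s v) has_derivative (\<lambda>l. l *s v)) (at l)" by simp
  from has_derivative_compose[OF this L(1)] have "((\<lambda>l. f (z + l *s v)) has_derivative (\<lambda>l. L (l *s v))) (at l)" .
  then have "((\<lambda>l. f (z + l *s v)) has_derivative (\<lambda>l. L v * l)) (at l)"
    by (simp add: L(2) mult.commute)
  then show "\<exists>f'. ((\<lambda>l. f (z + l *s v)) has_field_derivative f')
      (at l within {l. z + l *s v \<in> polydisc})"
    unfolding has_field_derivative_def by (blast intro: has_derivative_at_withinI)
qed

text \<open>Cauchy's integral formula on the circle of radius \<open>r\<close>, parametrized from the starting phase
  \<open>c\<close>; the Cauchy kernel times \<open>dz\<close> becomes \<open>1 / (1 - w * cnj u / r) dt\<close> with \<open>u\<close> on the unit circle.\<close>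

lemma circle_mean_value:
  assumes h: "h holomorphic_on ball 0 1" and r: "0 < r" "r < 1" and w: "cmod w < r" and c: "cmod c = 1"
  shows "((\<lambda>t. h (of_real r * (c * cis (2 * pi * t))) / (1 - w * cnj (c * cis (2 * pi * t)) / of_real r))
     has_integral h w) {0..1}"
proof -
  define g where "g = (\<lambda>z. h (c * z))"
  have cc: "c * cnj c = 1" using c by (simp add: complex_norm_square[symmetric])
  have "g holomorphic_on cball 0 r" unfolding g_def
    by (rule holomorphic_on_compose_gen[OF _ h, of "(*) c", unfolded o_def])
       (use r c in \<open>auto intro!: holomorphic_intros simp: norm_mult\<close>)
  then have "((\<lambda>u. g u / (u - w * cnj c)) has_contour_integral (2 * of_real pi * \<i> * g (w * cnj c))) (circlepath 0 r)"
    by (rule Cauchy_integral_circlepath_simple) (use w c in \<open>auto simp: norm_mult\<close>)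
  then have "((\<lambda>t. g (circlepath 0 r t) / (circlepath 0 r t - w * cnj c) *
      vector_derivative (circlepath 0 r) (at t within {0..1})) has_integral (2 * of_real pi * \<i> * g (w * cnj c))) {0..1}"
    unfolding has_contour_integral_def .
  then have "((\<lambda>t. (2 * of_real pi * \<i>) * (h (of_real r * (c * cis (2 * pi * t))) / (1 - w * cnj (c * cis (2 * pi * t)) / of_real r)))
      has_integral (2 * of_real pi * \<i> * g (w * cnj c))) {0..1}"
  proof (rule has_integral_eq[rotated])
    fix t :: real assume t: "t \<in> {0..1}"
    define e where "e = cis (2 * pi * t)"
    have e: "e \<noteq> 0" "cnj e = 1 / e" by (simp_all add: e_def cis_cnj divide_inverse)
    have cp: "circlepath 0 r t = of_real r * e"
      by (simp add: circlepath e_def cis_conv_exp mult_ac)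
    have vd: "vector_derivative (circlepath 0 r) (at t within {0..1}) = 2 * of_real pi * \<i> * of_real r * e"
      using t by (subst vector_derivative_circlepath01) (auto simp: e_def cis_conv_exp mult_ac)
    have ne: "of_real r * e - w * cnj c \<noteq> 0"
    proof -
      have "cmod (w * cnj c) < cmod (of_real r * e)"
        using w c r by (simp add: norm_mult e_def)
      then show ?thesis by auto
    qed
    have "1 - w * cnj (c * e) / of_real r = (of_real r * e - w * cnj c) / (of_real r * e)"
      using r e by (simp add: field_simps)
    then show "g (circlepath 0 r t) / (circlepath 0 r t - w * cnj c) *
        vector_derivative (circlepath 0 r) (at t within {0..1}) =
        (2 * of_real pi * \<i>) * (h (of_real r * (c * cis (2 * pi * t))) / (1 - w * cnj (c * cis (2 * pi * t)) / of_real r))"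
      unfolding cp vd e_def[symmetric] g_def using ne by (simp add: mult_ac)
  qed
  from has_integral_mult_right[OF this, of "1 / (2 * of_real pi * \<i>)"]
  have "((\<lambda>t. h (of_real r * (c * cis (2 * pi * t))) / (1 - w * cnj (c * cis (2 * pi * t)) / of_real r))
      has_integral g (w * cnj c)) {0..1}" by simp
  moreover have "c * (w * cnj c) = w" using cc by (metis mult.commute mult.left_commute mult_1_right)
  then have "g (w * cnj c) = h w" by (simp only: g_def)
  ultimately show ?thesis by simp
qed

text \<open>The torus measure is invariant under rotations of the coordinate \<open>j\<close>, so a function may be
  replaced by its averages over these rotations, which are one-variable integrals. In this way
  one-variable formulas enter integrals over the torus.\<close>

lemma integral_torus_average:
  fixes G H :: "complex ^ 'n \<Rightarrow> complex" and j :: "'n :: finite"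
  assumes G: "G \<in> borel_measurable borel" and H: "H \<in> borel_measurable borel" and B: "\<And>\<zeta>. \<zeta> \<in> torus \<Longrightarrow> cmod (G \<zeta>) \<le> B"
    and avg: "\<And>\<zeta>. \<zeta> \<in> torus \<Longrightarrow>
      ((\<lambda>t. G (torus_rot (\<chi> i. if i = j then cis (2 * pi * t) else 1) \<zeta>)) has_integral H \<zeta>) {0..1}"
  shows "(\<integral>\<zeta>. G \<zeta> \<partial>torus_measure) = (\<integral>\<zeta>. H \<zeta> \<partial>torus_measure)"
proof -
  define L where "L = restrict_space lborel {0..1::real}"
  interpret L: prob_space L
    by standard (simp add: L_def emeasure_restrict_space)
  interpret P: pair_prob_space "torus_measure :: (complex ^ 'n) measure" L ..
  define \<eta> where "\<eta> = (\<lambda>t. \<chi> i. if i = j then cis (2 * pi * t) else 1 :: complex ^ 'n)"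
  have \<eta>: "\<eta> t \<in> torus" for t by (simp add: \<eta>_def torus_def)
  define G' where "G' \<zeta> = (if \<zeta> \<in> torus then G \<zeta> else 0)" for \<zeta>
  have "closed (torus :: (complex ^ 'n) set)"
    unfolding torus_def by (intro closed_Collect_all closed_Collect_eq continuous_intros)
  then have [measurable]: "(torus :: (complex ^ 'n) set) \<in> sets borel" by simp
  note G [measurable]
  have G'm [measurable]: "G' \<in> borel_measurable borel"
    unfolding G'_def by measurable
  have bd: "cmod (G' \<zeta>) \<le> max B 0" for \<zeta>
    using B[of \<zeta>] by (auto simp: G'_def)
  have rot: "torus_rot (\<eta> t) \<zeta> \<in> torus \<longleftrightarrow> \<zeta> \<in> torus" for t \<zeta>
    by (auto simp: torus_rot_def \<eta>_def torus_def norm_mult)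
  have "continuous_on UNIV (\<lambda>p :: (complex ^ 'n) \<times> real. torus_rot (\<eta> (snd p)) (fst p))"
  proof -
    have "continuous_on UNIV (\<lambda>p :: (complex ^ 'n) \<times> real. if i = j then cis (2 * pi * snd p) else 1)" for i
      by (cases "i = j") (auto simp: cis_conv_exp intro!: continuous_intros)
    then show ?thesis
      unfolding torus_rot_def \<eta>_def by (auto intro!: continuous_intros)
  qed
  then have m0: "(\<lambda>p :: (complex ^ 'n) \<times> real. torus_rot (\<eta> (snd p)) (fst p)) \<in> borel_measurable (borel \<Otimes>\<^sub>M borel)"
    unfolding borel_prod by (rule borel_measurable_continuous_onI)
  have m1: "(\<lambda>p. p) \<in> measurable ((torus_measure :: (complex ^ 'n) measure) \<Otimes>\<^sub>M L) (borel \<Otimes>\<^sub>M borel)"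
  proof -
    have "(\<lambda>x. x) \<in> measurable L borel" unfolding L_def by (rule measurable_restrict_space1) simp
    then have [measurable]: "(\<lambda>p. snd p) \<in> measurable ((torus_measure :: (complex ^ 'n) measure) \<Otimes>\<^sub>M L) borel"
      by (rule measurable_compose[OF measurable_snd])
    have [measurable]: "(\<lambda>p. fst p) \<in> measurable ((torus_measure :: (complex ^ 'n) measure) \<Otimes>\<^sub>M L) borel"
      by (rule measurable_fst'') auto
    have "(\<lambda>p. (fst p, snd p)) \<in> measurable ((torus_measure :: (complex ^ 'n) measure) \<Otimes>\<^sub>M L) (borel \<Otimes>\<^sub>M borel)"
      by (rule measurable_Pair) measurable
    then show ?thesis by simp
  qed
  have m2: "(\<lambda>p. G' (torus_rot (\<eta> (snd p)) (fst p))) \<in> borel_measurable (torus_measure \<Otimes>\<^sub>M L)"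
    using measurable_compose[OF measurable_compose[OF m1 m0] G'm] by simp
  have int: "integrable (torus_measure \<Otimes>\<^sub>M L) (\<lambda>(\<zeta>, t). G' (torus_rot (\<eta> t) \<zeta>))"
    using m2 by (intro P.integrable_const_bound[where B = "max B 0"]) (auto simp: bd case_prod_beta)
  have inner: "(\<integral>t. G' (torus_rot (\<eta> t) \<zeta>) \<partial>L) = H \<zeta>" if "\<zeta> \<in> torus" for \<zeta>
  proof -
    have G'G: "G' (torus_rot (\<eta> t) \<zeta>) = G (torus_rot (\<eta> t) \<zeta>)" for t
      using that by (simp add: G'_def rot)
    have c: "continuous_on UNIV (\<lambda>t. torus_rot (\<eta> t) \<zeta>)"
    proof -
      have "continuous_on UNIV (\<lambda>t. if i = j then cis (2 * pi * t) else 1)" for i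
        by (cases "i = j") (auto simp: cis_conv_exp intro!: continuous_intros)
      then show ?thesis
        unfolding torus_rot_def \<eta>_def by (auto intro!: continuous_intros)
    qed
    have mt [measurable]: "(\<lambda>t. G' (torus_rot (\<eta> t) \<zeta>)) \<in> borel_measurable borel"
      by (rule measurable_compose[OF borel_measurable_continuous_onI[OF c] G'm])
    have si: "set_integrable lborel {0..1} (\<lambda>t. G' (torus_rot (\<eta> t) \<zeta>))"
      unfolding set_integrable_def
    proof (rule integrableI_bounded_set_indicator[where B = "max B 0"])
      show "AE x in lborel. x \<in> {0..1::real} \<longrightarrow> cmod (G' (torus_rot (\<eta> x) \<zeta>)) \<le> max B 0"
        using bd by auto
    qed auto
    have "(\<integral>t. G' (torus_rot (\<eta> t) \<zeta>) \<partial>L) = (LINT t:{0..1}|lborel. G' (torus_rot (\<eta> t) \<zeta>))"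
      unfolding L_def set_lebesgue_integral_def by (rule integral_restrict_space) auto
    also have "\<dots> = integral {0..1} (\<lambda>t. G' (torus_rot (\<eta> t) \<zeta>))"
      by (rule set_borel_integral_eq_integral(2)[OF si])
    also have "\<dots> = H \<zeta>"
      unfolding G'G using avg[OF that] by (simp add: \<eta>_def integral_unique)
    finally show ?thesis .
  qed
  have "(\<integral>\<zeta>. H \<zeta> \<partial>torus_measure) = (\<integral>\<zeta>. \<integral>t. G' (torus_rot (\<eta> t) \<zeta>) \<partial>L \<partial>torus_measure)"
  proof (rule integral_cong_AE)
    show "(\<lambda>\<zeta>. \<integral>t. G' (torus_rot (\<eta> t) \<zeta>) \<partial>L) \<in> borel_measurable torus_measure"
      using m2 by (intro L.borel_measurable_lebesgue_integral) (simp add: case_prod_beta)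
    show "H \<in> borel_measurable torus_measure" using H by simp
  qed (use AE_torus inner in \<open>auto elim!: eventually_mono\<close>)
  also have "\<dots> = (\<integral>t. \<integral>\<zeta>. G' (torus_rot (\<eta> t) \<zeta>) \<partial>torus_measure \<partial>L)"
    by (rule P.Fubini_integral[symmetric]) (use int in simp)
  also have "\<dots> = (\<integral>t. \<integral>\<zeta>. G' \<zeta> \<partial>torus_measure \<partial>L)"
    by (intro Bochner_Integration.integral_cong refl integral_torus_rotate \<eta> G'm)
  also have "\<dots> = (\<integral>\<zeta>. G' \<zeta> \<partial>torus_measure)"
    using L.prob_space by simp
  also have "\<dots> = (\<integral>\<zeta>. G \<zeta> \<partial>torus_measure)"
    by (rule integral_cong_AE) (use AE_torus in \<open>auto simp: G'_def elim!: eventually_mono\<close>)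
  finally show ?thesis ..
qed

lemma torus_scale_polydisc: "\<zeta> \<in> torus \<Longrightarrow> 0 \<le> r \<Longrightarrow> r < 1 \<Longrightarrow> r *\<^sub>R \<zeta> \<in> polydisc"
  by (simp add: torus_def polydisc_def)

lemma compact_torus: "compact (torus :: (complex ^ 'n) set)"
proof -
  have "bounded (torus :: (complex ^ 'n) set)"
  proof (rule boundedI)
    fix \<zeta> :: "complex ^ 'n" assume "\<zeta> \<in> torus"
    then show "norm \<zeta> \<le> (\<Sum>i\<in>(UNIV :: 'n set). 1)"
      using L2_set_le_sum[of UNIV "\<lambda>i. norm (\<zeta> $ i)"] by (simp add: torus_def norm_vec_def)
  qed
  moreover have "closed (torus :: (complex ^ 'n) set)"
    unfolding torus_def by (intro closed_Collect_all closed_Collect_eq continuous_intros)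
  ultimately show ?thesis by (simp add: compact_eq_bounded_closed)
qed

lemma torus_bounded_continuous:
  fixes f :: "complex ^ 'n \<Rightarrow> complex"
  assumes "continuous_on torus f"
  obtains B where "\<And>\<zeta>. \<zeta> \<in> torus \<Longrightarrow> cmod (f \<zeta>) \<le> B"
  using compact_imp_bounded[OF compact_continuous_image[OF assms compact_torus]]
  unfolding bounded_iff by auto

lemma disc_fun_circle_bounded:
  assumes "disc_fun f" "0 \<le> r" "r < 1"
  obtains B where "\<And>\<zeta>. \<zeta> \<in> torus \<Longrightarrow> cmod (f (r *\<^sub>R \<zeta>)) \<le> B"
proof -
  have "continuous_on torus (\<lambda>\<zeta>. f (r *\<^sub>R \<zeta>))"
  proof (rule continuous_on_compose2[of polydisc f])
    show "continuous_on polydisc f"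
      using assms by (simp add: disc_fun_def analytic_polydisc_continuous)
  qed (use assms in \<open>auto simp: torus_scale_polydisc intro: continuous_intros\<close>)
  from torus_bounded_continuous[OF this] that show ?thesis by blast
qed

lemma measurable_scaleR_disc_fun:
  assumes "disc_fun f"
  shows "(\<lambda>\<zeta>. f (r *\<^sub>R \<zeta>)) \<in> borel_measurable borel"
  by (rule measurable_compose[OF _ disc_fun_measurable[OF assms]]) simp

definition mix_coords :: "'n set \<Rightarrow> complex ^ 'n \<Rightarrow> complex ^ 'n \<Rightarrow> complex ^ 'n" where
  "mix_coords S \<zeta> z = (\<chi> i. if i \<in> S then \<zeta> $ i else z $ i)"

lemma continuous_mix_coords: "continuous_on A (\<lambda>\<zeta>. mix_coords S (g \<zeta>) z)" if "continuous_on A g"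
proof -
  have "continuous_on A (\<lambda>\<zeta>. if i \<in> S then g \<zeta> $ i else z $ i)" for i
    by (cases "i \<in> S") (auto intro!: continuous_intros that)
  then show ?thesis unfolding mix_coords_def by (intro continuous_intros)
qed

text \<open>Induction on the set \<open>S\<close> of coordinates in which the point \<open>z\<close> has been replaced by a point of
  the circle: averaging over one more coordinate is Cauchy's formula for the slice function.\<close>

lemma polydisc_Cauchy:
  fixes f :: "complex ^ 'n \<Rightarrow> complex"
  assumes f: "disc_fun f" and r: "0 < r" "r < 1" and z: "\<And>i. cmod (z $ i) < r"
  shows "f z = (\<integral>\<zeta>. f (r *\<^sub>R \<zeta>) * (\<Prod>i\<in>UNIV. 1 / (1 - z $ i * cnj (\<zeta> $ i) / of_real r)) \<partial>torus_measure)"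
proof -
  define G where "G S \<zeta> = f (mix_coords S (r *\<^sub>R \<zeta>) z) * (\<Prod>i\<in>S. 1 / (1 - z $ i * cnj (\<zeta> $ i) / of_real r))"
    for S :: "'n set" and \<zeta>
  have zp: "z \<in> polydisc" unfolding polydisc_def using less_trans[OF z r(2)] by simp
  have mixp: "mix_coords S (r *\<^sub>R \<zeta>) z \<in> polydisc" if "\<zeta> \<in> torus" for S \<zeta>
    using that zp r by (auto simp: mix_coords_def polydisc_def torus_def)
  have ne: "1 - z $ i * cnj (\<zeta> $ i) / of_real r \<noteq> 0" if "\<zeta> \<in> torus" for i \<zeta>
  proof
    assume "1 - z $ i * cnj (\<zeta> $ i) / of_real r = 0"
    then have "cmod (z $ i * cnj (\<zeta> $ i) / of_real r) = 1" by simp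
    then show False using that z[of i] r by (simp add: norm_mult norm_divide torus_def)
  qed
  have fm: "f \<in> borel_measurable borel" using f by (rule disc_fun_measurable)
  have Gm: "G S \<in> borel_measurable borel" for S
  proof -
    have "continuous_on UNIV (\<lambda>\<zeta>. mix_coords S (r *\<^sub>R \<zeta>) z)"
      by (intro continuous_mix_coords continuous_intros)
    then have 1: "(\<lambda>\<zeta>. f (mix_coords S (r *\<^sub>R \<zeta>) z)) \<in> borel_measurable borel"
      using measurable_compose[OF borel_measurable_continuous_onI fm] by blast
    have [measurable]: "(\<lambda>\<zeta> :: complex ^ 'n. \<zeta> $ i) \<in> borel_measurable borel" for i
      by (intro borel_measurable_continuous_onI continuous_intros)
    have "(\<lambda>\<zeta>. \<Prod>i\<in>S. 1 / (1 - z $ i * cnj (\<zeta> $ i) / of_real r)) \<in> borel_measurable borel"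
      by measurable
    with 1 show ?thesis unfolding G_def by (rule borel_measurable_times)
  qed
  have Gb: "\<exists>B. \<forall>\<zeta>\<in>torus. cmod (G S \<zeta>) \<le> B" for S
  proof -
    have "continuous_on torus (G S)"
      unfolding G_def
    proof (intro continuous_on_mult continuous_on_prod continuous_on_divide)
      show "continuous_on torus (\<lambda>\<zeta>. f (mix_coords S (r *\<^sub>R \<zeta>) z))"
      proof (rule continuous_on_compose2[of polydisc f])
        show "continuous_on polydisc f"
          using f by (simp add: disc_fun_def analytic_polydisc_continuous)
        show "continuous_on torus (\<lambda>\<zeta>. mix_coords S (r *\<^sub>R \<zeta>) z)"
          by (intro continuous_mix_coords continuous_intros)
      qed (use mixp in auto)
    qed (use ne r in \<open>auto intro!: continuous_intros\<close>)
    then show ?thesis by (rule torus_bounded_continuous) blast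
  qed
  have "(\<integral>\<zeta>. G S \<zeta> \<partial>torus_measure) = f z" if "finite S" for S
    using that
  proof induction
    case empty
    then show ?case by (simp add: G_def mix_coords_def torus.prob_space[unfolded space_torus_measure])
  next
    case (insert j S)
    obtain B where B: "\<And>\<zeta>. \<zeta> \<in> torus \<Longrightarrow> cmod (G (insert j S) \<zeta>) \<le> B" using Gb by blast
    have "(\<integral>\<zeta>. G (insert j S) \<zeta> \<partial>torus_measure) = (\<integral>\<zeta>. G S \<zeta> \<partial>torus_measure)"
    proof (rule integral_torus_average[OF Gm Gm B])
      fix \<zeta> :: "complex ^ 'n" assume \<zeta>: "\<zeta> \<in> torus"
      define p where "p = mix_coords S (r *\<^sub>R \<zeta>) z"
      define h where "h l = f (mix_coords {j} 0 p + l *s axis j 1)" for l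
      have upd: "mix_coords {j} 0 p + l *s axis j 1 = (\<chi> i. if i = j then l else p $ i)" for l
        by (auto simp: mix_coords_def vec_eq_iff axis_def)
      have hol: "h holomorphic_on ball 0 1"
        unfolding h_def
        by (rule holomorphic_on_subset[OF analytic_polydisc_line_holomorphic])
           (use f mixp[OF \<zeta>, of S] in \<open>auto simp: disc_fun_def upd p_def[symmetric] polydisc_def\<close>)
      define P where "P = (\<Prod>i\<in>S. 1 / (1 - z $ i * cnj (\<zeta> $ i) / of_real r))"
      define \<eta> where "\<eta> t = torus_rot (\<chi> i. if i = j then cis (2 * pi * t) else 1) \<zeta>" for t
      have \<eta>: "\<eta> t $ i = (if i = j then \<zeta> $ j * cis (2 * pi * t) else \<zeta> $ i)" for t i
        by (simp add: \<eta>_def torus_rot_def)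
      have GS: "G S \<zeta> = h (z $ j) * P"
      proof -
        have "mix_coords {j} 0 p + (z $ j) *s axis j 1 = p"
          unfolding upd using insert.hyps by (auto simp: vec_eq_iff p_def mix_coords_def)
        then show ?thesis by (simp add: G_def h_def P_def p_def)
      qed
      have Gj: "G (insert j S) (\<eta> t) = h (of_real r * (\<zeta> $ j * cis (2 * pi * t))) /
          (1 - z $ j * cnj (\<zeta> $ j * cis (2 * pi * t)) / of_real r) * P" for t
      proof -
        have 1: "mix_coords (insert j S) (r *\<^sub>R \<eta> t) z =
          mix_coords {j} 0 p + (of_real r * (\<zeta> $ j * cis (2 * pi * t))) *s axis j 1"
          unfolding upd by (auto simp: vec_eq_iff mix_coords_def p_def \<eta> scaleR_conv_of_real[where 'a = complex])
        have 2: "(\<Prod>i\<in>S. 1 / (1 - z $ i * cnj (\<eta> t $ i) / of_real r)) = P"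
          unfolding P_def by (rule prod.cong) (use insert.hyps in \<open>auto simp: \<eta>\<close>)
        show ?thesis unfolding G_def 1 prod.insert[OF insert.hyps(1,2)] 2 h_def by (simp add: \<eta>)
      qed
      have "cmod (\<zeta> $ j) = 1" using \<zeta> by (simp add: torus_def)
      from has_integral_mult_left[OF circle_mean_value[OF hol r z this], where c = P]
      show "((\<lambda>t. G (insert j S) (torus_rot (\<chi> i. if i = j then cis (2 * pi * t) else 1) \<zeta>)) has_integral G S \<zeta>) {0..1}"
        unfolding \<eta>_def[symmetric] GS Gj .
    qed
    then show ?case using insert.IH by simp
  qed
  moreover have "mix_coords UNIV \<zeta> z = \<zeta>" for \<zeta> by (simp add: mix_coords_def vec_eq_iff)
  ultimately show ?thesis using G_def by (metis (no_types, lifting) Bochner_Integration.integral_cong finite)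
qed

text \<open>A finite set of multi-indices lies in a box, and over a box the sum factors into a product of
  partial sums of geometric series.\<close>

lemma monom_abs_summable:
  fixes x :: "complex ^ 'n"
  assumes "x \<in> polydisc"
  shows "(\<lambda>\<alpha>. cmod (monom_fun \<alpha> x)) summable_on UNIV"
proof (rule nonneg_bdd_above_summable_on)
  show "bdd_above (sum (\<lambda>\<alpha>. cmod (monom_fun \<alpha> x)) ` {F. F \<subseteq> UNIV \<and> finite F})"
  proof (rule bdd_aboveI2)
    fix F :: "('n \<Rightarrow> nat) set" assume "F \<in> {F. F \<subseteq> UNIV \<and> finite F}"
    then have fin: "finite F" by simp
    define N where "N = Max (insert 0 ((\<lambda>p. (fst p) (snd p)) ` (F \<times> UNIV)))"
    have "F \<subseteq> PiE UNIV (\<lambda>_. {..N})"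
    proof
      fix \<alpha> assume "\<alpha> \<in> F"
      have "\<alpha> i \<le> N" for i
        unfolding N_def
      proof (rule Max_ge)
        show "\<alpha> i \<in> insert 0 ((\<lambda>p. fst p (snd p)) ` (F \<times> UNIV))"
          using \<open>\<alpha> \<in> F\<close> by (intro insertI2 image_eqI[of _ _ "(\<alpha>, i)"]) simp_all
      qed (use fin in simp)
      then show "\<alpha> \<in> PiE UNIV (\<lambda>_. {..N})" by (simp add: PiE_def Pi_def)
    qed
    then have "sum (\<lambda>\<alpha>. cmod (monom_fun \<alpha> x)) F \<le> sum (\<lambda>\<alpha>. cmod (monom_fun \<alpha> x)) (PiE UNIV (\<lambda>_. {..N}))"
      by (intro sum_mono2 finite_PiE) auto
    also have "\<dots> = (\<Prod>i\<in>UNIV. \<Sum>k\<le>N. cmod (x $ i) ^ k)"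
      by (subst prod_sum_PiE) (auto simp: monom_fun_def norm_power prod_norm[symmetric])
    also have "\<dots> \<le> (\<Prod>i\<in>UNIV. 1 / (1 - cmod (x $ i)))"
    proof (intro prod_mono conjI sum_nonneg)
      fix i
      have "(\<Sum>k\<le>N. cmod (x $ i) ^ k) \<le> (\<Sum>k. cmod (x $ i) ^ k)"
        using assms by (intro sum_le_suminf summable_geometric) (auto simp: polydisc_def)
      also have "\<dots> = 1 / (1 - cmod (x $ i))"
        using assms by (intro suminf_geometric) (auto simp: polydisc_def)
      finally show "(\<Sum>k\<le>N. cmod (x $ i) ^ k) \<le> 1 / (1 - cmod (x $ i))" .
    qed auto
    finally show "sum (\<lambda>\<alpha>. cmod (monom_fun \<alpha> x)) F \<le> (\<Prod>i\<in>UNIV. 1 / (1 - cmod (x $ i)))" .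
  qed
qed auto

lemma monom_has_sum:
  fixes x :: "complex ^ 'n"
  assumes "x \<in> polydisc"
  shows "((\<lambda>\<alpha>. monom_fun \<alpha> x) has_sum (\<Prod>i\<in>UNIV. 1 / (1 - x $ i))) UNIV"
proof -
  have nx: "cmod (x $ i) < 1" for i using assms by (simp add: polydisc_def)
  have g: "((\<lambda>k. x $ i ^ k) has_sum 1 / (1 - x $ i)) UNIV" and ga: "(\<lambda>k. norm (x $ i ^ k)) summable_on UNIV" for i
  proof -
    show "(\<lambda>k. norm (x $ i ^ k)) summable_on UNIV"
      unfolding norm_power using nx by (intro summable_nonneg_imp_summable_on summable_geometric) simp_all
    have "(\<lambda>k. x $ i ^ k) sums (1 / (1 - x $ i))" using nx by (rule geometric_sums)
    then show "((\<lambda>k. x $ i ^ k) has_sum 1 / (1 - x $ i)) UNIV"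
      by (rule norm_summable_imp_has_sum[rotated]) (use nx in \<open>simp add: norm_power summable_geometric\<close>)
  qed
  have "infsum (\<lambda>\<alpha>. \<Prod>i\<in>UNIV. x $ i ^ \<alpha> i) (PiE UNIV (\<lambda>_. UNIV)) = (\<Prod>i\<in>UNIV. infsum (\<lambda>k. x $ i ^ k) UNIV)"
    by (rule infsum_prod_PiE_abs) (use ga in auto)
  moreover have "PiE (UNIV :: 'n set) (\<lambda>_. UNIV :: nat set) = UNIV" by auto
  moreover have "infsum (\<lambda>k. x $ i ^ k) UNIV = 1 / (1 - x $ i)" for i using g infsumI by blast
  ultimately have "infsum (\<lambda>\<alpha>. monom_fun \<alpha> x) UNIV = (\<Prod>i\<in>UNIV. 1 / (1 - x $ i))"
    by (simp add: monom_fun_def)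
  moreover have "(\<lambda>\<alpha>. monom_fun \<alpha> x) summable_on UNIV"
    using monom_abs_summable[OF assms] by (rule abs_summable_summable)
  ultimately show ?thesis by (simp add: has_sum_iff)
qed

text \<open>Weierstrass majorants: the partial sums over finite sets converge uniformly, hence in mean.\<close>

lemma has_sum_integral_torus:
  fixes u :: "'a \<Rightarrow> complex ^ 'n \<Rightarrow> complex"
  assumes um: "\<And>a. u a \<in> borel_measurable borel" and Sm: "S \<in> borel_measurable borel"
    and sum: "\<And>\<zeta>. \<zeta> \<in> torus \<Longrightarrow> ((\<lambda>a. u a \<zeta>) has_sum S \<zeta>) UNIV"
    and bd: "\<And>a \<zeta>. \<zeta> \<in> torus \<Longrightarrow> cmod (u a \<zeta>) \<le> B a" and B: "B summable_on UNIV"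
  shows "((\<lambda>a. \<integral>\<zeta>. u a \<zeta> \<partial>torus_measure) has_sum (\<integral>\<zeta>. S \<zeta> \<partial>torus_measure)) UNIV"
proof -
  define T where "T = infsum B UNIV"
  have T: "(B has_sum T) UNIV" using B by (simp add: T_def)
  note um [measurable] and Sm [measurable]
  have ui: "integrable torus_measure (u a)" for a
  proof (rule torus.integrable_const_bound)
    show "AE \<zeta> in torus_measure. cmod (u a \<zeta>) \<le> B a"
      using AE_torus by eventually_elim (rule bd)
  qed simp
  have Sb: "cmod (S \<zeta>) \<le> T" if "\<zeta> \<in> torus" for \<zeta>
    by (rule norm_infsum_le[OF sum[OF that] T]) (use bd that in auto)
  have Si: "integrable torus_measure S"
  proof (rule torus.integrable_const_bound)
    show "AE \<zeta> in torus_measure. cmod (S \<zeta>) \<le> T"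
      using AE_torus by eventually_elim (rule Sb)
  qed simp
  have est: "cmod ((\<Sum>a\<in>A. \<integral>\<zeta>. u a \<zeta> \<partial>torus_measure) - (\<integral>\<zeta>. S \<zeta> \<partial>torus_measure)) \<le> T - sum B A"
    if A: "finite A" for A
  proof -
    have pt: "cmod ((\<Sum>a\<in>A. u a \<zeta>) - S \<zeta>) \<le> T - sum B A" if \<zeta>: "\<zeta> \<in> torus" for \<zeta>
    proof -
      have "cmod (S \<zeta> - (\<Sum>a\<in>A. u a \<zeta>)) \<le> T - sum B A"
        by (rule norm_infsum_le[OF has_sum_Diff[OF sum[OF \<zeta>] has_sum_finite[OF A]] has_sum_Diff[OF T has_sum_finite[OF A]]])
           (use bd \<zeta> in auto)
      then show ?thesis by (simp add: norm_minus_commute)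
    qed
    have "(\<Sum>a\<in>A. \<integral>\<zeta>. u a \<zeta> \<partial>torus_measure) - (\<integral>\<zeta>. S \<zeta> \<partial>torus_measure) =
        (\<integral>\<zeta>. (\<Sum>a\<in>A. u a \<zeta>) - S \<zeta> \<partial>torus_measure)"
      using ui Si by (simp add: Bochner_Integration.integral_diff Bochner_Integration.integral_sum)
    also have "cmod \<dots> \<le> (\<integral>\<zeta>. cmod ((\<Sum>a\<in>A. u a \<zeta>) - S \<zeta>) \<partial>torus_measure)"
      by (rule integral_norm_bound)
    also have "\<dots> \<le> (\<integral>\<zeta>. T - sum B A \<partial>(torus_measure :: (complex ^ 'n) measure))"
    proof (rule integral_mono_AE)
      show "integrable torus_measure (\<lambda>\<zeta>. cmod ((\<Sum>a\<in>A. u a \<zeta>) - S \<zeta>))"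
        using ui Si by (intro integrable_norm Bochner_Integration.integrable_diff Bochner_Integration.integrable_sum)
      show "AE \<zeta> in torus_measure. cmod ((\<Sum>a\<in>A. u a \<zeta>) - S \<zeta>) \<le> T - sum B A"
        using AE_torus by eventually_elim (rule pt)
    qed simp
    finally show ?thesis by (simp add: torus.prob_space[unfolded space_torus_measure])
  qed
  have "((\<lambda>A. T - sum B A) \<longlongrightarrow> T - T) (finite_subsets_at_top UNIV)"
    by (rule tendsto_diff[OF tendsto_const T[unfolded has_sum_def]])
  then have lim: "((\<lambda>A. T - sum B A) \<longlongrightarrow> 0) (finite_subsets_at_top UNIV)" by simp
  have "((\<lambda>A. (\<Sum>a\<in>A. \<integral>\<zeta>. u a \<zeta> \<partial>torus_measure) - (\<integral>\<zeta>. S \<zeta> \<partial>torus_measure)) \<longlongrightarrow> 0) (finite_subsets_at_top UNIV)"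
  proof (rule Lim_null_comparison[rotated, where g = "\<lambda>A. T - sum B A"])
    show "\<forall>\<^sub>F A in finite_subsets_at_top UNIV.
        cmod ((\<Sum>a\<in>A. \<integral>\<zeta>. u a \<zeta> \<partial>torus_measure) - (\<integral>\<zeta>. S \<zeta> \<partial>torus_measure)) \<le> T - sum B A"
      by (rule eventually_finite_subsets_at_top_weakI) (rule est)
  qed (rule lim)
  from LIM_zero_cancel[OF this] show ?thesis unfolding has_sum_def .
qed

section \<open>Power series and their coefficients\<close>

definition deg :: "('n::finite \<Rightarrow> nat) \<Rightarrow> nat" where
  "deg \<alpha> = (\<Sum>i\<in>UNIV. \<alpha> i)"

text \<open>The Fourier coefficient on the circle of radius \<open>1/2\<close>, rescaled. By
  \<open>integral_circle_coef\<close> every other radius gives the same value, and by \<open>power_series\<close> these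
  are the Taylor coefficients.\<close>

definition coef :: "(complex ^ 'n \<Rightarrow> complex) \<Rightarrow> ('n \<Rightarrow> nat) \<Rightarrow> complex" where
  "coef f \<alpha> = 2 ^ deg \<alpha> * (\<integral>\<zeta>. f ((1/2) *\<^sub>R \<zeta>) * cnj (monom_fun \<alpha> \<zeta>) \<partial>torus_measure)"

lemma monom_fun_scaleR: "monom_fun \<alpha> (r *\<^sub>R z) = of_real r ^ deg \<alpha> * monom_fun \<alpha> z"
  by (simp add: monom_fun_def deg_def power_sum prod.distrib power_mult_distrib scaleR_conv_of_real[where 'a = complex])

lemma monom_fun_diagonal: "monom_fun \<alpha> (r *\<^sub>R (\<chi> i. 1)) = of_real r ^ deg \<alpha>"
proof -
  have "monom_fun \<alpha> (\<chi> i. 1) = 1" by (simp add: monom_fun_def)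
  then show ?thesis by (simp only: monom_fun_scaleR mult_1_right)
qed

lemma abs_summable_complex_UNIV: "(f has_sum s) UNIV \<Longrightarrow> (\<lambda>x. cmod (f x)) summable_on UNIV"
  using summable_on_iff_abs_summable_on_complex has_sum_imp_summable by blast

text \<open>Integrating a power series term by term against a monomial leaves a single term, by
  orthogonality. Consequently coefficients are unique and do not depend on the radius.\<close>

lemma integral_circle_monom:
  fixes f :: "complex ^ 'n \<Rightarrow> complex"
  assumes f: "disc_fun f" and s: "0 < s" "s < r" "r \<le> 1"
    and a: "\<And>z. (\<And>i. cmod (z $ i) < r) \<Longrightarrow> ((\<lambda>\<alpha>. a \<alpha> * monom_fun \<alpha> z) has_sum f z) UNIV"
  shows "(\<integral>\<zeta>. f (s *\<^sub>R \<zeta>) * cnj (monom_fun \<beta> \<zeta>) \<partial>torus_measure) = of_real s ^ deg \<beta> * a \<beta>"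
proof -
  let ?u = "\<lambda>\<alpha> \<zeta> :: complex ^ 'n. a \<alpha> * of_real s ^ deg \<alpha> * (monom_fun \<alpha> \<zeta> * cnj (monom_fun \<beta> \<zeta>))"
  have "((\<lambda>\<alpha>. \<integral>\<zeta>. ?u \<alpha> \<zeta> \<partial>torus_measure) has_sum (\<integral>\<zeta>. f (s *\<^sub>R \<zeta>) * cnj (monom_fun \<beta> \<zeta>) \<partial>torus_measure)) UNIV"
  proof (rule has_sum_integral_torus[where B = "\<lambda>\<alpha>. cmod (a \<alpha> * of_real s ^ deg \<alpha>)"])
    show "(\<lambda>\<zeta>. f (s *\<^sub>R \<zeta>) * cnj (monom_fun \<beta> \<zeta>)) \<in> borel_measurable borel"
      using measurable_scaleR_disc_fun[OF f] by measurable
    show "((\<lambda>\<alpha>. ?u \<alpha> \<zeta>) has_sum f (s *\<^sub>R \<zeta>) * cnj (monom_fun \<beta> \<zeta>)) UNIV" if "\<zeta> \<in> torus" for \<zeta> :: "complex ^ 'n"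
    proof -
      have "((\<lambda>\<alpha>. a \<alpha> * monom_fun \<alpha> (s *\<^sub>R \<zeta>)) has_sum f (s *\<^sub>R \<zeta>)) UNIV"
        by (rule a) (use that s in \<open>simp add: torus_def\<close>)
      from has_sum_cmult_left[OF this, of "cnj (monom_fun \<beta> \<zeta>)"] show ?thesis
        by (simp add: monom_fun_scaleR mult_ac)
    qed
    have "((\<lambda>\<alpha>. a \<alpha> * monom_fun \<alpha> (s *\<^sub>R (\<chi> i. 1))) has_sum f (s *\<^sub>R (\<chi> i. 1))) UNIV"
      by (rule a) (use s in simp)
    from abs_summable_complex_UNIV[OF this]
    show "(\<lambda>\<alpha>. cmod (a \<alpha> * of_real s ^ deg \<alpha>)) summable_on UNIV"
      unfolding monom_fun_diagonal .
  qed (auto simp: norm_mult norm_monom_fun_torus)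
  moreover have "(\<lambda>\<alpha>. \<integral>\<zeta>. ?u \<alpha> \<zeta> \<partial>torus_measure) = (\<lambda>\<alpha>. if \<alpha> = \<beta> then of_real s ^ deg \<beta> * a \<beta> else 0)"
    by (rule ext) (simp add: integral_monom_fun del: fun_eq_iff)
  ultimately have 1: "((\<lambda>\<alpha>. if \<alpha> = \<beta> then of_real s ^ deg \<beta> * a \<beta> else 0) has_sum
      (\<integral>\<zeta>. f (s *\<^sub>R \<zeta>) * cnj (monom_fun \<beta> \<zeta>) \<partial>torus_measure)) UNIV" by simp
  have "((\<lambda>\<alpha>. if \<alpha> = \<beta> then of_real s ^ deg \<beta> * a \<beta> else 0) has_sum of_real s ^ deg \<beta> * a \<beta>) UNIV"
    by (rule has_sum_finite_neutralI[of "{\<beta>}"]) auto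
  with 1 show ?thesis by (rule has_sum_unique)
qed

text \<open>Expand the Cauchy kernel of \<open>polydisc_Cauchy\<close> into its geometric series.\<close>

lemma circle_power_series:
  fixes f :: "complex ^ 'n \<Rightarrow> complex"
  assumes f: "disc_fun f" and r: "0 < r" "r < 1" and z: "\<And>i. cmod (z $ i) < r"
  shows "((\<lambda>\<alpha>. (\<integral>\<zeta>. f (r *\<^sub>R \<zeta>) * cnj (monom_fun \<alpha> \<zeta>) \<partial>torus_measure) / of_real r ^ deg \<alpha> * monom_fun \<alpha> z) has_sum f z) UNIV"
proof -
  obtain M where M: "\<And>\<zeta>. \<zeta> \<in> torus \<Longrightarrow> cmod (f (r *\<^sub>R \<zeta>)) \<le> M"
    by (rule disc_fun_circle_bounded[OF f less_imp_le[OF r(1)] r(2)]) (rule that)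
  define x where "x = (\<chi> i. z $ i / of_real r)"
  have x: "x \<in> polydisc" using z r by (simp add: x_def polydisc_def norm_divide)
  let ?u = "\<lambda>\<alpha> \<zeta>. f (r *\<^sub>R \<zeta>) * (monom_fun \<alpha> x * cnj (monom_fun \<alpha> \<zeta>))"
  have monx: "monom_fun \<alpha> x = monom_fun \<alpha> z / of_real r ^ deg \<alpha>" for \<alpha>
    by (simp add: monom_fun_def x_def deg_def power_sum prod_dividef power_divide)
  have "((\<lambda>\<alpha>. \<integral>\<zeta>. ?u \<alpha> \<zeta> \<partial>torus_measure) has_sum
     (\<integral>\<zeta>. f (r *\<^sub>R \<zeta>) * (\<Prod>i\<in>UNIV. 1 / (1 - z $ i * cnj (\<zeta> $ i) / of_real r)) \<partial>torus_measure)) UNIV"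
  proof (rule has_sum_integral_torus[where B = "\<lambda>\<alpha>. M * cmod (monom_fun \<alpha> x)"])
    note [measurable] = measurable_scaleR_disc_fun[OF f]
    have [measurable]: "(\<lambda>\<zeta> :: complex ^ 'n. \<zeta> $ i) \<in> borel_measurable borel" for i
      by (intro borel_measurable_continuous_onI continuous_intros)
    show "(\<lambda>\<zeta>. f (r *\<^sub>R \<zeta>) * (\<Prod>i\<in>UNIV. 1 / (1 - z $ i * cnj (\<zeta> $ i) / of_real r))) \<in> borel_measurable borel"
      by measurable
    show "?u \<alpha> \<in> borel_measurable borel" for \<alpha> by measurable
    show "((\<lambda>\<alpha>. ?u \<alpha> \<zeta>) has_sum f (r *\<^sub>R \<zeta>) * (\<Prod>i\<in>UNIV. 1 / (1 - z $ i * cnj (\<zeta> $ i) / of_real r))) UNIV"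
      if \<zeta>: "\<zeta> \<in> torus" for \<zeta>
    proof -
      have "(\<chi> i. x $ i * cnj (\<zeta> $ i)) \<in> polydisc"
        using x \<zeta> by (simp add: polydisc_def torus_def norm_mult)
      from has_sum_cmult_right[OF monom_has_sum[OF this], of "f (r *\<^sub>R \<zeta>)"] show ?thesis
        by (simp add: x_def monom_fun_def power_mult_distrib power_divide prod.distrib prod_dividef)
    qed
    show "cmod (?u \<alpha> \<zeta>) \<le> M * cmod (monom_fun \<alpha> x)" if "\<zeta> \<in> torus" for \<alpha> \<zeta>
      using M[OF that] by (simp add: norm_mult norm_monom_fun_torus[OF that] mult_right_mono)
    show "(\<lambda>\<alpha>. M * cmod (monom_fun \<alpha> x)) summable_on UNIV"
      by (rule summable_on_cmult_right[OF monom_abs_summable[OF x]])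
  qed
  also have "(\<integral>\<zeta>. f (r *\<^sub>R \<zeta>) * (\<Prod>i\<in>UNIV. 1 / (1 - z $ i * cnj (\<zeta> $ i) / of_real r)) \<partial>torus_measure) = f z"
    by (rule polydisc_Cauchy[OF f r z, symmetric])
  also have "(\<lambda>\<alpha>. \<integral>\<zeta>. ?u \<alpha> \<zeta> \<partial>torus_measure) =
      (\<lambda>\<alpha>. (\<integral>\<zeta>. f (r *\<^sub>R \<zeta>) * cnj (monom_fun \<alpha> \<zeta>) \<partial>torus_measure) / of_real r ^ deg \<alpha> * monom_fun \<alpha> z)"
  proof
    fix \<alpha>
    have "(\<integral>\<zeta>. ?u \<alpha> \<zeta> \<partial>torus_measure) = (\<integral>\<zeta>. monom_fun \<alpha> x * (f (r *\<^sub>R \<zeta>) * cnj (monom_fun \<alpha> \<zeta>)) \<partial>torus_measure)"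
      by (simp add: mult_ac)
    also have "\<dots> = monom_fun \<alpha> x * (\<integral>\<zeta>. f (r *\<^sub>R \<zeta>) * cnj (monom_fun \<alpha> \<zeta>) \<partial>torus_measure)"
      by (rule integral_mult_right_zero)
    also have "\<dots> = (\<integral>\<zeta>. f (r *\<^sub>R \<zeta>) * cnj (monom_fun \<alpha> \<zeta>) \<partial>torus_measure) / of_real r ^ deg \<alpha> * monom_fun \<alpha> z"
    proof -
      have "a / b * c = c / b * a" for a b c :: complex by simp
      then show ?thesis unfolding monx .
    qed
    finally show "(\<integral>\<zeta>. ?u \<alpha> \<zeta> \<partial>torus_measure) =
      (\<integral>\<zeta>. f (r *\<^sub>R \<zeta>) * cnj (monom_fun \<alpha> \<zeta>) \<partial>torus_measure) / of_real r ^ deg \<alpha> * monom_fun \<alpha> z" .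
  qed
  finally show ?thesis .
qed

lemma integral_circle_coef:
  assumes f: "disc_fun f" and r: "0 < r" "r < 1"
  shows "(\<integral>\<zeta>. f (r *\<^sub>R \<zeta>) * cnj (monom_fun \<alpha> \<zeta>) \<partial>torus_measure) = of_real r ^ deg \<alpha> * coef f \<alpha>"
proof -
  define c :: "real \<Rightarrow> complex" where "c s = (\<integral>\<zeta>. f (s *\<^sub>R \<zeta>) * cnj (monom_fun \<alpha> \<zeta>) \<partial>torus_measure) / of_real s ^ deg \<alpha>" for s
  have eq: "c s = c t" if "0 < s" "s < t" "t < 1" for s t
  proof -
    have "(\<integral>\<zeta>. f (s *\<^sub>R \<zeta>) * cnj (monom_fun \<alpha> \<zeta>) \<partial>torus_measure) =
      of_real s ^ deg \<alpha> * ((\<integral>\<zeta>. f (t *\<^sub>R \<zeta>) * cnj (monom_fun \<alpha> \<zeta>) \<partial>torus_measure) / of_real t ^ deg \<alpha>)"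
    proof (rule integral_circle_monom[OF f that(1,2)])
      show "((\<lambda>\<alpha>. (\<integral>\<zeta>. f (t *\<^sub>R \<zeta>) * cnj (monom_fun \<alpha> \<zeta>) \<partial>torus_measure) / of_real t ^ deg \<alpha> * monom_fun \<alpha> z) has_sum f z) UNIV"
        if "\<And>i. cmod (z $ i) < t" for z
        by (rule circle_power_series[OF f _ _ that]) (use \<open>0 < s\<close> \<open>s < t\<close> \<open>t < 1\<close> in auto)
    qed (use that in simp)
    then show ?thesis using that by (simp add: c_def)
  qed
  have "c r = c (1/2)"
  proof (cases r "1/2 :: real" rule: linorder_cases)
    case less
    with r show ?thesis by (intro eq) simp_all
  next
    case greater
    with r show ?thesis by (intro eq[symmetric]) simp_all
  next
    case equal
    then show ?thesis by (simp only:)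
  qed
  moreover have "c (1/2) = coef f \<alpha>"
    by (simp only: c_def coef_def) (simp add: power_divide)
  ultimately have "c r = coef f \<alpha>" by simp
  then show ?thesis using r unfolding c_def by (simp add: divide_eq_eq mult.commute)
qed

lemma power_series:
  fixes f :: "complex ^ 'n \<Rightarrow> complex"
  assumes f: "disc_fun f" and z: "z \<in> polydisc"
  shows "((\<lambda>\<alpha>. coef f \<alpha> * monom_fun \<alpha> z) has_sum f z) UNIV"
proof -
  define m where "m = Max (range (\<lambda>i. cmod (z $ i)))"
  have m: "cmod (z $ i) \<le> m" for i unfolding m_def by (rule Max_ge) auto
  have "m \<in> range (\<lambda>i. cmod (z $ i))" unfolding m_def by (rule Max_in) auto
  then have m1: "0 \<le> m" "m < 1" using z by (auto simp: polydisc_def)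
  define r where "r = (m + 1) / 2"
  have r: "0 < r" "r < 1" "m < r" using m1 by (auto simp: r_def)
  have "((\<lambda>\<alpha>. (\<integral>\<zeta>. f (r *\<^sub>R \<zeta>) * cnj (monom_fun \<alpha> \<zeta>) \<partial>torus_measure) / of_real r ^ deg \<alpha> * monom_fun \<alpha> z) has_sum f z) UNIV"
    by (rule circle_power_series[OF f r(1,2)]) (use m r(3) le_less_trans in blast)
  then show ?thesis using r by (simp add: integral_circle_coef[OF f r(1,2)])
qed

lemma coef_eqI:
  assumes f: "disc_fun f" and a: "\<And>z. z \<in> polydisc \<Longrightarrow> ((\<lambda>\<alpha>. a \<alpha> * monom_fun \<alpha> z) has_sum f z) UNIV"
  shows "coef f = a"
proof
  fix \<alpha>
  have "(\<integral>\<zeta>. f ((1/2) *\<^sub>R \<zeta>) * cnj (monom_fun \<alpha> \<zeta>) \<partial>torus_measure) = of_real (1/2) ^ deg \<alpha> * a \<alpha>"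
    by (rule integral_circle_monom[OF f, where r = 1]) (auto intro: a simp: polydisc_def)
  then show "coef f \<alpha> = a \<alpha>"
    by (simp add: coef_def power_divide)
qed

lemma coef_abs_summable:
  fixes f :: "complex ^ 'n \<Rightarrow> complex"
  assumes "disc_fun f" "0 \<le> r" "r < 1"
  shows "(\<lambda>\<alpha>. cmod (coef f \<alpha>) * r ^ deg \<alpha>) summable_on UNIV"
proof -
  have "r *\<^sub>R (\<chi> i. 1) \<in> (polydisc :: (complex ^ 'n) set)" using assms by (simp add: polydisc_def)
  from abs_summable_complex_UNIV[OF power_series[OF assms(1) this], unfolded monom_fun_diagonal] show ?thesis
    using assms by (simp add: norm_mult norm_power)
qed

lemma has_sum_integral_circle:
  fixes f g :: "complex ^ 'n \<Rightarrow> complex"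
  assumes f: "disc_fun f" and g: "disc_fun g" and r: "0 < r" "r < 1"
  shows "((\<lambda>\<alpha>. coef f \<alpha> * cnj (coef g \<alpha>) * of_real r ^ (2 * deg \<alpha>)) has_sum
      (\<integral>\<zeta>. f (r *\<^sub>R \<zeta>) * cnj (g (r *\<^sub>R \<zeta>)) \<partial>torus_measure)) UNIV"
proof -
  obtain M where M: "\<And>\<zeta>. \<zeta> \<in> torus \<Longrightarrow> cmod (g (r *\<^sub>R \<zeta>)) \<le> M"
    by (rule disc_fun_circle_bounded[OF g less_imp_le[OF r(1)] r(2)]) (rule that)
  let ?u = "\<lambda>\<alpha> \<zeta>. coef f \<alpha> * of_real r ^ deg \<alpha> * cnj (g (r *\<^sub>R \<zeta>) * cnj (monom_fun \<alpha> \<zeta>))"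
  note [measurable] = measurable_scaleR_disc_fun[OF f] measurable_scaleR_disc_fun[OF g]
  have "((\<lambda>\<alpha>. \<integral>\<zeta>. ?u \<alpha> \<zeta> \<partial>torus_measure) has_sum
      (\<integral>\<zeta>. f (r *\<^sub>R \<zeta>) * cnj (g (r *\<^sub>R \<zeta>)) \<partial>torus_measure)) UNIV"
  proof (rule has_sum_integral_torus[where B = "\<lambda>\<alpha>. cmod (coef f \<alpha>) * r ^ deg \<alpha> * M"])
    show "((\<lambda>\<alpha>. ?u \<alpha> \<zeta>) has_sum f (r *\<^sub>R \<zeta>) * cnj (g (r *\<^sub>R \<zeta>))) UNIV" if "\<zeta> \<in> torus" for \<zeta>
      using has_sum_cmult_left[OF power_series[OF f torus_scale_polydisc[OF that, of r]], of "cnj (g (r *\<^sub>R \<zeta>))"] r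
      by (simp add: monom_fun_scaleR mult_ac)
    show "cmod (?u \<alpha> \<zeta>) \<le> cmod (coef f \<alpha>) * r ^ deg \<alpha> * M" if "\<zeta> \<in> torus" for \<alpha> \<zeta>
      using M[OF that] r by (simp add: norm_mult norm_power norm_monom_fun_torus[OF that] mult_left_mono)
    show "(\<lambda>\<alpha>. cmod (coef f \<alpha>) * r ^ deg \<alpha> * M) summable_on UNIV"
      using r by (intro summable_on_cmult_left coef_abs_summable f) auto
  qed measurable
  also have "(\<lambda>\<alpha>. \<integral>\<zeta>. ?u \<alpha> \<zeta> \<partial>torus_measure) = (\<lambda>\<alpha>. coef f \<alpha> * cnj (coef g \<alpha>) * of_real r ^ (2 * deg \<alpha>))"
  proof
    fix \<alpha>
    have "(\<integral>\<zeta>. ?u \<alpha> \<zeta> \<partial>torus_measure) = coef f \<alpha> * of_real r ^ deg \<alpha> *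
        cnj (\<integral>\<zeta>. g (r *\<^sub>R \<zeta>) * cnj (monom_fun \<alpha> \<zeta>) \<partial>torus_measure)"
      by (simp only: integral_mult_right_zero Bochner_Integration.integral_cnj)
    also have "\<dots> = coef f \<alpha> * cnj (coef g \<alpha>) * of_real r ^ (2 * deg \<alpha>)"
      by (simp add: integral_circle_coef[OF g r] power_mult power2_eq_square power_mult_distrib)
    finally show "(\<integral>\<zeta>. ?u \<alpha> \<zeta> \<partial>torus_measure) = coef f \<alpha> * cnj (coef g \<alpha>) * of_real r ^ (2 * deg \<alpha>)" .
  qed
  finally show ?thesis .
qed

section \<open>Power series with bounded coefficients are analytic\<close>

lemma analytic_polydisc_const: "analytic_polydisc (\<lambda>z. c)"
  unfolding analytic_polydisc_def by (auto intro!: exI[of _ "\<lambda>_. 0"])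

lemma analytic_polydisc_coord: "analytic_polydisc (\<lambda>z :: complex ^ 'n. z $ i)"
  unfolding analytic_polydisc_def
proof
  fix z :: "complex ^ 'n"
  have "((\<lambda>z :: complex ^ 'n. z $ i) has_derivative (\<lambda>h. h $ i)) (at z)"
    by (intro bounded_linear_imp_has_derivative bounded_linear_vec_nth)
  then show "\<exists>L. ((\<lambda>z :: complex ^ 'n. z $ i) has_derivative L) (at z) \<and> (\<forall>c v. L (c *s v) = c * L v)"
    by (intro exI[of _ "\<lambda>h. h $ i"]) simp
qed

lemma analytic_polydisc_add:
  assumes "analytic_polydisc f" "analytic_polydisc g"
  shows "analytic_polydisc (\<lambda>z. f z + g z)"
  unfolding analytic_polydisc_def
proof
  fix z :: "complex ^ 'a" assume "z \<in> polydisc"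
  with assms obtain L M where *: "(f has_derivative L) (at z)" "\<forall>c v. L (c *s v) = c * L v"
    "(g has_derivative M) (at z)" "\<forall>c v. M (c *s v) = c * M v"
    unfolding analytic_polydisc_def by meson
  show "\<exists>L. ((\<lambda>z. f z + g z) has_derivative L) (at z) \<and> (\<forall>c v. L (c *s v) = c * L v)"
    by (rule exI[of _ "\<lambda>h. L h + M h"]) (use * in \<open>auto intro!: has_derivative_add simp: algebra_simps\<close>)
qed

lemma analytic_polydisc_mult:
  assumes "analytic_polydisc f" "analytic_polydisc g"
  shows "analytic_polydisc (\<lambda>z. f z * g z)"
  unfolding analytic_polydisc_def
proof
  fix z :: "complex ^ 'a" assume "z \<in> polydisc"
  with assms obtain L M where *: "(f has_derivative L) (at z)" "\<forall>c v. L (c *s v) = c * L v"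
    "(g has_derivative M) (at z)" "\<forall>c v. M (c *s v) = c * M v"
    unfolding analytic_polydisc_def by meson
  show "\<exists>L. ((\<lambda>z. f z * g z) has_derivative L) (at z) \<and> (\<forall>c v. L (c *s v) = c * L v)"
    by (rule exI[of _ "\<lambda>h. f z * M h + L h * g z"]) (use * has_derivative_mult[OF *(1) *(3)] in \<open>auto simp: algebra_simps\<close>)
qed

lemma analytic_polydisc_cong:
  assumes "analytic_polydisc f" "\<And>z. z \<in> polydisc \<Longrightarrow> f z = g z"
  shows "analytic_polydisc g"
  unfolding analytic_polydisc_def
proof
  fix z :: "complex ^ 'a" assume z: "z \<in> polydisc"
  then obtain L where *: "(f has_derivative L) (at z)" "\<forall>c v. L (c *s v) = c * L v"
    using assms(1) unfolding analytic_polydisc_def by meson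
  have "(g has_derivative L) (at z)"
    by (rule has_derivative_transform_within_open[OF *(1) open_polydisc z]) (rule assms(2))
  with * show "\<exists>L. (g has_derivative L) (at z) \<and> (\<forall>c v. L (c *s v) = c * L v)" by blast
qed

lemma analytic_polydisc_power: "analytic_polydisc f \<Longrightarrow> analytic_polydisc (\<lambda>z. f z ^ k)"
  by (induction k) (auto intro: analytic_polydisc_const analytic_polydisc_mult)

lemma analytic_polydisc_prod:
  "finite A \<Longrightarrow> (\<And>i. i \<in> A \<Longrightarrow> analytic_polydisc (f i)) \<Longrightarrow> analytic_polydisc (\<lambda>z. \<Prod>i\<in>A. f i z)"
  by (induction A rule: finite_induct) (auto intro: analytic_polydisc_const analytic_polydisc_mult)

lemma analytic_polydisc_monom: "analytic_polydisc (monom_fun \<alpha>)"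
  unfolding monom_fun_def by (intro analytic_polydisc_prod analytic_polydisc_power analytic_polydisc_coord finite)

text \<open>The bound on the derivative is uniform on the polydisc of radius \<open>\<rho>\<close>, which is what termwise
  differentiation of a power series needs.\<close>

lemma monom_derivative:
  fixes z :: "complex ^ 'n"
  obtains D where "(monom_fun \<alpha> has_derivative D) (at z)" "\<And>c v. D (c *s v) = c * D v"
    "\<And>\<rho> h. 0 < \<rho> \<Longrightarrow> (\<And>i. cmod (z $ i) \<le> \<rho>) \<Longrightarrow> cmod (D h) \<le> real (deg \<alpha>) * \<rho> ^ deg \<alpha> / \<rho> * norm h"
proof -
  define d where "d i = of_nat (\<alpha> i) * z $ i ^ (\<alpha> i - 1) * (\<Prod>j\<in>UNIV - {i}. z $ j ^ \<alpha> j)" for i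
  define D where "D h = (\<Sum>i\<in>UNIV. h $ i * d i)" for h
  have "((\<lambda>z :: complex ^ 'n. \<Prod>i\<in>UNIV. z $ i ^ \<alpha> i) has_derivative
      (\<lambda>h. \<Sum>i\<in>UNIV. (of_nat (\<alpha> i) * h $ i * z $ i ^ (\<alpha> i - 1)) * (\<Prod>j\<in>UNIV - {i}. z $ j ^ \<alpha> j))) (at z)"
    by (intro has_derivative_prod has_derivative_power bounded_linear_imp_has_derivative bounded_linear_vec_nth)
  also have "(\<lambda>z :: complex ^ 'n. \<Prod>i\<in>UNIV. z $ i ^ \<alpha> i) = monom_fun \<alpha>"
    by (simp add: monom_fun_def fun_eq_iff)
  also have "(\<lambda>h. \<Sum>i\<in>UNIV. (of_nat (\<alpha> i) * h $ i * z $ i ^ (\<alpha> i - 1)) * (\<Prod>j\<in>UNIV - {i}. z $ j ^ \<alpha> j)) = D"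
    unfolding D_def d_def by (simp add: mult_ac)
  finally have D: "(monom_fun \<alpha> has_derivative D) (at z)" .
  have lin: "D (c *s v) = c * D v" for c v
    by (simp add: D_def sum_distrib_left mult_ac)
  have bound: "cmod (D h) \<le> real (deg \<alpha>) * \<rho> ^ deg \<alpha> / \<rho> * norm h"
    if \<rho>: "0 < \<rho>" and z: "\<And>i. cmod (z $ i) \<le> \<rho>" for \<rho> h
  proof -
    have di: "cmod (d i) \<le> real (\<alpha> i) * (\<rho> ^ deg \<alpha> / \<rho>)" for i
    proof (cases "\<alpha> i = 0")
      case False
      have "cmod (\<Prod>j\<in>UNIV - {i}. z $ j ^ \<alpha> j) \<le> (\<Prod>j\<in>UNIV - {i}. \<rho> ^ \<alpha> j)"
        unfolding prod_norm[symmetric] norm_power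
        by (intro prod_mono conjI power_mono z) auto
      moreover have "cmod (z $ i ^ (\<alpha> i - 1)) \<le> \<rho> ^ (\<alpha> i - 1)"
        unfolding norm_power by (intro power_mono z) auto
      ultimately have "cmod (d i) \<le> real (\<alpha> i) * \<rho> ^ (\<alpha> i - 1) * (\<Prod>j\<in>UNIV - {i}. \<rho> ^ \<alpha> j)"
        unfolding d_def norm_mult using \<rho> by (intro mult_mono) (auto intro!: mult_nonneg_nonneg prod_nonneg)
      also have "\<rho> ^ (\<alpha> i - 1) = \<rho> ^ \<alpha> i / \<rho>"
        using False \<rho> by (simp add: power_diff)
      also have "real (\<alpha> i) * (\<rho> ^ \<alpha> i / \<rho>) * (\<Prod>j\<in>UNIV - {i}. \<rho> ^ \<alpha> j) = real (\<alpha> i) * ((\<Prod>j\<in>UNIV. \<rho> ^ \<alpha> j) / \<rho>)"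
      proof -
        have "(\<Prod>j\<in>UNIV. \<rho> ^ \<alpha> j) = \<rho> ^ \<alpha> i * (\<Prod>j\<in>UNIV - {i}. \<rho> ^ \<alpha> j)"
          by (rule prod.remove) auto
        then show ?thesis by simp
      qed
      finally show ?thesis by (simp add: deg_def power_sum)
    qed (use \<rho> in \<open>simp add: d_def\<close>)
    have "cmod (D h) \<le> (\<Sum>i\<in>UNIV. norm h * (real (\<alpha> i) * (\<rho> ^ deg \<alpha> / \<rho>)))"
      unfolding D_def
    proof (rule order_trans[OF norm_sum sum_mono])
      fix i
      have "norm (h $ i) \<le> norm h" by (rule Finite_Cartesian_Product.norm_nth_le)
      then show "cmod (h $ i * d i) \<le> norm h * (real (\<alpha> i) * (\<rho> ^ deg \<alpha> / \<rho>))"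
        unfolding norm_mult by (rule mult_mono[OF _ di]) auto
    qed
    also have "\<dots> = real (deg \<alpha>) * \<rho> ^ deg \<alpha> / \<rho> * norm h"
      unfolding sum_distrib_left[symmetric] sum_distrib_right[symmetric] by (simp add: deg_def mult_ac)
    finally show ?thesis .
  qed
  show ?thesis by (rule that[OF D lin bound])
qed

definition of_coef :: "(('n \<Rightarrow> nat) \<Rightarrow> complex) \<Rightarrow> complex ^ 'n \<Rightarrow> complex" where
  "of_coef a z = (if z \<in> polydisc then \<Sum>\<^sub>\<infinity>\<alpha>. a \<alpha> * monom_fun \<alpha> z else 0)"

lemma of_coef_has_sum:
  fixes z :: "complex ^ 'n"
  assumes a: "\<And>\<alpha>. cmod (a \<alpha>) \<le> C" and z: "z \<in> polydisc"
  shows "((\<lambda>\<alpha>. a \<alpha> * monom_fun \<alpha> z) has_sum of_coef a z) UNIV"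
proof -
  have "(\<lambda>\<alpha>. cmod (a \<alpha> * monom_fun \<alpha> z)) summable_on UNIV"
    by (rule summable_on_comparison_test[OF summable_on_cmult_right[OF monom_abs_summable[OF z], of C]])
       (auto simp: norm_mult a mult_right_mono)
  then show ?thesis using z by (simp add: of_coef_def abs_summable_summable has_sum_infsum)
qed

text \<open>With \<open>R\<close> the square root of \<open>\<rho>\<close>, the factor \<open>deg \<alpha> * R ^ deg \<alpha>\<close> is bounded and the
  remaining \<open>R ^ deg \<alpha>\<close> is summable.\<close>

lemma deg_power_summable:
  assumes "0 < \<rho>" "\<rho> < 1"
  shows "(\<lambda>\<alpha> :: 'n::finite \<Rightarrow> nat. real (deg \<alpha>) * \<rho> ^ deg \<alpha>) summable_on UNIV"
proof -
  define R where "R = sqrt \<rho>"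
  have R: "0 < R" "R < 1" "\<rho> = R * R" using assms by (auto simp: R_def)
  have "(\<lambda>n. real n * R ^ n) \<longlonglongrightarrow> 0" using R by (intro powser_times_n_limit_0) auto
  then have "Bseq (\<lambda>n. real n * R ^ n)" by (intro convergent_imp_Bseq convergentI)
  then obtain K where K: "\<And>n. norm (real n * R ^ n) \<le> K" unfolding Bseq_def by blast
  have "R *\<^sub>R (\<chi> i. 1) \<in> (polydisc :: (complex ^ 'n) set)" using R by (simp add: polydisc_def)
  from monom_abs_summable[OF this] have "(\<lambda>\<alpha> :: 'n \<Rightarrow> nat. cmod (of_real R ^ deg \<alpha>)) summable_on UNIV"
    unfolding monom_fun_diagonal .
  then have "(\<lambda>\<alpha> :: 'n \<Rightarrow> nat. K * R ^ deg \<alpha>) summable_on UNIV"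
    using R by (intro summable_on_cmult_right) (simp add: norm_power)
  then show ?thesis
  proof (rule summable_on_comparison_test)
    fix \<alpha> :: "'n \<Rightarrow> nat"
    have "real (deg \<alpha>) * \<rho> ^ deg \<alpha> = (real (deg \<alpha>) * R ^ deg \<alpha>) * R ^ deg \<alpha>"
      by (simp add: R power_mult_distrib)
    also have "\<dots> \<le> K * R ^ deg \<alpha>"
      using K[of "deg \<alpha>"] R by (intro mult_right_mono) auto
    finally show "real (deg \<alpha>) * \<rho> ^ deg \<alpha> \<le> K * R ^ deg \<alpha>" .
  qed (use assms in auto)
qed

lemma infinite_multi_index: "infinite (UNIV :: ('n::finite \<Rightarrow> nat) set)"
proof -
  have "inj (\<lambda>k :: nat. \<lambda>_ :: 'n. k)" by (auto simp: inj_def fun_eq_iff)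
  then show ?thesis by (meson finite_imageD finite_subset infinite_UNIV_nat subset_UNIV)
qed

text \<open>The multi-indices are enumerated by the natural numbers, and the series of derivatives is
  dominated on a smaller polydisc by \<open>deg_power_summable\<close>.\<close>

lemma of_coef_analytic:
  fixes a :: "('n::finite \<Rightarrow> nat) \<Rightarrow> complex"
  assumes a: "\<And>\<alpha>. cmod (a \<alpha>) \<le> C"
  shows "analytic_polydisc (of_coef a)"
  unfolding analytic_polydisc_def
proof
  fix z0 :: "complex ^ 'n" assume z0: "z0 \<in> polydisc"
  define m where "m = Max (range (\<lambda>i. cmod (z0 $ i)))"
  have m: "cmod (z0 $ i) \<le> m" for i unfolding m_def by (rule Max_ge) auto
  have "m \<in> range (\<lambda>i. cmod (z0 $ i))" unfolding m_def by (rule Max_in) auto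
  then have m1: "0 \<le> m" "m < 1" using z0 by (auto simp: polydisc_def)
  define \<rho> where "\<rho> = (m + 1) / 2"
  have \<rho>: "0 < \<rho>" "\<rho> < 1" "m < \<rho>" using m1 by (auto simp: \<rho>_def)
  define S where "S = (\<lambda>z. \<rho> *\<^sub>R z) ` (polydisc :: (complex ^ 'n) set)"
  have Sle: "cmod (z $ i) < \<rho>" if "z \<in> S" for z i
    using that \<rho> by (auto simp: S_def polydisc_def)
  have Spoly: "z \<in> polydisc" if "z \<in> S" for z
    unfolding polydisc_def using less_trans[OF Sle[OF that] \<rho>(2)] by simp
  have openS: "open S" unfolding S_def using \<rho> by (intro open_scaling open_polydisc) auto
  have convS: "convex S" unfolding S_def by (intro convex_scaling convex_polydisc)
  have zS: "z0 \<in> S"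
  proof -
    have "z0 = \<rho> *\<^sub>R ((1 / \<rho>) *\<^sub>R z0)" using \<rho> by simp
    moreover have "(1 / \<rho>) *\<^sub>R z0 \<in> polydisc"
      using \<rho> m by (auto simp: polydisc_def divide_simps intro: le_less_trans)
    ultimately show ?thesis unfolding S_def by blast
  qed
  define e :: "nat \<Rightarrow> ('n \<Rightarrow> nat)" where "e = from_nat_into UNIV"
  have e: "bij_betw e UNIV UNIV"
    unfolding e_def by (rule bij_betw_from_nat_into) (auto simp: infinite_multi_index)
  define Q where "Q \<alpha> z D \<longleftrightarrow> (monom_fun \<alpha> has_derivative D) (at z) \<and> (\<forall>c v. D (c *s v) = c * D v) \<and>
     (\<forall>\<rho> h. 0 < \<rho> \<longrightarrow> (\<forall>i. cmod (z $ i) \<le> \<rho>) \<longrightarrow> cmod (D h) \<le> real (deg \<alpha>) * \<rho> ^ deg \<alpha> / \<rho> * norm h)"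
    for \<alpha> and z :: "complex ^ 'n" and D
  define D where "D \<alpha> z = (SOME d. Q \<alpha> z d)" for \<alpha> z
  have "\<exists>d. Q \<alpha> z d" for \<alpha> z
    unfolding Q_def by (rule monom_derivative[of \<alpha> z]) blast
  then have DQ: "Q \<alpha> z (D \<alpha> z)" for \<alpha> z
    unfolding D_def by (rule someI_ex)
  have D: "(monom_fun \<alpha> has_derivative D \<alpha> z) (at z)" "D \<alpha> z (c *s v) = c * D \<alpha> z v"
    "0 < \<rho> \<Longrightarrow> (\<And>i. cmod (z $ i) \<le> \<rho>) \<Longrightarrow> cmod (D \<alpha> z h) \<le> real (deg \<alpha>) * \<rho> ^ deg \<alpha> / \<rho> * norm h"
    for \<alpha> z c v \<rho> h
    using DQ[of \<alpha> z] unfolding Q_def by blast+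
  define M where "M n = C / \<rho> * (real (deg (e n)) * \<rho> ^ deg (e n))" for n
  have C0: "0 \<le> C" using order_trans[OF norm_ge_zero a] .
  have Msum: "summable M"
  proof -
    have "(\<lambda>n. real (deg (e n)) * \<rho> ^ deg (e n)) summable_on UNIV"
      using summable_on_reindex_bij_betw[OF e, of "\<lambda>\<alpha>. real (deg \<alpha>) * \<rho> ^ deg \<alpha>"] deg_power_summable[OF \<rho>(1,2)] by simp
    then have "summable (\<lambda>n. real (deg (e n)) * \<rho> ^ deg (e n))"
      by (rule summable_on_imp_summable)
    then show ?thesis unfolding M_def by (rule summable_mult)
  qed
  define f' where "f' n z h = a (e n) * D (e n) z h" for n z h
  have f'b: "cmod (f' n z h) \<le> M n * norm h" if "z \<in> S" for n z h
  proof -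
    have "cmod (D (e n) z h) \<le> real (deg (e n)) * \<rho> ^ deg (e n) / \<rho> * norm h"
      using Sle[OF that] \<rho> by (intro D(3)) (auto intro: less_imp_le)
    then have "cmod (f' n z h) \<le> C * (real (deg (e n)) * \<rho> ^ deg (e n) / \<rho> * norm h)"
      unfolding f'_def norm_mult using a C0 by (intro mult_mono) auto
    then show ?thesis by (simp add: M_def mult_ac)
  qed
  have f's: "summable (\<lambda>n. f' n z h)" if "z \<in> S" for z h
    by (rule summable_comparison_test'[where N = 0, OF summable_mult2[OF Msum, of "norm h"]]) (use f'b[OF that] in auto)
  define g' where "g' z h = (\<Sum>n. f' n z h)" for z h
  have "\<exists>g. \<forall>z\<in>S. (\<lambda>n. a (e n) * monom_fun (e n) z) sums (g z) \<and> (g has_derivative g' z) (at z within S)"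
  proof (rule has_derivative_series[OF convS])
    show "((\<lambda>z. a (e n) * monom_fun (e n) z) has_derivative f' n z) (at z within S)" for n z
    proof -
      have "f' n z = (\<lambda>h. a (e n) * D (e n) z h)" by (simp add: fun_eq_iff f'_def)
      with bounded_linear.has_derivative[OF bounded_linear_mult_right has_derivative_at_withinI[OF D(1)[of "e n" z]]]
      show ?thesis by simp
    qed
    show "\<forall>\<^sub>F n in sequentially. \<forall>x\<in>S. \<forall>h. norm (sum (\<lambda>i. f' i x h) {..<n} - g' x h) \<le> \<epsilon> * norm h"
      if "\<epsilon> > 0" for \<epsilon>
    proof -
      have "(\<lambda>n. \<Sum>k. M (k + n)) \<longlonglongrightarrow> 0" by (rule suminf_exist_split2[OF Msum])
      from order_tendstoD(2)[OF this that] show ?thesis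
      proof eventually_elim
        case (elim n)
        show ?case
        proof (intro ballI allI)
          fix x h assume x: "x \<in> S"
          have "g' x h = (\<Sum>k. f' (k + n) x h) + (\<Sum>i<n. f' i x h)"
            unfolding g'_def by (rule suminf_split_initial_segment[OF f's[OF x]])
          then have "norm ((\<Sum>i<n. f' i x h) - g' x h) = norm (\<Sum>k. f' (k + n) x h)"
            by (simp add: norm_minus_commute)
          also have "\<dots> \<le> (\<Sum>k. M (k + n) * norm h)"
            by (rule norm_suminf_le) (use f'b[OF x] Msum in \<open>auto intro!: summable_mult2 summable_ignore_initial_segment\<close>)
          also have "\<dots> = (\<Sum>k. M (k + n)) * norm h"
            by (rule suminf_mult2[symmetric]) (use Msum in \<open>auto intro!: summable_ignore_initial_segment\<close>)
          also have "\<dots> \<le> \<epsilon> * norm h" using elim by (intro mult_right_mono) auto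
          finally show "norm ((\<Sum>i<n. f' i x h) - g' x h) \<le> \<epsilon> * norm h" .
        qed
      qed
    qed
    show "z0 \<in> S" by (rule zS)
    have "((\<lambda>n. a (e n) * monom_fun (e n) z0) has_sum of_coef a z0) UNIV"
      using has_sum_reindex_bij_betw[OF e, of "\<lambda>\<alpha>. a \<alpha> * monom_fun \<alpha> z0"] of_coef_has_sum[OF a z0] by simp
    then show "(\<lambda>n. a (e n) * monom_fun (e n) z0) sums of_coef a z0" by (rule has_sum_imp_sums)
  qed
  then obtain g where g: "\<And>z. z \<in> S \<Longrightarrow> (\<lambda>n. a (e n) * monom_fun (e n) z) sums (g z)"
    "\<And>z. z \<in> S \<Longrightarrow> (g has_derivative g' z) (at z within S)" by blast
  have ga: "g z = of_coef a z" if "z \<in> S" for z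
  proof -
    have "((\<lambda>n. a (e n) * monom_fun (e n) z) has_sum of_coef a z) UNIV"
      using has_sum_reindex_bij_betw[OF e, of "\<lambda>\<alpha>. a \<alpha> * monom_fun \<alpha> z"] of_coef_has_sum[OF a Spoly[OF that]] by simp
    from has_sum_imp_sums[OF this] g(1)[OF that] show ?thesis by (rule sums_unique2[rotated])
  qed
  have "(g has_derivative g' z0) (at z0)"
    using g(2)[OF zS] at_within_open[OF zS openS] by simp
  then have "(of_coef a has_derivative g' z0) (at z0)"
    by (rule has_derivative_transform_within_open[OF _ openS zS]) (rule ga)
  moreover have "g' z0 (c *s v) = c * g' z0 v" for c v
  proof -
    have "f' n z0 (c *s v) = c * f' n z0 v" for n
      by (simp add: f'_def D(2))
    then show ?thesis unfolding g'_def using suminf_mult[OF f's[OF zS]] by simp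
  qed
  ultimately show "\<exists>L. (of_coef a has_derivative L) (at z0) \<and> (\<forall>c v. L (c *s v) = c * L v)" by blast
qed

lemma of_coef_disc_fun: "(\<And>\<alpha>. cmod (a \<alpha>) \<le> C) \<Longrightarrow> disc_fun (of_coef a)"
  unfolding disc_fun_def using of_coef_analytic[of a C] by (auto simp: of_coef_def)

lemma coef_of_coef: "(\<And>\<alpha>. cmod (a \<alpha>) \<le> C) \<Longrightarrow> coef (of_coef a) = a"
  by (rule coef_eqI[OF of_coef_disc_fun of_coef_has_sum]) auto

section \<open>The Hardy space in terms of coefficients\<close>

lemma square_mean_has_sum:
  assumes f: "disc_fun f" and r: "0 < r" "r < 1"
  shows "((\<lambda>\<alpha>. (cmod (coef f \<alpha>))\<^sup>2 * r ^ (2 * deg \<alpha>)) has_sum square_mean f r) UNIV"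
proof -
  have "(\<integral>\<zeta>. f (r *\<^sub>R \<zeta>) * cnj (f (r *\<^sub>R \<zeta>)) \<partial>torus_measure) = of_real (square_mean f r)"
    unfolding square_mean_def complex_norm_square[symmetric] by (rule integral_complex_of_real)
  moreover have "coef f \<alpha> * cnj (coef f \<alpha>) * of_real r ^ (2 * deg \<alpha>) = of_real ((cmod (coef f \<alpha>))\<^sup>2 * r ^ (2 * deg \<alpha>))" for \<alpha>
    by (simp only: complex_norm_square[symmetric] of_real_mult of_real_power)
  ultimately show ?thesis
    using has_sum_integral_circle[OF f f r] by (simp only: has_sum_of_real_iff)
qed

lemma disc_fun_at_0:
  assumes f: "disc_fun f"
  shows "f 0 = coef f (\<lambda>_. 0)"
proof -
  have "((\<lambda>\<alpha>. coef f \<alpha> * monom_fun \<alpha> 0) has_sum f 0) UNIV"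
    by (rule power_series[OF f]) (simp add: polydisc_def)
  moreover have "((\<lambda>\<alpha>. coef f \<alpha> * monom_fun \<alpha> 0) has_sum coef f (\<lambda>_. 0)) UNIV"
    by (rule has_sum_finite_neutralI[of "{\<lambda>_. 0}"]) (auto simp: monom_fun_def fun_eq_iff)
  ultimately show ?thesis by (rule has_sum_unique)
qed

lemma square_mean_0: "square_mean f 0 = (cmod (f 0))\<^sup>2"
  by (simp add: square_mean_def torus.prob_space[unfolded space_torus_measure])

lemma square_mean_le:
  assumes f: "disc_fun f" and s: "((\<lambda>\<alpha>. (cmod (coef f \<alpha>))\<^sup>2) has_sum s) UNIV" and r: "0 \<le> r" "r < 1"
  shows "square_mean f r \<le> s"
proof (cases "r = 0")
  case True
  have "sum (\<lambda>\<alpha>. (cmod (coef f \<alpha>))\<^sup>2) {\<lambda>_. 0} \<le> s"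
    by (rule finite_sum_le_has_sum[OF s]) auto
  then show ?thesis by (simp add: True square_mean_0 disc_fun_at_0[OF f])
next
  case False
  show ?thesis
    by (rule has_sum_mono[OF square_mean_has_sum[OF f] s])
       (use r False in \<open>auto simp: power_le_one intro!: mult_left_le\<close>)
qed

text \<open>Let \<open>r\<close> tend to \<open>1\<close> in a finite part of the sum \<open>square_mean_has_sum\<close>.\<close>

lemma finite_coef_sum_le:
  assumes f: "disc_fun f" and B: "\<And>r. 0 < r \<Longrightarrow> r < 1 \<Longrightarrow> square_mean f r \<le> B" and A: "finite A"
  shows "(\<Sum>\<alpha>\<in>A. (cmod (coef f \<alpha>))\<^sup>2) \<le> B"
proof (rule tendsto_upperbound)
  have "((\<lambda>r. \<Sum>\<alpha>\<in>A. (cmod (coef f \<alpha>))\<^sup>2 * r ^ (2 * deg \<alpha>)) \<longlongrightarrow> (\<Sum>\<alpha>\<in>A. (cmod (coef f \<alpha>))\<^sup>2 * 1 ^ (2 * deg \<alpha>))) (at_left (1::real))"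
    by (rule tendsto_sum, rule tendsto_mult[OF tendsto_const], rule tendsto_power, rule tendsto_ident_at)
  then show "((\<lambda>r. \<Sum>\<alpha>\<in>A. (cmod (coef f \<alpha>))\<^sup>2 * r ^ (2 * deg \<alpha>)) \<longlongrightarrow> (\<Sum>\<alpha>\<in>A. (cmod (coef f \<alpha>))\<^sup>2)) (at_left (1::real))"
    by simp
  have "\<forall>\<^sub>F r in at_left (1::real). r \<in> {0<..<1}" by (rule eventually_at_left_real) simp
  then show "\<forall>\<^sub>F r in at_left 1. (\<Sum>\<alpha>\<in>A. (cmod (coef f \<alpha>))\<^sup>2 * r ^ (2 * deg \<alpha>)) \<le> B"
  proof eventually_elim
    case (elim r)
    then have "(\<Sum>\<alpha>\<in>A. (cmod (coef f \<alpha>))\<^sup>2 * r ^ (2 * deg \<alpha>)) \<le> square_mean f r"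
      by (intro finite_sum_le_has_sum[OF square_mean_has_sum[OF f]] A) auto
    also have "\<dots> \<le> B" using elim by (intro B) auto
    finally show ?case .
  qed
qed simp

lemma H2_disc_fun: "f \<in> H2 \<Longrightarrow> disc_fun f"
  by (simp add: H2_def disc_fun_def)

text \<open>By \<open>square_mean_has_sum\<close> the square mean increases with the radius to the square sum of the
  coefficients.\<close>

lemma H2_iff: "f \<in> H2 \<longleftrightarrow> disc_fun f \<and> (\<lambda>\<alpha>. (cmod (coef f \<alpha>))\<^sup>2) summable_on UNIV"
proof (intro iffI conjI)
  assume f: "f \<in> H2"
  then show d: "disc_fun f" by (rule H2_disc_fun)
  from f obtain B where "\<forall>r\<in>{0..<1}. square_mean f r \<le> B"
    unfolding H2_def bdd_above_def by auto
  then have B: "square_mean f r \<le> B" if "0 < r" "r < 1" for r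
    using that by simp
  show "(\<lambda>\<alpha>. (cmod (coef f \<alpha>))\<^sup>2) summable_on UNIV"
  proof (rule nonneg_bdd_above_summable_on)
    show "bdd_above (sum (\<lambda>\<alpha>. (cmod (coef f \<alpha>))\<^sup>2) ` {F. F \<subseteq> UNIV \<and> finite F})"
      using finite_coef_sum_le[OF d B] by (intro bdd_aboveI2[where M = B]) auto
  qed auto
next
  assume "disc_fun f \<and> (\<lambda>\<alpha>. (cmod (coef f \<alpha>))\<^sup>2) summable_on UNIV"
  then have d: "disc_fun f" and s: "((\<lambda>\<alpha>. (cmod (coef f \<alpha>))\<^sup>2) has_sum infsum (\<lambda>\<alpha>. (cmod (coef f \<alpha>))\<^sup>2) UNIV) UNIV"
    by auto
  have "bdd_above (square_mean f ` {0..<1})"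
    using square_mean_le[OF d s] by (intro bdd_aboveI2) auto
  then show "f \<in> H2" using d by (simp add: H2_def disc_fun_def)
qed

lemma H2_norm_sq:
  assumes f: "f \<in> H2"
  shows "((\<lambda>\<alpha>. (cmod (coef f \<alpha>))\<^sup>2) has_sum (H2_norm f)\<^sup>2) UNIV"
proof -
  have d: "disc_fun f" and s: "((\<lambda>\<alpha>. (cmod (coef f \<alpha>))\<^sup>2) has_sum infsum (\<lambda>\<alpha>. (cmod (coef f \<alpha>))\<^sup>2) UNIV) UNIV"
    using f by (auto simp: H2_iff)
  define t where "t = (SUP r\<in>{0..<1}. square_mean f r)"
  have bdd: "bdd_above (square_mean f ` {0..<1})" using f by (simp add: H2_def)
  have up: "square_mean f r \<le> t" if "0 \<le> r" "r < 1" for r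
    unfolding t_def using that by (intro cSUP_upper[OF _ bdd]) auto
  have "t \<le> infsum (\<lambda>\<alpha>. (cmod (coef f \<alpha>))\<^sup>2) UNIV"
    unfolding t_def using square_mean_le[OF d s] by (intro cSUP_least) auto
  moreover have "infsum (\<lambda>\<alpha>. (cmod (coef f \<alpha>))\<^sup>2) UNIV \<le> t"
    by (rule infsum_le_finite_sums) (use s up in \<open>auto intro!: finite_coef_sum_le[OF d] simp: has_sum_imp_summable\<close>)
  moreover have "0 \<le> t" using up[of 0] by (auto simp: square_mean_0 intro: order_trans[OF zero_le_power2])
  ultimately show ?thesis using s by (simp add: H2_norm_def t_def[symmetric])
qed

lemma disc_fun_add: "disc_fun f \<Longrightarrow> disc_fun g \<Longrightarrow> disc_fun (\<lambda>z. f z + g z)"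
  by (auto simp: disc_fun_def analytic_polydisc_add)

lemma disc_fun_mult: "analytic_polydisc f \<Longrightarrow> disc_fun g \<Longrightarrow> disc_fun (\<lambda>z. f z * g z)"
  by (auto simp: disc_fun_def analytic_polydisc_mult)

lemma coef_add: "disc_fun f \<Longrightarrow> disc_fun g \<Longrightarrow> coef (\<lambda>z. f z + g z) = (\<lambda>\<alpha>. coef f \<alpha> + coef g \<alpha>)"
  by (rule coef_eqI[OF disc_fun_add]) (auto simp: distrib_right intro!: has_sum_add power_series)

lemma coef_cmult: "disc_fun f \<Longrightarrow> coef (\<lambda>z. c * f z) = (\<lambda>\<alpha>. c * coef f \<alpha>)"
  by (rule coef_eqI[OF disc_fun_mult[OF analytic_polydisc_const]]) (auto simp: mult.assoc intro!: has_sum_cmult_right power_series)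

lemma H2_cmult: "f \<in> H2 \<Longrightarrow> (\<lambda>z. c * f z) \<in> H2"
  by (auto simp: H2_iff disc_fun_mult[OF analytic_polydisc_const] coef_cmult norm_mult power_mult_distrib intro!: summable_on_cmult_right)

lemma H2_add:
  assumes "f \<in> H2" "g \<in> H2"
  shows "(\<lambda>z. f z + g z) \<in> H2"
proof -
  have d: "disc_fun f" "disc_fun g" using assms by (auto simp: H2_iff)
  have "(\<lambda>\<alpha>. 2 * (cmod (coef f \<alpha>))\<^sup>2 + 2 * (cmod (coef g \<alpha>))\<^sup>2) summable_on UNIV"
    using assms by (intro summable_on_add summable_on_cmult_right) (auto simp: H2_iff)
  then have "(\<lambda>\<alpha>. (cmod (coef f \<alpha> + coef g \<alpha>))\<^sup>2) summable_on UNIV"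
  proof (rule summable_on_comparison_test)
    fix \<alpha>
    have "(cmod (coef f \<alpha> + coef g \<alpha>))\<^sup>2 \<le> (cmod (coef f \<alpha>) + cmod (coef g \<alpha>))\<^sup>2"
      by (intro power_mono norm_triangle_ineq) auto
    also have "\<dots> \<le> 2 * (cmod (coef f \<alpha>))\<^sup>2 + 2 * (cmod (coef g \<alpha>))\<^sup>2"
      using sum_squares_ge_zero[of "cmod (coef f \<alpha>) - cmod (coef g \<alpha>)" 0] by (simp add: power2_eq_square algebra_simps)
    finally show "(cmod (coef f \<alpha> + coef g \<alpha>))\<^sup>2 \<le> 2 * (cmod (coef f \<alpha>))\<^sup>2 + 2 * (cmod (coef g \<alpha>))\<^sup>2" .
  qed auto
  then show ?thesis using d by (simp add: H2_iff disc_fun_add coef_add)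
qed

lemma polarization_complex:
  fixes a b :: complex
  shows "(\<Sum>k<4. \<i> ^ k * of_real ((cmod (a + \<i> ^ k * b))\<^sup>2)) / 4 = a * cnj b"
proof -
  have "{..<4::nat} = {0,1,2,3}" by auto
  moreover have "\<i> ^ 3 = - \<i>" by (simp add: numeral_3_eq_3)
  ultimately have "(\<Sum>k<4. \<i> ^ k * of_real ((cmod (a + \<i> ^ k * b))\<^sup>2)) =
     of_real ((cmod (a + b))\<^sup>2) + \<i> * of_real ((cmod (a + \<i> * b))\<^sup>2) - of_real ((cmod (a - b))\<^sup>2) - \<i> * of_real ((cmod (a - \<i> * b))\<^sup>2)"
    by (simp add: algebra_simps)
  also have "\<dots> = 4 * (a * cnj b)"
    unfolding complex_norm_square by (simp add: algebra_simps)
  finally show ?thesis by simp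
qed

lemma has_sum_finite_sum:
  fixes f :: "'b \<Rightarrow> 'a \<Rightarrow> complex"
  assumes "finite K" "\<And>k. k \<in> K \<Longrightarrow> (f k has_sum s k) A"
  shows "((\<lambda>x. \<Sum>k\<in>K. f k x) has_sum (\<Sum>k\<in>K. s k)) A"
  using assms by (induction K rule: finite_induct) (auto intro!: has_sum_add)

lemma H2_inner_has_sum:
  assumes f: "f \<in> H2" and g: "g \<in> H2"
  shows "((\<lambda>\<alpha>. coef f \<alpha> * cnj (coef g \<alpha>)) has_sum H2_inner f g) UNIV"
proof -
  have d: "disc_fun f" "disc_fun g" using assms by (auto simp: H2_iff)
  have c: "coef (\<lambda>z. f z + \<i> ^ k * g z) = (\<lambda>\<alpha>. coef f \<alpha> + \<i> ^ k * coef g \<alpha>)" for k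
    using coef_add[OF d(1) disc_fun_mult[OF analytic_polydisc_const d(2)]] coef_cmult[OF d(2)] by simp
  have "((\<lambda>\<alpha>. (\<Sum>k<4. \<i> ^ k * of_real ((cmod (coef f \<alpha> + \<i> ^ k * coef g \<alpha>))\<^sup>2)) / 4) has_sum H2_inner f g) UNIV"
    unfolding H2_inner_def divide_inverse
  proof (intro has_sum_cmult_left has_sum_finite_sum finite_lessThan has_sum_cmult_right)
    fix k :: nat
    show "((\<lambda>\<alpha>. complex_of_real ((cmod (coef f \<alpha> + \<i> ^ k * coef g \<alpha>))\<^sup>2)) has_sum of_real ((H2_norm (\<lambda>z. f z + \<i> ^ k * g z))\<^sup>2)) UNIV"
      unfolding has_sum_of_real_iff
      using H2_norm_sq[OF H2_add[OF f H2_cmult[OF g, of "\<i> ^ k"]]] by (simp add: c)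
  qed
  then show ?thesis unfolding polarization_complex .
qed

section \<open>Hilbert space structure\<close>

abbreviation ip :: "(complex ^ 'n \<Rightarrow> complex) \<Rightarrow> (complex ^ 'n \<Rightarrow> complex) \<Rightarrow> complex" where
  "ip \<equiv> H2_inner"

definition scl :: "complex \<Rightarrow> ('a \<Rightarrow> complex) \<Rightarrow> 'a \<Rightarrow> complex" where
  "scl c f = (\<lambda>z. c * f z)"

lemma scl_apply [simp]: "scl c f z = c * f z" by (simp add: scl_def)

lemma H2_plus: "f \<in> H2 \<Longrightarrow> g \<in> H2 \<Longrightarrow> f + g \<in> H2"
  unfolding plus_fun_def by (rule H2_add)

lemma H2_scl: "f \<in> H2 \<Longrightarrow> scl c f \<in> H2"
  unfolding scl_def by (rule H2_cmult)

lemma minus_eq_plus_scl: "f - g = f + scl (-1) g" for f g :: "'a \<Rightarrow> complex"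
  by (simp add: fun_eq_iff)

lemma H2_minus: "f \<in> H2 \<Longrightarrow> g \<in> H2 \<Longrightarrow> f - g \<in> H2"
  unfolding minus_eq_plus_scl by (intro H2_plus H2_scl)

lemma coef_plus: "f \<in> H2 \<Longrightarrow> g \<in> H2 \<Longrightarrow> coef (f + g) \<alpha> = coef f \<alpha> + coef g \<alpha>"
  unfolding plus_fun_def by (simp add: coef_add H2_disc_fun)

lemma coef_scl: "f \<in> H2 \<Longrightarrow> coef (scl c f) \<alpha> = c * coef f \<alpha>"
  unfolding scl_def by (simp add: coef_cmult H2_disc_fun)

lemma ip_eqI: "f \<in> H2 \<Longrightarrow> g \<in> H2 \<Longrightarrow> ((\<lambda>\<alpha>. coef f \<alpha> * cnj (coef g \<alpha>)) has_sum s) UNIV \<Longrightarrow> ip f g = s"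
  using H2_inner_has_sum has_sum_unique by blast

lemma ip_add_left:
  assumes "f \<in> H2" "g \<in> H2" "h \<in> H2"
  shows "ip (f + g) h = ip f h + ip g h"
  by (rule ip_eqI)
     (use has_sum_add[OF H2_inner_has_sum[OF assms(1,3)] H2_inner_has_sum[OF assms(2,3)]] assms
      in \<open>auto simp: H2_plus coef_plus distrib_right\<close>)

lemma ip_scl_left: "f \<in> H2 \<Longrightarrow> h \<in> H2 \<Longrightarrow> ip (scl c f) h = c * ip f h"
  by (rule ip_eqI) (auto simp: H2_scl coef_scl mult.assoc intro!: has_sum_cmult_right H2_inner_has_sum)

lemma ip_commute: "f \<in> H2 \<Longrightarrow> g \<in> H2 \<Longrightarrow> ip g f = cnj (ip f g)"
  by (rule ip_eqI, assumption+)
     (drule (1) H2_inner_has_sum, subst (asm) has_sum_cnj_iff[symmetric], simp add: mult.commute)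

lemma ip_add_right: "f \<in> H2 \<Longrightarrow> g \<in> H2 \<Longrightarrow> h \<in> H2 \<Longrightarrow> ip h (f + g) = ip h f + ip h g"
  using ip_add_left[of f g h] by (metis H2_plus complex_cnj_add ip_commute)

lemma ip_scl_right: "f \<in> H2 \<Longrightarrow> h \<in> H2 \<Longrightarrow> ip h (scl c f) = cnj c * ip h f"
  using ip_scl_left[of f h c] by (metis H2_scl complex_cnj_mult ip_commute)

lemma ip_diff_left: "f \<in> H2 \<Longrightarrow> g \<in> H2 \<Longrightarrow> h \<in> H2 \<Longrightarrow> ip (f - g) h = ip f h - ip g h"
  unfolding minus_eq_plus_scl by (simp add: ip_add_left ip_scl_left H2_scl)

lemma ip_diff_right: "f \<in> H2 \<Longrightarrow> g \<in> H2 \<Longrightarrow> h \<in> H2 \<Longrightarrow> ip h (f - g) = ip h f - ip h g"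
  unfolding minus_eq_plus_scl by (simp add: ip_add_right ip_scl_right H2_scl)

lemma ip_self: "f \<in> H2 \<Longrightarrow> ip f f = of_real ((H2_norm f)\<^sup>2)"
  by (rule ip_eqI) (auto simp: complex_norm_square[symmetric] has_sum_of_real_iff H2_norm_sq simp del: of_real_power)

lemma coef_0_imp_0:
  assumes f: "f \<in> H2" and c: "\<And>\<alpha>. coef f \<alpha> = 0"
  shows "f = 0"
proof
  fix z
  show "f z = 0 z"
  proof (cases "z \<in> polydisc")
    case True
    have "((\<lambda>\<alpha>. coef f \<alpha> * monom_fun \<alpha> z) has_sum f z) UNIV"
      by (rule power_series[OF H2_disc_fun[OF f] True])
    then have "((\<lambda>\<alpha> :: 'a \<Rightarrow> nat. 0 :: complex) has_sum f z) UNIV" by (simp add: c)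
    from has_sum_unique[OF this has_sum_0_simp] show ?thesis by simp
  qed (use f in \<open>simp add: H2_def\<close>)
qed

lemma ip_self_0: "f \<in> H2 \<Longrightarrow> ip f f = 0 \<Longrightarrow> f = 0"
proof (rule coef_0_imp_0)
  assume f: "f \<in> H2" and "ip f f = 0"
  then have "(H2_norm f)\<^sup>2 = 0" by (simp add: ip_self)
  then have s: "((\<lambda>\<alpha>. (cmod (coef f \<alpha>))\<^sup>2) has_sum 0) UNIV" using H2_norm_sq[OF f] by simp
  show "coef f \<alpha> = 0" for \<alpha>
    using nonneg_has_sum_le_0D[OF s _ _ UNIV_I, of \<alpha>] by simp
qed

lemma H2_norm_nonneg: "f \<in> H2 \<Longrightarrow> 0 \<le> H2_norm f"
proof -
  assume f: "f \<in> H2"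
  have "square_mean f 0 \<le> (SUP r\<in>{0..<1}. square_mean f r)"
    using f by (intro cSUP_upper) (auto simp: H2_def)
  then show ?thesis unfolding H2_norm_def by (intro real_sqrt_ge_zero) (auto simp: square_mean_0 intro: order_trans[OF zero_le_power2])
qed

lemma H2_0: "0 \<in> H2"
proof -
  have "square_mean (0 :: complex ^ 'a \<Rightarrow> complex) r = 0" for r
    by (simp add: square_mean_def)
  moreover have "analytic_polydisc (0 :: complex ^ 'a \<Rightarrow> complex)"
    using analytic_polydisc_const[of 0] by (simp add: zero_fun_def)
  ultimately show ?thesis by (auto simp: H2_def bdd_above_def)
qed

lemma ip_0_left: "h \<in> H2 \<Longrightarrow> ip 0 h = 0" and ip_0_right: "h \<in> H2 \<Longrightarrow> ip h 0 = 0"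
  using ip_scl_left[OF H2_0, of h 0] ip_scl_right[OF H2_0, of h 0]
  by (auto simp: scl_def zero_fun_def)

lemma Cauchy_Schwarz_H2:
  assumes f: "f \<in> H2" and g: "g \<in> H2"
  shows "cmod (ip f g) \<le> H2_norm f * H2_norm g"
proof (cases "H2_norm g = 0")
  case True
  then have "g = 0" using ip_self_0[OF g] by (simp add: ip_self[OF g])
  then have "ip f g = 0" using f by (simp add: ip_0_right)
  then show ?thesis using True by simp
next
  case False
  define N where "N = (H2_norm g)\<^sup>2"
  have N: "0 < N" using False by (simp add: N_def)
  define c where "c = ip f g / of_real N"
  define h where "h = f - scl c g"
  have h: "h \<in> H2" unfolding h_def by (intro H2_minus H2_scl f g)
  have gf: "ip g f = cnj (ip f g)" by (rule ip_commute[OF f g])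
  have "ip h h = ip f f - cnj c * ip f g - c * ip g f + c * cnj c * ip g g"
    unfolding h_def by (simp add: ip_diff_left ip_diff_right ip_scl_left ip_scl_right H2_minus H2_scl f g algebra_simps)
  also have "ip g g = of_real N" by (simp add: ip_self[OF g] N_def)
  also have "ip f f - cnj c * ip f g - c * ip g f + c * cnj c * of_real N = ip f f - ip f g * cnj (ip f g) / of_real N"
    using N by (simp add: c_def gf field_simps)
  also have "\<dots> = of_real ((H2_norm f)\<^sup>2 - (cmod (ip f g))\<^sup>2 / N)"
    by (simp only: ip_self[OF f] complex_norm_square[symmetric] of_real_diff of_real_divide)
  finally have "of_real ((H2_norm h)\<^sup>2) = complex_of_real ((H2_norm f)\<^sup>2 - (cmod (ip f g))\<^sup>2 / N)"
    unfolding ip_self[OF h] .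
  then have "(H2_norm h)\<^sup>2 = (H2_norm f)\<^sup>2 - (cmod (ip f g))\<^sup>2 / N" unfolding of_real_eq_iff .
  then have "(cmod (ip f g))\<^sup>2 / N \<le> (H2_norm f)\<^sup>2" using zero_le_power2[of "H2_norm h"] by linarith
  then have "(cmod (ip f g))\<^sup>2 \<le> (H2_norm f * H2_norm g)\<^sup>2"
    using N by (simp add: N_def divide_le_eq power_mult_distrib)
  then show ?thesis by (rule power2_le_imp_le) (intro mult_nonneg_nonneg H2_norm_nonneg f g)
qed

lemma H2_sum: "finite A \<Longrightarrow> (\<And>i. i \<in> A \<Longrightarrow> f i \<in> H2) \<Longrightarrow> (\<Sum>i\<in>A. f i) \<in> H2"
  by (induction A rule: finite_induct) (auto simp: H2_0 H2_plus)

lemma ip_sum_left: "finite A \<Longrightarrow> (\<And>i. i \<in> A \<Longrightarrow> f i \<in> H2) \<Longrightarrow> h \<in> H2 \<Longrightarrow> ip (\<Sum>i\<in>A. f i) h = (\<Sum>i\<in>A. ip (f i) h)"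
  by (induction A rule: finite_induct) (auto simp: ip_0_left ip_add_left H2_sum)

lemma ip_sum_right: "finite A \<Longrightarrow> (\<And>i. i \<in> A \<Longrightarrow> f i \<in> H2) \<Longrightarrow> h \<in> H2 \<Longrightarrow> ip h (\<Sum>i\<in>A. f i) = (\<Sum>i\<in>A. ip h (f i))"
  by (induction A rule: finite_induct) (auto simp: ip_0_right ip_add_right H2_sum)

lemma Bessel_H2:
  assumes A: "finite A" and e: "\<And>i. i \<in> A \<Longrightarrow> e i \<in> H2"
    and orth: "\<And>i j. i \<in> A \<Longrightarrow> j \<in> A \<Longrightarrow> ip (e i) (e j) = (if i = j then 1 else 0)"
  shows "ip (\<Sum>i\<in>A. scl (c i) (e i)) (\<Sum>i\<in>A. scl (c i) (e i)) = of_real (\<Sum>i\<in>A. (cmod (c i))\<^sup>2)"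
    and "x \<in> H2 \<Longrightarrow> (\<Sum>i\<in>A. (cmod (ip x (e i)))\<^sup>2) \<le> (H2_norm x)\<^sup>2"
proof -
  have main: "ip (\<Sum>i\<in>A. scl (c i) (e i)) (\<Sum>i\<in>A. scl (c i) (e i)) = of_real (\<Sum>i\<in>A. (cmod (c i))\<^sup>2)" for c
  proof -
    have "ip (\<Sum>i\<in>A. scl (c i) (e i)) (\<Sum>j\<in>A. scl (c j) (e j)) = (\<Sum>i\<in>A. \<Sum>j\<in>A. c i * cnj (c j) * ip (e i) (e j))"
    proof -
      define y where "y = (\<Sum>j\<in>A. scl (c j) (e j))"
      have y: "y \<in> H2" unfolding y_def by (intro H2_sum A H2_scl e)
      have "ip (\<Sum>i\<in>A. scl (c i) (e i)) y = (\<Sum>i\<in>A. c i * ip (e i) y)"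
        by (simp add: ip_sum_left A e H2_scl y ip_scl_left)
      also have "\<dots> = (\<Sum>i\<in>A. \<Sum>j\<in>A. c i * cnj (c j) * ip (e i) (e j))"
        unfolding y_def by (intro sum.cong refl)
          (simp add: ip_sum_right A e H2_scl ip_scl_right sum_distrib_left mult.assoc)
      finally show ?thesis unfolding y_def .
    qed
    also have "\<dots> = (\<Sum>i\<in>A. \<Sum>j\<in>A. if i = j then c i * cnj (c i) else 0)"
      by (intro sum.cong refl) (auto simp: orth)
    also have "\<dots> = (\<Sum>i\<in>A. c i * cnj (c i))" using A by simp
    finally show ?thesis by (simp only: complex_norm_square[symmetric] of_real_sum)
  qed
  show "ip (\<Sum>i\<in>A. scl (c i) (e i)) (\<Sum>i\<in>A. scl (c i) (e i)) = of_real (\<Sum>i\<in>A. (cmod (c i))\<^sup>2)" by (rule main)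
  assume x: "x \<in> H2"
  define y where "y = (\<Sum>i\<in>A. scl (ip x (e i)) (e i))"
  define s where "s = (\<Sum>i\<in>A. (cmod (ip x (e i)))\<^sup>2)"
  have y: "y \<in> H2" unfolding y_def by (intro H2_sum A H2_scl e)
  have "(H2_norm y)\<^sup>2 = s"
    using main[of "\<lambda>i. ip x (e i)"] ip_self[OF y] unfolding y_def[symmetric] s_def[symmetric] by (simp del: of_real_power)
  moreover have "ip x y = of_real s"
  proof -
    have "ip x y = (\<Sum>i\<in>A. cnj (ip x (e i)) * ip x (e i))"
      unfolding y_def by (simp add: ip_sum_right A e H2_scl x ip_scl_right)
    also have "\<dots> = of_real s"
      unfolding s_def of_real_sum by (intro sum.cong refl) (simp only: complex_norm_square mult.commute)
    finally show ?thesis .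
  qed
  moreover have s0: "0 \<le> s" unfolding s_def by (intro sum_nonneg) auto
  ultimately have "s \<le> H2_norm x * H2_norm y" using Cauchy_Schwarz_H2[OF x y] by simp
  then have "s\<^sup>2 \<le> (H2_norm x * H2_norm y)\<^sup>2" using s0 by (intro power_mono)
  then have "s * s \<le> (H2_norm x)\<^sup>2 * s" unfolding power_mult_distrib \<open>(H2_norm y)\<^sup>2 = s\<close> by (simp add: power2_eq_square)
  then show "s \<le> (H2_norm x)\<^sup>2" using s0 by (cases "s = 0") auto
qed

text \<open>\<open>H2\<close> contains only functions that vanish outside the polydisc.\<close>

definition restr :: "(complex ^ 'n \<Rightarrow> complex) \<Rightarrow> complex ^ 'n \<Rightarrow> complex" where
  "restr \<phi> = (\<lambda>z. if z \<in> polydisc then \<phi> z else 0)"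

definition mon :: "('n \<Rightarrow> nat) \<Rightarrow> complex ^ 'n \<Rightarrow> complex" where
  "mon \<alpha> = restr (monom_fun \<alpha>)"

lemma disc_fun_restr: "analytic_polydisc \<phi> \<Longrightarrow> disc_fun (restr \<phi>)"
  unfolding disc_fun_def by (auto simp: restr_def intro: analytic_polydisc_cong)

lemma coef_mon: "coef (mon \<alpha>) = (\<lambda>\<beta>. if \<beta> = \<alpha> then 1 else 0)"
proof (rule coef_eqI)
  show "disc_fun (mon \<alpha>)" unfolding mon_def by (intro disc_fun_restr analytic_polydisc_monom)
  fix z :: "complex ^ 'a" assume z: "z \<in> polydisc"
  show "((\<lambda>\<beta>. (if \<beta> = \<alpha> then 1 else 0) * monom_fun \<beta> z) has_sum mon \<alpha> z) UNIV"
    by (rule has_sum_finite_neutralI[of "{\<alpha>}"]) (use z in \<open>auto simp: mon_def restr_def\<close>)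
qed

lemma H2_mon [simp]: "mon \<alpha> \<in> H2"
proof -
  have "(\<lambda>\<beta>. (cmod (coef (mon \<alpha>) \<beta>))\<^sup>2) summable_on UNIV"
    by (rule has_sum_imp_summable[OF has_sum_finite_neutralI[of "{\<alpha>}"]]) (auto simp: coef_mon)
  then show ?thesis
    by (simp add: H2_iff) (simp add: mon_def disc_fun_restr analytic_polydisc_monom)
qed

lemma ip_mon: "f \<in> H2 \<Longrightarrow> ip f (mon \<alpha>) = coef f \<alpha>"
  by (rule ip_eqI) (auto simp: coef_mon intro!: has_sum_finite_neutralI[of "{\<alpha>}"] split: if_splits)

lemma mon_orthonormal: "ip (mon \<alpha>) (mon \<beta>) = (if \<alpha> = \<beta> then 1 else 0)"
  by (simp add: ip_mon coef_mon)

definition bounded_functional :: "((complex ^ 'n \<Rightarrow> complex) \<Rightarrow> complex) \<Rightarrow> real \<Rightarrow> bool" where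
  "bounded_functional L C \<longleftrightarrow> (\<forall>f\<in>H2. \<forall>g\<in>H2. L (f + g) = L f + L g) \<and>
     (\<forall>c. \<forall>f\<in>H2. L (scl c f) = c * L f) \<and> (\<forall>f\<in>H2. cmod (L f) \<le> C * H2_norm f)"

lemma bounded_functional_sum:
  assumes L: "bounded_functional L C" and A: "finite A" and f: "\<And>i. i \<in> A \<Longrightarrow> f i \<in> H2"
  shows "L (\<Sum>i\<in>A. scl (c i) (f i)) = (\<Sum>i\<in>A. c i * L (f i))"
  using A f
proof (induction A rule: finite_induct)
  case empty
  have "L (scl 0 0) = 0 * L 0" using L H2_0 unfolding bounded_functional_def by blast
  moreover have "scl 0 0 = (0 :: complex ^ 'a \<Rightarrow> complex)" by (simp add: fun_eq_iff)
  ultimately show ?case by (simp add: zero_fun_def)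
next
  case (insert i A)
  have fi: "f i \<in> H2" and fA: "(\<Sum>i\<in>A. scl (c i) (f i)) \<in> H2"
    using insert by (auto intro!: H2_sum H2_scl)
  have "L (\<Sum>j\<in>insert i A. scl (c j) (f j)) = L (scl (c i) (f i) + (\<Sum>j\<in>A. scl (c j) (f j)))"
    by (rule arg_cong[where f = L], rule sum.insert[OF insert.hyps])
  also have "\<dots> = L (scl (c i) (f i)) + L (\<Sum>j\<in>A. scl (c j) (f j))"
    using L H2_scl[OF fi] fA unfolding bounded_functional_def by blast
  also have "L (scl (c i) (f i)) = c i * L (f i)"
    using L fi unfolding bounded_functional_def by blast
  also have "L (\<Sum>j\<in>A. scl (c j) (f j)) = (\<Sum>j\<in>A. c j * L (f j))"
    by (rule insert.IH) (use insert.prems in auto)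
  also have "c i * L (f i) + (\<Sum>j\<in>A. c j * L (f j)) = (\<Sum>j\<in>insert i A. c j * L (f j))"
    by (rule sum.insert[OF insert.hyps, symmetric])
  finally show ?case .
qed

text \<open>The monomials are a Hilbert basis: the distance from \<open>f\<close> to its Taylor polynomials tends to
  zero. All density arguments below are applications of this expansion.\<close>

lemma functional_expand:
  assumes L: "bounded_functional L C" and f: "f \<in> H2"
  shows "((\<lambda>\<alpha>. coef f \<alpha> * L (mon \<alpha>)) has_sum L f) UNIV"
proof -
  define p where "p A = (\<Sum>\<alpha>\<in>A. scl (coef f \<alpha>) (mon \<alpha>))" for A
  have pH: "p A \<in> H2" if "finite A" for A unfolding p_def by (intro H2_sum that H2_scl H2_mon)
  define e where "e A = (H2_norm f)\<^sup>2 - (\<Sum>\<alpha>\<in>A. (cmod (coef f \<alpha>))\<^sup>2)" for A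
  have err: "(H2_norm (f - p A))\<^sup>2 = e A" if A: "finite A" for A
  proof -
    define s where "s = (\<Sum>\<alpha>\<in>A. (cmod (coef f \<alpha>))\<^sup>2)"
    have fp: "ip f (p A) = of_real s"
    proof -
      have "ip f (p A) = (\<Sum>\<alpha>\<in>A. cnj (coef f \<alpha>) * coef f \<alpha>)"
        unfolding p_def by (simp add: ip_sum_right A H2_scl f ip_scl_right ip_mon)
      also have "\<dots> = of_real s"
        unfolding s_def of_real_sum by (intro sum.cong refl) (simp only: complex_norm_square mult.commute)
      finally show ?thesis .
    qed
    have pf: "ip (p A) f = of_real s" using ip_commute[OF f pH[OF A]] fp by simp
    have pp: "ip (p A) (p A) = of_real s"
      unfolding p_def s_def by (rule Bessel_H2(1)[OF A]) (auto simp: mon_orthonormal)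
    have "complex_of_real ((H2_norm (f - p A))\<^sup>2) = ip (f - p A) (f - p A)"
      by (simp add: ip_self H2_minus f pH A)
    also have "\<dots> = ip f f - of_real s"
      by (simp add: ip_diff_left ip_diff_right H2_minus f pH A fp pf pp)
    also have "\<dots> = of_real (e A)" by (simp add: ip_self f e_def s_def)
    finally show ?thesis unfolding of_real_eq_iff .
  qed
  have "((\<lambda>A. e A) \<longlongrightarrow> (H2_norm f)\<^sup>2 - (H2_norm f)\<^sup>2) (finite_subsets_at_top UNIV)"
    unfolding e_def by (rule tendsto_diff[OF tendsto_const H2_norm_sq[OF f, unfolded has_sum_def]])
  then have "((\<lambda>A. C * sqrt (e A)) \<longlongrightarrow> C * sqrt 0) (finite_subsets_at_top UNIV)"
    by (intro tendsto_mult tendsto_const tendsto_real_sqrt) simp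
  then have lim: "((\<lambda>A. C * sqrt (e A)) \<longlongrightarrow> 0) (finite_subsets_at_top UNIV)" by simp
  have "((\<lambda>A. (\<Sum>\<alpha>\<in>A. coef f \<alpha> * L (mon \<alpha>)) - L f) \<longlongrightarrow> 0) (finite_subsets_at_top UNIV)"
  proof (rule Lim_null_comparison[rotated, OF lim])
    show "\<forall>\<^sub>F A in finite_subsets_at_top UNIV. cmod ((\<Sum>\<alpha>\<in>A. coef f \<alpha> * L (mon \<alpha>)) - L f) \<le> C * sqrt (e A)"
    proof (rule eventually_finite_subsets_at_top_weakI)
      fix A :: "('a \<Rightarrow> nat) set" assume A: "finite A"
      have "L (f - p A) = L f - L (p A)"
        using L f pH[OF A] unfolding bounded_functional_def minus_eq_plus_scl by (simp add: H2_scl)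
      moreover have "L (p A) = (\<Sum>\<alpha>\<in>A. coef f \<alpha> * L (mon \<alpha>))"
        unfolding p_def by (rule bounded_functional_sum[OF L A]) simp
      moreover have "cmod (L (f - p A)) \<le> C * H2_norm (f - p A)"
        using L H2_minus[OF f pH[OF A]] unfolding bounded_functional_def by blast
      moreover have "H2_norm (f - p A) = sqrt (e A)"
        using H2_norm_nonneg[OF H2_minus[OF f pH[OF A]]] by (simp add: err[OF A, symmetric])
      ultimately show "cmod ((\<Sum>\<alpha>\<in>A. coef f \<alpha> * L (mon \<alpha>)) - L f) \<le> C * sqrt (e A)"
        by (simp add: norm_minus_commute)
    qed
  qed
  from LIM_zero_cancel[OF this] show ?thesis unfolding has_sum_def .
qed

text \<open>Evaluating \<open>L\<close> on the combination of monomials with coefficients \<open>cnj (L (mon \<alpha>))\<close> bounds the square sum of these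
  numbers by \<open>C\<^sup>2\<close>, so they are the coefficients of a member of \<open>H2\<close>, and this function represents \<open>L\<close>.\<close>

lemma Riesz_H2:
  assumes L: "bounded_functional L C"
  shows "\<exists>y\<in>H2. \<forall>f\<in>H2. L f = ip f y"
proof -
  define c where "c \<alpha> = cnj (L (mon \<alpha>))" for \<alpha>
  have fin: "(\<Sum>\<alpha>\<in>A. (cmod (c \<alpha>))\<^sup>2) \<le> C\<^sup>2" if A: "finite A" for A
  proof -
    define p where "p = (\<Sum>\<alpha>\<in>A. scl (c \<alpha>) (mon \<alpha>))"
    define s where "s = (\<Sum>\<alpha>\<in>A. (cmod (c \<alpha>))\<^sup>2)"
    have p: "p \<in> H2" unfolding p_def by (intro H2_sum A H2_scl H2_mon)
    have "L p = (\<Sum>\<alpha>\<in>A. c \<alpha> * L (mon \<alpha>))"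
      unfolding p_def by (rule bounded_functional_sum[OF L A]) simp
    also have "\<dots> = of_real s"
      unfolding s_def of_real_sum by (intro sum.cong refl) (simp add: complex_norm_square c_def del: of_real_power)
    finally have "L p = of_real s" .
    moreover have "ip p p = of_real s"
      unfolding p_def s_def by (rule Bessel_H2(1)[OF A]) (auto simp: mon_orthonormal)
    then have n: "(H2_norm p)\<^sup>2 = s" by (simp add: ip_self[OF p] del: of_real_power)
    moreover have s0: "0 \<le> s" unfolding s_def by (intro sum_nonneg) auto
    moreover have "cmod (L p) \<le> C * H2_norm p" using L p unfolding bounded_functional_def by blast
    ultimately have "s \<le> C * H2_norm p" by simp
    then have "s\<^sup>2 \<le> (C * H2_norm p)\<^sup>2" using s0 by (intro power_mono)
    then have "s * s \<le> C\<^sup>2 * s" unfolding power_mult_distrib n by (simp add: power2_eq_square)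
    then show "s \<le> C\<^sup>2" using s0 by (cases "s = 0") auto
  qed
  have cb: "cmod (c \<alpha>) \<le> \<bar>C\<bar>" for \<alpha>
    using fin[of "{\<alpha>}"] by (simp add: abs_le_square_iff[symmetric])
  define y where "y = of_coef c"
  have cy: "coef y = c" unfolding y_def by (rule coef_of_coef[OF cb])
  have "(\<lambda>\<alpha>. (cmod (c \<alpha>))\<^sup>2) summable_on UNIV"
    by (rule nonneg_bdd_above_summable_on) (auto intro!: bdd_aboveI2[where M = "C\<^sup>2"] fin)
  then have y: "y \<in> H2" by (simp add: H2_iff cy) (simp add: y_def of_coef_disc_fun[OF cb])
  have "L f = ip f y" if f: "f \<in> H2" for f
    using ip_eqI[OF f y] functional_expand[OF L f] by (simp add: cy c_def)
  with y show ?thesis by blast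
qed

section \<open>Multiplication operators and their adjoints\<close>

lemma H_infty_bound:
  assumes "\<phi> \<in> H_infty"
  obtains B where "0 \<le> B" "\<And>z. z \<in> polydisc \<Longrightarrow> cmod (\<phi> z) \<le> B"
proof -
  from assms have "bounded (\<phi> ` polydisc)" by (simp add: H_infty_def)
  then obtain B where B: "\<And>x. x \<in> \<phi> ` polydisc \<Longrightarrow> norm x \<le> B" unfolding bounded_iff by blast
  show ?thesis by (rule that[of "max B 0"]) (use B in \<open>auto simp: le_max_iff_disj\<close>)
qed

lemma H_inftyI: "analytic_polydisc \<phi> \<Longrightarrow> (\<And>z. z \<in> polydisc \<Longrightarrow> cmod (\<phi> z) \<le> B) \<Longrightarrow> \<phi> \<in> H_infty"
  unfolding H_infty_def bounded_iff by auto

lemma H_infty_times: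
  assumes "\<phi> \<in> H_infty" "\<psi> \<in> H_infty"
  shows "\<phi> * \<psi> \<in> H_infty"
proof -
  obtain B where B: "0 \<le> B" "\<And>z. z \<in> polydisc \<Longrightarrow> cmod (\<phi> z) \<le> B" by (rule H_infty_bound[OF assms(1)]) (rule that)
  obtain C where C: "0 \<le> C" "\<And>z. z \<in> polydisc \<Longrightarrow> cmod (\<psi> z) \<le> C" by (rule H_infty_bound[OF assms(2)]) (rule that)
  show ?thesis
  proof (rule H_inftyI[where B = "B * C"])
    show "analytic_polydisc (\<phi> * \<psi>)" unfolding times_fun_def
      using assms by (intro analytic_polydisc_mult) (auto simp: H_infty_def)
    show "cmod ((\<phi> * \<psi>) z) \<le> B * C" if "z \<in> polydisc" for z
      using B C that by (auto simp: norm_mult intro!: mult_mono)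
  qed
qed

definition coord :: "'n::finite \<Rightarrow> complex ^ 'n \<Rightarrow> complex" where
  "coord i = (\<lambda>z. z $ i)"

lemma coord_H_infty [simp]: "coord i \<in> H_infty"
  by (rule H_inftyI[where B = 1]) (auto simp: coord_def analytic_polydisc_coord polydisc_def intro: less_imp_le)

lemma norm_monom_fun_le_1: "z \<in> polydisc \<Longrightarrow> cmod (monom_fun \<alpha> z) \<le> 1"
  unfolding monom_fun_def prod_norm[symmetric] norm_power
  by (intro prod_le_1 conjI power_le_one) (auto simp: polydisc_def intro: less_imp_le)

lemma monom_H_infty [simp]: "monom_fun \<alpha> \<in> H_infty"
  by (rule H_inftyI[where B = 1]) (auto simp: analytic_polydisc_monom norm_monom_fun_le_1)

lemma restr_H_infty: "\<phi> \<in> H_infty \<Longrightarrow> restr \<phi> \<in> H_infty"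
  unfolding H_infty_def bounded_iff by (auto simp: restr_def intro: analytic_polydisc_cong)

lemma mon_H_infty [simp]: "mon \<alpha> \<in> H_infty"
  unfolding mon_def by (intro restr_H_infty monom_H_infty)

lemma square_mean_times_le:
  assumes f: "f \<in> H2" and g: "disc_fun (\<phi> * f)" and B: "\<And>z. z \<in> polydisc \<Longrightarrow> cmod (\<phi> z) \<le> B" and r: "0 \<le> r" "r < 1"
  shows "square_mean (\<phi> * f) r \<le> B\<^sup>2 * square_mean f r"
proof -
  have int: "integrable torus_measure (\<lambda>\<zeta>. (cmod (h (r *\<^sub>R \<zeta>)))\<^sup>2)" if h: "disc_fun h" for h
  proof -
    obtain M where M: "\<And>\<zeta>. \<zeta> \<in> torus \<Longrightarrow> cmod (h (r *\<^sub>R \<zeta>)) \<le> M"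
      by (rule disc_fun_circle_bounded[OF h r]) (rule that)
    note [measurable] = measurable_scaleR_disc_fun[OF h]
    show ?thesis
    proof (rule torus.integrable_const_bound)
      show "AE \<zeta> in torus_measure. norm ((cmod (h (r *\<^sub>R \<zeta>)))\<^sup>2) \<le> M\<^sup>2"
        using AE_torus by eventually_elim (simp add: M power_mono)
    qed measurable
  qed
  have "square_mean (\<phi> * f) r \<le> (\<integral>\<zeta>. B\<^sup>2 * (cmod (f (r *\<^sub>R \<zeta>)))\<^sup>2 \<partial>torus_measure)"
    unfolding square_mean_def
  proof (rule integral_mono_AE)
    show "AE \<zeta> in torus_measure. (cmod ((\<phi> * f) (r *\<^sub>R \<zeta>)))\<^sup>2 \<le> B\<^sup>2 * (cmod (f (r *\<^sub>R \<zeta>)))\<^sup>2"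
      using AE_torus
    proof eventually_elim
      case (elim \<zeta>)
      from B[OF torus_scale_polydisc[OF elim r]] show ?case
        by (simp add: norm_mult power_mult_distrib[symmetric] power_mono mult_right_mono)
    qed
  qed (intro int g Bochner_Integration.integrable_mult_right H2_disc_fun[OF f])+
  then show ?thesis by (simp add: square_mean_def)
qed

lemma H2_times_bound:
  assumes \<phi>: "\<phi> \<in> H_infty" and f: "f \<in> H2" and B: "0 \<le> B" "\<And>z. z \<in> polydisc \<Longrightarrow> cmod (\<phi> z) \<le> B"
  shows "\<phi> * f \<in> H2" and "H2_norm (\<phi> * f) \<le> B * H2_norm f"
proof -
  have d: "disc_fun (\<phi> * f)" unfolding times_fun_def
    using \<phi> by (intro disc_fun_mult H2_disc_fun[OF f]) (simp add: H_infty_def)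
  have le: "square_mean (\<phi> * f) r \<le> B\<^sup>2 * (H2_norm f)\<^sup>2" if "0 \<le> r" "r < 1" for r
  proof -
    have "square_mean (\<phi> * f) r \<le> B\<^sup>2 * square_mean f r"
      by (rule square_mean_times_le[OF f d B(2) that])
    also have "\<dots> \<le> B\<^sup>2 * (H2_norm f)\<^sup>2"
      by (intro mult_left_mono square_mean_le[OF H2_disc_fun[OF f] H2_norm_sq[OF f] that]) auto
    finally show ?thesis .
  qed
  show H: "\<phi> * f \<in> H2"
    using d le by (auto simp: H2_def disc_fun_def intro!: bdd_aboveI2)
  have "(H2_norm (\<phi> * f))\<^sup>2 \<le> B\<^sup>2 * (H2_norm f)\<^sup>2"
    by (rule has_sum_le_finite_sums[OF H2_norm_sq[OF H]]) (auto intro!: finite_coef_sum_le[OF d] le)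
  then have "(H2_norm (\<phi> * f))\<^sup>2 \<le> (B * H2_norm f)\<^sup>2" by (simp add: power_mult_distrib)
  then show "H2_norm (\<phi> * f) \<le> B * H2_norm f"
    by (rule power2_le_imp_le) (intro mult_nonneg_nonneg B(1) H2_norm_nonneg f)
qed

lemma H2_times: "\<phi> \<in> H_infty \<Longrightarrow> f \<in> H2 \<Longrightarrow> \<phi> * f \<in> H2"
  by (rule H_infty_bound, assumption) (rule H2_times_bound(1))

lemma times_plus: "\<phi> * (f + g) = \<phi> * f + \<phi> * g" and times_scl: "\<phi> * scl c f = scl c (\<phi> * f)"
  and times_minus: "\<phi> * (f - g) = \<phi> * f - \<phi> * g"
  for f g :: "'a \<Rightarrow> complex"
  by (simp_all add: fun_eq_iff algebra_simps)

lemma ip_ext: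
  assumes "x \<in> H2" "y \<in> H2" "\<And>h. h \<in> H2 \<Longrightarrow> ip x h = ip y h"
  shows "x = y"
proof -
  have d: "x - y \<in> H2" by (intro H2_minus assms)
  have "ip (x - y) (x - y) = 0" using assms d by (simp add: ip_diff_left)
  from ip_self_0[OF d this] show ?thesis by simp
qed

lemma bounded_functional_times:
  assumes \<phi>: "\<phi> \<in> H_infty" and f: "f \<in> H2"
  shows "\<exists>C. bounded_functional (\<lambda>h. ip (\<phi> * h) f) C"
proof -
  obtain B where B: "0 \<le> B" "\<And>z. z \<in> polydisc \<Longrightarrow> cmod (\<phi> z) \<le> B" by (rule H_infty_bound[OF \<phi>]) (rule that)
  have "bounded_functional (\<lambda>h. ip (\<phi> * h) f) (B * H2_norm f)"
    unfolding bounded_functional_def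
  proof (intro conjI ballI allI)
    fix g h :: "complex ^ 'a \<Rightarrow> complex" and c assume g: "g \<in> H2"
    show "ip (\<phi> * scl c g) f = c * ip (\<phi> * g) f"
      by (simp add: times_scl ip_scl_left H2_times \<phi> f g)
    have "cmod (ip (\<phi> * g) f) \<le> H2_norm (\<phi> * g) * H2_norm f"
      by (intro Cauchy_Schwarz_H2 H2_times \<phi> f g)
    also have "\<dots> \<le> (B * H2_norm g) * H2_norm f"
      by (intro mult_right_mono H2_times_bound(2) \<phi> g B H2_norm_nonneg f)
    finally show "cmod (ip (\<phi> * g) f) \<le> B * H2_norm f * H2_norm g" by (simp add: mult_ac)
    assume h: "h \<in> H2"
    show "ip (\<phi> * (g + h)) f = ip (\<phi> * g) f + ip (\<phi> * h) f"
      by (simp add: times_plus ip_add_left H2_times \<phi> f g h)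
  qed
  then show ?thesis ..
qed

text \<open>The Hilbert space adjoint of multiplication by \<open>\<phi>\<close>, that is, the Toeplitz operator with symbol
  \<open>cnj \<phi>\<close>.\<close>

definition adj :: "(complex ^ 'n \<Rightarrow> complex) \<Rightarrow> (complex ^ 'n \<Rightarrow> complex) \<Rightarrow> complex ^ 'n \<Rightarrow> complex" where
  "adj \<phi> f = (SOME g. g \<in> H2 \<and> (\<forall>h\<in>H2. ip g h = ip f (\<phi> * h)))"

lemma
  assumes \<phi>: "\<phi> \<in> H_infty" and f: "f \<in> H2"
  shows adj_H2: "adj \<phi> f \<in> H2" and ip_adj_left: "h \<in> H2 \<Longrightarrow> ip (adj \<phi> f) h = ip f (\<phi> * h)"
    and ip_adj_right: "h \<in> H2 \<Longrightarrow> ip h (adj \<phi> f) = ip (\<phi> * h) f"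
proof -
  obtain C where "bounded_functional (\<lambda>h. ip (\<phi> * h) f) C" using bounded_functional_times[OF \<phi> f] by blast
  from Riesz_H2[OF this] obtain y where y: "y \<in> H2" "\<And>h. h \<in> H2 \<Longrightarrow> ip (\<phi> * h) f = ip h y" by blast
  have "ip y h = ip f (\<phi> * h)" if "h \<in> H2" for h
    using y(2)[OF that] ip_commute[OF that y(1)] ip_commute[OF H2_times[OF \<phi> that] f] by simp
  with y(1) have "y \<in> H2 \<and> (\<forall>h\<in>H2. ip y h = ip f (\<phi> * h))" by blast
  from someI[of "\<lambda>g. g \<in> H2 \<and> (\<forall>h\<in>H2. ip g h = ip f (\<phi> * h))", OF this]
  have 1: "adj \<phi> f \<in> H2" and 2: "\<And>h. h \<in> H2 \<Longrightarrow> ip (adj \<phi> f) h = ip f (\<phi> * h)"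
    unfolding adj_def by blast+
  show "adj \<phi> f \<in> H2" by (rule 1)
  show "h \<in> H2 \<Longrightarrow> ip (adj \<phi> f) h = ip f (\<phi> * h)" by (rule 2)
  show "ip h (adj \<phi> f) = ip (\<phi> * h) f" if "h \<in> H2"
    using 2[OF that] ip_commute[OF 1 that] ip_commute[OF f H2_times[OF \<phi> that]] by simp
qed

lemma adj_eqI:
  assumes "\<phi> \<in> H_infty" "f \<in> H2" "g \<in> H2" "\<And>h. h \<in> H2 \<Longrightarrow> ip g h = ip f (\<phi> * h)"
  shows "adj \<phi> f = g"
  by (rule ip_ext) (use assms in \<open>auto simp: adj_H2 ip_adj_left\<close>)

lemma adj_minus: "\<phi> \<in> H_infty \<Longrightarrow> f \<in> H2 \<Longrightarrow> g \<in> H2 \<Longrightarrow> adj \<phi> (f - g) = adj \<phi> f - adj \<phi> g"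
  by (rule adj_eqI) (auto simp: H2_minus adj_H2 ip_diff_left ip_adj_left H2_times)

lemma adj_0: "\<phi> \<in> H_infty \<Longrightarrow> adj \<phi> 0 = 0"
  by (rule adj_eqI) (auto simp: H2_0 ip_0_left H2_times)

lemma adj_times: "\<phi> \<in> H_infty \<Longrightarrow> \<psi> \<in> H_infty \<Longrightarrow> f \<in> H2 \<Longrightarrow> adj (\<phi> * \<psi>) f = adj \<psi> (adj \<phi> f)"
  by (rule adj_eqI) (auto simp: H_infty_times adj_H2 ip_adj_left H2_times mult.assoc)

lemma adj_commute: "\<phi> \<in> H_infty \<Longrightarrow> \<psi> \<in> H_infty \<Longrightarrow> f \<in> H2 \<Longrightarrow> adj \<phi> (adj \<psi> f) = adj \<psi> (adj \<phi> f)"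
  using adj_times[of \<phi> \<psi> f] adj_times[of \<psi> \<phi> f] by (simp add: mult.commute)

text \<open>The reproducing kernel of \<open>H2\<close> at the point \<open>w\<close>, given by its coefficients.\<close>

definition Szego_kernel :: "complex ^ 'n \<Rightarrow> complex ^ 'n \<Rightarrow> complex" where
  "Szego_kernel w = of_coef (\<lambda>\<alpha>. cnj (monom_fun \<alpha> w))"

lemma
  assumes w: "w \<in> polydisc"
  shows Szego_kernel_H2: "Szego_kernel w \<in> H2" and ip_Szego_kernel: "f \<in> H2 \<Longrightarrow> ip f (Szego_kernel w) = f w"
proof -
  have b: "cmod (cnj (monom_fun \<alpha> w)) \<le> 1" for \<alpha> using norm_monom_fun_le_1[OF w] by simp
  have c: "coef (Szego_kernel w) = (\<lambda>\<alpha>. cnj (monom_fun \<alpha> w))"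
    unfolding Szego_kernel_def by (rule coef_of_coef[OF b])
  have "(\<lambda>\<alpha>. (cmod (monom_fun \<alpha> w))\<^sup>2) summable_on UNIV"
    by (rule summable_on_comparison_test[OF monom_abs_summable[OF w]])
       (auto simp: power2_eq_square norm_monom_fun_le_1[OF w] mult_left_le)
  then show k: "Szego_kernel w \<in> H2"
    by (simp add: H2_iff c) (simp add: Szego_kernel_def of_coef_disc_fun[OF b])
  show "ip f (Szego_kernel w) = f w" if f: "f \<in> H2"
    by (rule ip_eqI[OF f k]) (simp add: c power_series H2_disc_fun f w)
qed

section \<open>Isometric multipliers\<close>

text \<open>Multiplication by \<open>\<phi>\<close> maps the basis of monomials to an orthonormal family. This is the part
  of the notion of an inner function that Hilbert space arguments can produce: it makes sense before any boundary
  values are known to exist.\<close>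

definition isometric :: "(complex ^ 'n \<Rightarrow> complex) \<Rightarrow> bool" where
  "isometric \<phi> \<longleftrightarrow> \<phi> \<in> H2 \<and> (\<forall>\<alpha> \<beta>. ip (mon \<alpha> * \<phi>) (mon \<beta> * \<phi>) = (if \<alpha> = \<beta> then 1 else 0))"

text \<open>Bessel's inequality for the kernel at \<open>w\<close> and the family \<open>mon \<alpha> * \<phi>\<close> reads
  \<open>|\<phi> w|\<^sup>2 K \<le> K\<close>, where \<open>K\<close> is the squared norm of the kernel.\<close>

lemma isometric_le_1:
  assumes \<phi>: "isometric \<phi>" and w: "w \<in> polydisc"
  shows "cmod (\<phi> w) \<le> 1"
proof -
  have \<phi>H: "\<phi> \<in> H2" and orth: "\<And>\<alpha> \<beta>. ip (mon \<alpha> * \<phi>) (mon \<beta> * \<phi>) = (if \<alpha> = \<beta> then 1 else 0)"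
    using \<phi> by (auto simp: isometric_def)
  define K where "K = (H2_norm (Szego_kernel w))\<^sup>2"
  have kk: "((\<lambda>\<alpha>. (cmod (monom_fun \<alpha> w))\<^sup>2) has_sum K) UNIV"
  proof -
    have "cmod (coef (Szego_kernel w) \<alpha>) = cmod (monom_fun \<alpha> w)" for \<alpha>
      using ip_mon[OF Szego_kernel_H2[OF w], of \<alpha>] ip_Szego_kernel[OF w H2_mon, of \<alpha>] ip_commute[OF H2_mon Szego_kernel_H2[OF w], of \<alpha>]
      by (simp add: mon_def restr_def w)
    then show ?thesis using H2_norm_sq[OF Szego_kernel_H2[OF w]] by (simp add: K_def)
  qed
  have "1 \<le> K" using finite_sum_le_has_sum[OF kk, of "{\<lambda>_. 0}"] by (simp add: monom_fun_def)
  have "(\<Sum>\<alpha>\<in>A. (cmod (monom_fun \<alpha> w))\<^sup>2 * (cmod (\<phi> w))\<^sup>2) \<le> K" if A: "finite A" for A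
  proof -
    have "(\<Sum>\<alpha>\<in>A. (cmod (ip (Szego_kernel w) (mon \<alpha> * \<phi>)))\<^sup>2) \<le> K"
      unfolding K_def by (rule Bessel_H2(2)[OF A]) (auto simp: orth H2_times \<phi>H Szego_kernel_H2[OF w])
    moreover have "cmod (ip (Szego_kernel w) (mon \<alpha> * \<phi>)) = cmod (monom_fun \<alpha> w) * cmod (\<phi> w)" for \<alpha>
      using ip_commute[OF H2_times[OF mon_H_infty \<phi>H, of \<alpha>] Szego_kernel_H2[OF w]] ip_Szego_kernel[OF w H2_times[OF mon_H_infty \<phi>H, of \<alpha>]]
      by (simp add: norm_mult mon_def restr_def w)
    ultimately show ?thesis by (simp add: power_mult_distrib)
  qed
  then have "K * (cmod (\<phi> w))\<^sup>2 \<le> K"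
    by (intro has_sum_le_finite_sums[OF has_sum_cmult_left[OF kk]]) auto
  then have "(cmod (\<phi> w))\<^sup>2 \<le> 1" using \<open>1 \<le> K\<close> by simp
  then show ?thesis by (simp add: power_le_one_iff)
qed

lemma isometric_H2: "isometric \<phi> \<Longrightarrow> \<phi> \<in> H2" by (simp add: isometric_def)

lemma isometric_H_infty: "isometric \<phi> \<Longrightarrow> \<phi> \<in> H_infty"
  by (rule H_inftyI[where B = 1]) (auto simp: isometric_le_1 dest: isometric_H2 H2_disc_fun[unfolded disc_fun_def])

text \<open>Expand first \<open>f\<close> and then \<open>g\<close> into monomials.\<close>

lemma isometric_ip:
  assumes \<phi>: "isometric \<phi>" and f: "f \<in> H2" and g: "g \<in> H2"
  shows "ip (\<phi> * f) (\<phi> * g) = ip f g"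
proof -
  note \<phi>' = isometric_H_infty[OF \<phi>]
  have orth: "ip (\<phi> * mon \<alpha>) (\<phi> * mon \<beta>) = (if \<alpha> = \<beta> then 1 else 0)" for \<alpha> \<beta>
    using \<phi> by (simp add: isometric_def mult.commute)
  have 1: "ip (\<phi> * h) (\<phi> * mon \<beta>) = coef h \<beta>" if h: "h \<in> H2" for h \<beta>
  proof -
    obtain C where "bounded_functional (\<lambda>h. ip (\<phi> * h) (\<phi> * mon \<beta>)) C"
      using bounded_functional_times[OF \<phi>' H2_times[OF \<phi>' H2_mon]] by blast
    from functional_expand[OF this h]
    have "((\<lambda>\<alpha>. coef h \<alpha> * (if \<alpha> = \<beta> then 1 else 0)) has_sum ip (\<phi> * h) (\<phi> * mon \<beta>)) UNIV"
      by (simp add: orth)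
    moreover have "((\<lambda>\<alpha>. coef h \<alpha> * (if \<alpha> = \<beta> then 1 else 0)) has_sum coef h \<beta>) UNIV"
      by (rule has_sum_finite_neutralI[of "{\<beta>}"]) (auto split: if_splits)
    ultimately show ?thesis by (rule has_sum_unique)
  qed
  obtain C where "bounded_functional (\<lambda>h. ip (\<phi> * h) (\<phi> * g)) C"
    using bounded_functional_times[OF \<phi>' H2_times[OF \<phi>' g]] by blast
  from functional_expand[OF this f]
  have "((\<lambda>\<alpha>. coef f \<alpha> * ip (\<phi> * mon \<alpha>) (\<phi> * g)) has_sum ip (\<phi> * f) (\<phi> * g)) UNIV" .
  moreover have "ip (\<phi> * mon \<alpha>) (\<phi> * g) = cnj (coef g \<alpha>)" for \<alpha>
    using 1[OF g] ip_commute[OF H2_times[OF \<phi>' g] H2_times[OF \<phi>' H2_mon]] by simp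
  ultimately have "((\<lambda>\<alpha>. coef f \<alpha> * cnj (coef g \<alpha>)) has_sum ip (\<phi> * f) (\<phi> * g)) UNIV" by simp
  from ip_eqI[OF f g this] show ?thesis ..
qed

lemma adj_isometric: "isometric \<phi> \<Longrightarrow> f \<in> H2 \<Longrightarrow> adj \<phi> (\<phi> * f) = f"
  by (rule adj_eqI) (auto simp: isometric_H_infty H2_times isometric_ip)

section \<open>Coordinate shifts\<close>

lemma coord_times_mon: "coord i * mon \<alpha> = mon (\<alpha>(i := Suc (\<alpha> i)))"
proof
  fix z :: "complex ^ 'a"
  have "(\<Prod>k\<in>UNIV. z $ k ^ (\<alpha>(i := Suc (\<alpha> i))) k) = z $ i ^ Suc (\<alpha> i) * (\<Prod>k\<in>UNIV - {i}. z $ k ^ \<alpha> k)"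
    by (subst prod.remove[of UNIV i]) auto
  moreover have "(\<Prod>k\<in>UNIV. z $ k ^ \<alpha> k) = z $ i ^ \<alpha> i * (\<Prod>k\<in>UNIV - {i}. z $ k ^ \<alpha> k)"
    by (rule prod.remove) auto
  ultimately show "(coord i * mon \<alpha>) z = mon (\<alpha>(i := Suc (\<alpha> i))) z"
    by (simp add: mon_def restr_def monom_fun_def coord_def del: fun_upd_apply)
qed

lemma coef_coord_times:
  assumes f: "f \<in> H2"
  shows "coef (coord i * f) \<beta> = (if \<beta> i = 0 then 0 else coef f (\<beta>(i := \<beta> i - 1)))"
proof -
  obtain C where "bounded_functional (\<lambda>h. ip (coord i * h) (mon \<beta>)) C"
    using bounded_functional_times[OF coord_H_infty H2_mon] by blast
  from functional_expand[OF this f]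
  have 1: "((\<lambda>\<alpha>. coef f \<alpha> * (if \<alpha>(i := Suc (\<alpha> i)) = \<beta> then 1 else 0)) has_sum coef (coord i * f) \<beta>) UNIV"
    by (simp add: coord_times_mon mon_orthonormal ip_mon H2_times f)
  have "((\<lambda>\<alpha>. coef f \<alpha> * (if \<alpha>(i := Suc (\<alpha> i)) = \<beta> then 1 else 0)) has_sum
      (if \<beta> i = 0 then 0 else coef f (\<beta>(i := \<beta> i - 1)))) UNIV"
  proof (cases "\<beta> i = 0")
    case True
    then have "\<alpha>(i := Suc (\<alpha> i)) \<noteq> \<beta>" for \<alpha> by (metis fun_upd_same nat.distinct(1))
    then show ?thesis using True by simp
  next
    case False
    have "\<alpha>(i := Suc (\<alpha> i)) = \<beta> \<longleftrightarrow> \<alpha> = \<beta>(i := \<beta> i - 1)" for \<alpha>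
      using False by (auto simp: fun_eq_iff)
    then show ?thesis using False
      by (intro has_sum_finite_neutralI[of "{\<beta>(i := \<beta> i - 1)}"]) (auto split: if_splits)
  qed
  from has_sum_unique[OF 1 this] show ?thesis .
qed

lemma coef_adj_coord: "f \<in> H2 \<Longrightarrow> coef (adj (coord i) f) \<alpha> = coef f (\<alpha>(i := Suc (\<alpha> i)))"
  using ip_adj_left[OF coord_H_infty _ H2_mon, of f i \<alpha>] by (simp add: ip_mon adj_H2 coord_times_mon)

lemma coef_ext: "f \<in> H2 \<Longrightarrow> g \<in> H2 \<Longrightarrow> (\<And>\<alpha>. coef f \<alpha> = coef g \<alpha>) \<Longrightarrow> f = g"
  using coef_0_imp_0[of "f - g"] unfolding minus_eq_plus_scl
  by (simp add: H2_plus H2_scl coef_plus coef_scl) (simp add: fun_eq_iff)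

lemma adj_coord_coord: "f \<in> H2 \<Longrightarrow> adj (coord i) (coord i * f) = f"
  by (rule coef_ext) (auto simp: adj_H2 H2_times coef_adj_coord coef_coord_times)

lemma adj_coord_coord_other: "f \<in> H2 \<Longrightarrow> i \<noteq> j \<Longrightarrow> adj (coord i) (coord j * f) = coord j * adj (coord i) f"
  by (rule coef_ext) (auto simp: adj_H2 H2_times coef_adj_coord coef_coord_times fun_upd_twist)

text \<open>The adjoint of the coordinate multiplication is the backward shift in \<open>\<alpha> i\<close>; it annihilates
  exactly the series without the variable \<open>z $ i\<close>. Conversely, if \<open>f\<close> does not depend on the
  coordinate, then neither does \<open>coord i * y\<close>, where \<open>y\<close> is the backward shift of \<open>f\<close>. This product vanishes
  for \<open>z $ i = 0\<close>, hence everywhere.\<close>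

lemma not_depends_iff:
  assumes f: "f \<in> H2"
  shows "\<not> depends_on_coord f i \<longleftrightarrow> adj (coord i) f = 0"
proof
  have indep: "\<not> depends_on_coord g i" if g: "g \<in> H2" and 0: "adj (coord i) g = 0" for g
  proof -
    have c0: "coef g \<alpha> = 0" if "\<alpha> i \<noteq> 0" for \<alpha>
    proof -
      have "coef (0 :: complex ^ 'a \<Rightarrow> complex) \<beta> = 0" for \<beta>
        using ip_mon[OF H2_0] ip_0_left[OF H2_mon] by metis
      then show ?thesis
        using coef_adj_coord[OF g, of i "\<alpha>(i := \<alpha> i - 1)"] that by (simp add: 0)
    qed
    have "g z = g w" if z: "z \<in> polydisc" and w: "w \<in> polydisc" and eq: "\<forall>j. j \<noteq> i \<longrightarrow> z $ j = w $ j" for z w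
    proof -
      have eqm: "coef g \<alpha> * monom_fun \<alpha> z = coef g \<alpha> * monom_fun \<alpha> w" for \<alpha>
      proof (cases "\<alpha> i = 0")
        case True
        have "monom_fun \<alpha> z = monom_fun \<alpha> w" unfolding monom_fun_def
          by (rule prod.cong) (use True eq in \<open>auto, metis power_0\<close>)
        then show ?thesis by simp
      qed (simp add: c0)
      show ?thesis
        by (rule has_sum_unique[OF power_series[OF H2_disc_fun[OF g] z, unfolded eqm] power_series[OF H2_disc_fun[OF g] w]])
    qed
    then show ?thesis unfolding depends_on_coord_def by blast
  qed
  show "adj (coord i) f = 0 \<Longrightarrow> \<not> depends_on_coord f i" by (rule indep[OF f])
  assume nd: "\<not> depends_on_coord f i"
  define y where "y = adj (coord i) f"
  have y: "y \<in> H2" unfolding y_def by (intro adj_H2 coord_H_infty f)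
  have f0: "f - coord i * y \<in> H2" by (intro H2_minus f H2_times coord_H_infty y)
  have nd0: "\<not> depends_on_coord (f - coord i * y) i"
    by (rule indep[OF f0]) (simp add: adj_minus f H2_times y adj_coord_coord y_def[symmetric])
  have "(coord i * y) z = 0" for z
  proof (cases "z \<in> polydisc")
    case True
    define w where "w = (\<chi> j. if j = i then 0 else z $ j)"
    have w: "w \<in> polydisc" using True by (auto simp: w_def polydisc_def)
    have zw: "\<forall>j. j \<noteq> i \<longrightarrow> z $ j = w $ j" by (simp add: w_def)
    have "f z = f w"
      using nd True w zw unfolding depends_on_coord_def by blast
    moreover have "(f - coord i * y) z = (f - coord i * y) w"
      using nd0 True w zw unfolding depends_on_coord_def by blast
    moreover have "(coord i * y) w = 0" by (simp add: coord_def w_def)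
    ultimately show ?thesis by simp
  qed (use y in \<open>simp add: H2_def\<close>)
  then have "coord i * y = 0" by (simp add: fun_eq_iff)
  then have "adj (coord i) (coord i * y) = 0" by (simp add: adj_0)
  then show "adj (coord i) f = 0" using adj_coord_coord[OF y] by (simp add: y_def)
qed

text \<open>From here on functions are elements of a ring; automatic pointwise evaluation would destroy
  the products that the operator identities speak of.\<close>

declare plus_fun_apply [simp del] times_fun_apply [simp del] zero_fun_apply [simp del] minus_apply [simp del]

lemmas pointwise = fun_eq_iff plus_fun_apply times_fun_apply zero_fun_apply minus_apply

lemma multi_index_induct [case_names zero Suc]:
  fixes \<alpha> :: "'n::finite \<Rightarrow> nat"
  assumes zero: "P (\<lambda>_. 0)" and Suc: "\<And>\<alpha> i. P \<alpha> \<Longrightarrow> P (\<alpha>(i := Suc (\<alpha> i)))"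
  shows "P \<alpha>"
proof (induction "deg \<alpha>" arbitrary: \<alpha>)
  case 0
  then have "\<alpha> = (\<lambda>_. 0)" by (auto simp: deg_def fun_eq_iff)
  with zero show ?case by (simp only:)
next
  case (Suc k)
  have "\<exists>i. \<alpha> i \<noteq> 0"
  proof (rule ccontr)
    assume "\<nexists>i. \<alpha> i \<noteq> 0"
    then have "deg \<alpha> = 0" by (simp add: deg_def)
    with Suc.hyps(2) show False by simp
  qed
  then obtain i where i: "\<alpha> i \<noteq> 0" by blast
  define \<gamma> where "\<gamma> = \<alpha>(i := \<alpha> i - 1)"
  have \<alpha>: "\<alpha> = \<gamma>(i := Suc (\<gamma> i))" using i by (auto simp: \<gamma>_def)
  have "deg \<alpha> = \<alpha> i + sum \<alpha> (UNIV - {i})" unfolding deg_def by (rule sum.remove) auto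
  moreover have "deg \<gamma> = \<gamma> i + sum \<gamma> (UNIV - {i})" unfolding deg_def by (rule sum.remove) auto
  moreover have "sum \<gamma> (UNIV - {i}) = sum \<alpha> (UNIV - {i})" by (rule sum.cong) (auto simp: \<gamma>_def)
  ultimately have "k = deg \<gamma>" using Suc.hyps(2) i by (simp add: \<gamma>_def)
  from Suc.hyps(1)[OF this] show ?case unfolding \<alpha> by (rule assms(2))
qed

lemma ip_coord_coord: "f \<in> H2 \<Longrightarrow> g \<in> H2 \<Longrightarrow> ip (coord i * f) (coord i * g) = ip f g"
  using ip_adj_left[OF coord_H_infty H2_times[OF coord_H_infty], of f g i i] by (simp add: adj_coord_coord)

lemma mon_0_times: "f \<in> H2 \<Longrightarrow> mon (\<lambda>_. 0) * f = f"
  by (auto simp: pointwise mon_def restr_def monom_fun_def H2_def)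

lemma mon_Suc_times: "mon (\<alpha>(i := Suc (\<alpha> i))) * f = coord i * (mon \<alpha> * f)"
  by (simp add: coord_times_mon[symmetric] mult.assoc)

lemma ip_mon_mon: "f \<in> H2 \<Longrightarrow> g \<in> H2 \<Longrightarrow> ip (mon \<alpha> * f) (mon \<alpha> * g) = ip f g"
  by (induction \<alpha> rule: multi_index_induct) (auto simp: mon_0_times mon_Suc_times ip_coord_coord H2_times)

text \<open>The one-variable identity theorem on the complex line through \<open>w\<close> and \<open>z\<close>: near \<open>w\<close> the
  factor \<open>g\<close> has no zero.\<close>

lemma polydisc_identity:
  fixes f g :: "complex ^ 'n \<Rightarrow> complex"
  assumes f: "analytic_polydisc f" and g: "analytic_polydisc g"
    and fg: "\<And>z. z \<in> polydisc \<Longrightarrow> f z * g z = 0" and w: "w \<in> polydisc" "g w \<noteq> 0" and z: "z \<in> polydisc"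
  shows "f z = 0"
proof -
  define v where "v = z - w"
  define D where "D = {l. w + l *s v \<in> polydisc}"
  have holf: "(\<lambda>l. f (w + l *s v)) holomorphic_on D" and holg: "(\<lambda>l. g (w + l *s v)) holomorphic_on D"
    unfolding D_def by (intro analytic_polydisc_line_holomorphic f g)+
  have lin: "linear (\<lambda>l. l *s v)" by (rule linearI) (auto simp: vec_eq_iff algebra_simps)
  have cont: "continuous_on UNIV (\<lambda>l. w + l *s v)"
    using lin by (intro continuous_intros linear_continuous_on) (simp add: linear_conv_bounded_linear)
  have openD: "open D"
    using open_vimage[OF open_polydisc cont] by (simp add: D_def vimage_def)
  have convD: "convex D"
  proof (rule convexI)
    fix x y :: complex and s t :: real assume xy: "x \<in> D" "y \<in> D" and st: "0 \<le> s" "0 \<le> t" "s + t = 1"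
    have "s *\<^sub>R (w + x *s v) + t *\<^sub>R (w + y *s v) \<in> polydisc"
      using xy st by (intro convexD[OF convex_polydisc]) (auto simp: D_def)
    also have "s *\<^sub>R (w + x *s v) + t *\<^sub>R (w + y *s v) = (s + t) *\<^sub>R w + (s *\<^sub>R x + t *\<^sub>R y) *s v"
      by (simp add: vec_eq_iff algebra_simps scaleR_conv_of_real[where 'a = complex])
    finally show "s *\<^sub>R x + t *\<^sub>R y \<in> D" using st by (simp add: D_def)
  qed
  have D01: "0 \<in> D" "1 \<in> D" using w z by (auto simp: D_def v_def)
  have "continuous_on D (\<lambda>l. g (w + l *s v))" by (rule holomorphic_on_imp_continuous_on[OF holg])
  then have "open ((\<lambda>l. g (w + l *s v)) -` (- {0}) \<inter> D)"
    unfolding continuous_on_open_vimage[OF openD] by (blast intro: open_Compl closed_singleton)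
  moreover have "0 \<in> (\<lambda>l. g (w + l *s v)) -` (- {0}) \<inter> D" using D01 w by simp
  ultimately obtain e where e: "0 < e" "ball 0 e \<subseteq> (\<lambda>l. g (w + l *s v)) -` (- {0}) \<inter> D"
    unfolding open_contains_ball by blast
  have "f (w + 1 *s v) = 0"
  proof (rule analytic_continuation[OF holf openD convex_connected[OF convD]])
    show "ball 0 e \<subseteq> D" using e by blast
    show "(0 :: complex) islimpt ball 0 e" using e(1) by (intro interior_limit_point) simp
    show "f (w + l *s v) = 0" if "l \<in> ball 0 e" for l
    proof -
      have "g (w + l *s v) \<noteq> 0" "w + l *s v \<in> polydisc"
        using subsetD[OF e(2) that] by (simp_all add: D_def)
      then show ?thesis using fg[of "w + l *s v"] by simp
    qed
  qed (use D01 in auto)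
  then show ?thesis by (simp add: v_def)
qed

text \<open>The closed invariant subspaces generated by \<open>f\<close> and by \<open>g\<close> both contain \<open>f * g\<close>, which has
  norm \<open>1\<close>.\<close>

lemma isometric_not_orthogonal:
  assumes f: "isometric f" and g: "isometric g" and orth: "\<And>\<alpha> \<beta>. ip (mon \<alpha> * f) (mon \<beta> * g) = 0"
  shows False
proof -
  note fi = isometric_H_infty[OF f] and gi = isometric_H_infty[OF g] and fH = isometric_H2[OF f] and gH = isometric_H2[OF g]
  have 1: "ip (f * h) (g * mon \<beta>) = 0" if h: "h \<in> H2" for h \<beta>
  proof -
    obtain C where "bounded_functional (\<lambda>h. ip (f * h) (g * mon \<beta>)) C"
      using bounded_functional_times[OF fi H2_times[OF gi H2_mon]] by blast
    from functional_expand[OF this h] have "((\<lambda>\<alpha> :: 'a \<Rightarrow> nat. 0 :: complex) has_sum ip (f * h) (g * mon \<beta>)) UNIV"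
      using orth[of _ \<beta>] by (simp add: mult.commute)
    from has_sum_unique[OF this has_sum_0_simp] show ?thesis .
  qed
  have 2: "ip (g * h) (f * g) = 0" if h: "h \<in> H2" for h
  proof -
    have 3: "ip (g * mon \<beta>) (f * g) = 0" for \<beta>
      using 1[OF gH, of \<beta>] ip_commute[OF H2_times[OF fi gH] H2_times[OF gi H2_mon, of \<beta>]] by simp
    obtain C where "bounded_functional (\<lambda>h. ip (g * h) (f * g)) C"
      using bounded_functional_times[OF gi H2_times[OF fi gH]] by blast
    from functional_expand[OF this h] have "((\<lambda>\<alpha> :: 'a \<Rightarrow> nat. 0 :: complex) has_sum ip (g * h) (f * g)) UNIV"
      using 3 by simp
    from has_sum_unique[OF this has_sum_0_simp] show ?thesis .
  qed
  have "ip (f * g) (f * g) = ip g g" by (rule isometric_ip[OF f gH gH])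
  also have "ip g g = 1" using g mon_0_times[OF gH] unfolding isometric_def by metis
  finally show False using 2[OF fH] by (simp add: mult.commute)
qed

section \<open>Commuting projections\<close>

text \<open>\<open>a * adj a h\<close> is the orthogonal projection of \<open>h\<close> onto the range of multiplication by \<open>a\<close>.\<close>

locale commuting_pair =
  fixes a b :: "complex ^ 'n \<Rightarrow> complex"
  assumes isometric_a: "isometric a" and isometric_b: "isometric b"
    and comm: "\<And>h. h \<in> H2 \<Longrightarrow> a * adj a (b * adj b h) = b * adj b (a * adj a h)"
begin

text \<open>\<open>T\<close> is the Toeplitz operator with symbol \<open>cnj a * b\<close> and \<open>T'\<close> is its adjoint. Commutation makes
  \<open>T\<close> a partial isometry, and \<open>rel\<close> below is the graph of its isometric part: the pairs \<open>f\<close>, \<open>F\<close>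
  with \<open>F = (b / a) f\<close>.\<close>

definition T where "T h = adj a (b * h)"
definition T' where "T' h = adj b (a * h)"

lemma ab_H_infty [simp]: "a \<in> H_infty" "b \<in> H_infty"
  by (simp_all add: isometric_H_infty isometric_a isometric_b)

lemma T_H2 [simp]: "h \<in> H2 \<Longrightarrow> T h \<in> H2" and T'_H2 [simp]: "h \<in> H2 \<Longrightarrow> T' h \<in> H2"
  by (simp_all add: T_def T'_def adj_H2 H2_times)

lemma ip_T: "h \<in> H2 \<Longrightarrow> g \<in> H2 \<Longrightarrow> ip (T h) g = ip (b * h) (a * g)"
  by (simp add: T_def ip_adj_left H2_times)

lemma ip_T_T': "h \<in> H2 \<Longrightarrow> g \<in> H2 \<Longrightarrow> ip (T h) g = ip h (T' g)"
  by (simp add: ip_T T'_def ip_adj_right H2_times)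

lemma ip_T'_T: "h \<in> H2 \<Longrightarrow> g \<in> H2 \<Longrightarrow> ip (T' g) h = ip g (T h)"
  by (simp add: T_def T'_def ip_adj_right ip_adj_left H2_times)

lemma T_minus: "f \<in> H2 \<Longrightarrow> g \<in> H2 \<Longrightarrow> T (f - g) = T f - T g"
  by (simp add: T_def times_minus adj_minus H2_times)

lemma T'_minus: "f \<in> H2 \<Longrightarrow> g \<in> H2 \<Longrightarrow> T' (f - g) = T' f - T' g"
  by (simp add: T'_def times_minus adj_minus H2_times)

definition rel where "rel f F \<longleftrightarrow> f \<in> H2 \<and> F \<in> H2 \<and> b * f = a * F"

lemma rel_T: "rel f F \<Longrightarrow> T f = F" and rel_T': "rel f F \<Longrightarrow> T' F = f"
  by (auto simp: rel_def T_def T'_def adj_isometric isometric_a) (metis adj_isometric isometric_b)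

lemma rel_times: "rel f F \<Longrightarrow> \<phi> \<in> H_infty \<Longrightarrow> rel (\<phi> * f) (\<phi> * F)"
  by (auto simp: rel_def H2_times mult.left_commute)

lemma rel_minus: "rel f F \<Longrightarrow> rel g G \<Longrightarrow> rel (f - g) (F - G)"
  by (auto simp: rel_def H2_minus times_minus)

lemma rel_scl: "rel f F \<Longrightarrow> rel (scl c f) (scl c F)"
  by (auto simp: rel_def H2_scl times_scl)

lemma rel_T'_T: "h \<in> H2 \<Longrightarrow> rel (T' (T h)) (T h)"
  using comm[of "b * h"] by (simp add: rel_def T_def T'_def H2_times adj_H2 adj_isometric isometric_b)

lemma rel_T_T': "h \<in> H2 \<Longrightarrow> rel (T' h) (T (T' h))"
  using comm[of "a * h"] by (simp add: rel_def T_def T'_def H2_times adj_H2 adj_isometric isometric_a)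

text \<open>The defining property of Toeplitz operators.\<close>

lemma adj_coord_T_coord:
  assumes h: "h \<in> H2"
  shows "adj (coord i) (T (coord i * h)) = T h"
proof (rule adj_eqI)
  fix g :: "complex ^ 'n \<Rightarrow> complex" assume g: "g \<in> H2"
  have "ip (T (coord i * h)) (coord i * g) = ip (coord i * (b * h)) (coord i * (a * g))"
    by (simp add: ip_T H2_times h g mult.left_commute)
  then show "ip (T h) g = ip (T (coord i * h)) (coord i * g)"
    by (simp add: ip_coord_coord H2_times h g ip_T)
qed (simp_all add: h H2_times)

text \<open>Both \<open>T\<close> and \<open>T'\<close> commute with the shift on the ranges of \<open>T'\<close> and \<open>T\<close>. Therefore the backward shift of
  \<open>G\<close> is orthogonal to the range of \<open>T'\<close> as soon as \<open>g\<close> is orthogonal to the range of the shift.\<close>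

lemma T_adj_coord_eq_0:
  assumes G: "rel G g" and 0: "adj (coord i) g = 0"
  shows "T (adj (coord i) G) = 0"
proof (rule ip_ext)
  have H: "G \<in> H2" "g \<in> H2" using G by (auto simp: rel_def)
  fix m :: "complex ^ 'n \<Rightarrow> complex" assume m: "m \<in> H2"
  have "ip (T (adj (coord i) G)) m = ip G (coord i * T' m)"
    by (simp add: ip_T_T' adj_H2 H m ip_adj_left)
  also have "\<dots> = ip (T' g) (coord i * T' m)" by (simp add: rel_T'[OF G])
  also have "\<dots> = ip g (T (coord i * T' m))" by (simp add: ip_T'_T H H2_times m)
  also have "T (coord i * T' m) = coord i * T (T' m)"
    by (rule rel_T[OF rel_times[OF rel_T_T'[OF m] coord_H_infty]])
  also have "ip g (coord i * T (T' m)) = ip (adj (coord i) g) (T (T' m))"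
    by (simp add: ip_adj_left H m)
  finally show "ip (T (adj (coord i) G)) m = ip 0 m" using m by (simp add: 0 ip_0_left)
qed (use G in \<open>auto simp: rel_def adj_H2 H2_0\<close>)

text \<open>\<open>N\<close> is the range of \<open>T'\<close>, the initial space of the partial isometry \<open>T\<close>. It is invariant under
  multiplication operators, \<open>Q\<close> is the projection onto it, and \<open>R i\<close> is the adjoint of the shift
  \<open>coord i\<close> restricted to \<open>N\<close>.\<close>

definition N where "N = {f. \<exists>F. rel f F}"
definition Q where "Q h = T' (T h)"
definition R where "R i n = Q (adj (coord i) n)"

lemma N_H2 [simp]: "f \<in> N \<Longrightarrow> f \<in> H2" by (auto simp: N_def rel_def)

lemma N_rel: "f \<in> N \<Longrightarrow> rel f (T f)" using rel_T by (auto simp: N_def)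

lemma N_Q: "f \<in> N \<Longrightarrow> Q f = f" using rel_T'[OF N_rel] by (simp add: Q_def)

lemma N_times: "f \<in> N \<Longrightarrow> \<phi> \<in> H_infty \<Longrightarrow> \<phi> * f \<in> N" using rel_times by (auto simp: N_def)
lemma N_minus: "f \<in> N \<Longrightarrow> g \<in> N \<Longrightarrow> f - g \<in> N" using rel_minus by (fastforce simp: N_def)
lemma N_scl: "f \<in> N \<Longrightarrow> scl c f \<in> N" using rel_scl by (auto simp: N_def)
lemma Q_N: "h \<in> H2 \<Longrightarrow> Q h \<in> N" using rel_T'_T by (auto simp: N_def Q_def)
lemma R_N: "n \<in> N \<Longrightarrow> R i n \<in> N" by (simp add: R_def Q_N adj_H2)
lemma T_Q: "h \<in> H2 \<Longrightarrow> T (Q h) = T h" unfolding Q_def by (rule rel_T[OF rel_T'_T])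

lemma ip_Q: "h \<in> H2 \<Longrightarrow> n \<in> N \<Longrightarrow> ip (Q h) n = ip h n"
  using N_Q[of n] by (simp add: Q_def ip_T'_T ip_T_T')

lemma ip_R: "n \<in> N \<Longrightarrow> m \<in> N \<Longrightarrow> ip (R i n) m = ip n (coord i * m)"
  by (simp add: R_def ip_Q adj_H2 ip_adj_left)

lemma R_minus: "n \<in> N \<Longrightarrow> m \<in> N \<Longrightarrow> R i (n - m) = R i n - R i m"
  by (simp add: R_def Q_def adj_minus T_minus T'_minus adj_H2)

lemma R_coord_same: "n \<in> N \<Longrightarrow> R i (coord i * n) = n"
  by (simp add: R_def adj_coord_coord N_Q)

text \<open>The shifts on \<open>N\<close> are doubly commuting. This is the crucial consequence of commutation.
  Split the backward shift \<open>h\<close> of \<open>n\<close> in direction \<open>j\<close> as \<open>Q h + k\<close> with \<open>T k = 0\<close>. The claim reduces to \<open>g = 0\<close>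
  for \<open>g = T (coord i * k)\<close>. By the Toeplitz property \<open>g\<close> does not depend on \<open>z $ i\<close>. Moving
  \<open>T\<close> and the two shifts to the other side turns \<open>ip g g\<close> into the inner product of \<open>n\<close> with the
  \<open>i\<close>-th backward shift of \<open>coord j * G\<close>, and \<open>T_adj_coord_eq_0\<close> says that this function is
  orthogonal to \<open>N\<close>.\<close>

lemma R_coord_other:
  assumes n: "n \<in> N" and ij: "j \<noteq> i"
  shows "R j (coord i * n) = coord i * R j n"
proof -
  have nH: "n \<in> H2" using n by simp
  define h where "h = adj (coord j) n"
  have h: "h \<in> H2" unfolding h_def by (intro adj_H2 coord_H_infty nH)
  define k where "k = h - Q h"
  have Qh: "Q h \<in> H2" "Q h \<in> N" using Q_N[OF h] by auto
  have k: "k \<in> H2" unfolding k_def by (intro H2_minus h Qh)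
  have Tk: "T k = 0" by (simp add: k_def T_minus h Qh T_Q)
  define g where "g = T (coord i * k)"
  have g: "g \<in> H2" by (simp add: g_def H2_times k)
  have g0: "adj (coord i) g = 0" by (simp add: g_def adj_coord_T_coord k Tk)
  define G where "G = T' g"
  have G: "rel G g" unfolding G_def g_def by (intro rel_T'_T H2_times coord_H_infty k)
  have GH: "G \<in> H2" using G by (simp add: rel_def)
  define c where "c = adj (coord i) G"
  have c: "c \<in> H2" unfolding c_def by (intro adj_H2 coord_H_infty GH)
  have Tc: "T c = 0" unfolding c_def by (rule T_adj_coord_eq_0[OF G g0])
  have "T (adj (coord i) (coord j * G)) = 0"
    by (rule T_adj_coord_eq_0[OF rel_times[OF G coord_H_infty]]) (use ij in \<open>simp add: adj_coord_coord_other g g0\<close>)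
  then have TXc: "T (coord j * c) = 0" using ij by (simp add: adj_coord_coord_other GH c_def)
  have "ip g g = ip (coord i * k) G" unfolding g_def G_def by (simp add: ip_T_T' H2_times k)
  also have "\<dots> = ip k c" unfolding c_def by (simp add: ip_adj_right GH k)
  also have "\<dots> = ip h c - ip (Q h) c" unfolding k_def by (simp add: ip_diff_left h Qh c)
  also have "ip (Q h) c = ip (T h) (T c)" by (simp add: Q_def ip_T'_T h c)
  also have "\<dots> = 0" using h by (simp add: Tc ip_0_right)
  also have "ip h c = ip n (coord j * c)" unfolding h_def by (simp add: ip_adj_left nH c)
  also have "\<dots> = ip (T' (T n)) (coord j * c)" using N_Q[OF n] by (simp add: Q_def)
  also have "\<dots> = ip (T n) (T (coord j * c))" by (simp add: ip_T'_T nH c H2_times)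
  also have "\<dots> = 0" using nH by (simp add: TXc ip_0_right)
  finally have "g = 0" using ip_self_0[OF g] by simp
  have "T (coord i * h) - T (coord i * Q h) = T (coord i * h - coord i * Q h)"
    by (simp add: T_minus H2_times h Qh)
  also have "coord i * h - coord i * Q h = coord i * k" by (simp add: k_def times_minus)
  finally have "T (coord i * h) - T (coord i * Q h) = 0" using \<open>g = 0\<close> by (simp only: g_def)
  then have "T (coord i * h) = T (coord i * Q h)" by simp
  then have "Q (coord i * h) = Q (coord i * Q h)" by (simp add: Q_def)
  also have "\<dots> = coord i * Q h" by (intro N_Q N_times Qh coord_H_infty)
  finally show ?thesis using ij by (simp add: R_def adj_coord_coord_other nH h_def)
qed

lemma R_commute:
  assumes n: "n \<in> N"
  shows "R i (R j n) = R j (R i n)"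
proof -
  define d where "d = R i (R j n) - R j (R i n)"
  have d: "d \<in> N" unfolding d_def by (intro N_minus R_N n)
  have "ip d d = ip (R i (R j n)) d - ip (R j (R i n)) d"
    unfolding d_def[symmetric] using d n by (subst (1) d_def) (simp add: ip_diff_left R_N)
  also have "\<dots> = 0"
    using d n by (simp add: ip_R R_N N_times mult.left_commute)
  finally have "d = 0" by (rule ip_self_0[OF N_H2[OF d]])
  then show ?thesis by (simp add: d_def)
qed

lemma R_0: "R i 0 = 0"
proof -
  have "0 \<in> N" unfolding N_def rel_def using H2_0 by (auto intro!: exI[of _ 0])
  from R_minus[OF this this] show ?thesis by simp
qed

text \<open>A Wold type argument, one coordinate at a time. With \<open>F m\<close> the iterates of \<open>R j\<close> on \<open>f\<close>, the
  function \<open>F m - coord j * F (m + 1)\<close> is annihilated by \<open>R j\<close>, and by double commutation it is still annihilated by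
  the earlier \<open>R i\<close>. If all of these functions were zero, then \<open>f\<close> would be divisible by all powers of
  \<open>coord j\<close>.\<close>

lemma wandering_exists:
  assumes V: "V \<subseteq> N" "\<And>u v. u \<in> V \<Longrightarrow> v \<in> V \<Longrightarrow> u - v \<in> V"
    "\<And>v i. v \<in> V \<Longrightarrow> coord i * v \<in> V" "\<And>v i. v \<in> V \<Longrightarrow> R i v \<in> V"
    and v: "v \<in> V" "v \<noteq> 0"
  shows "\<exists>f\<in>V. f \<noteq> 0 \<and> (\<forall>i. R i f = 0)"
proof -
  have "\<exists>f\<in>V. f \<noteq> 0 \<and> (\<forall>i\<in>S. R i f = 0)" if "finite S" for S
    using that
  proof induction
    case empty
    show ?case using v by blast
  next
    case (insert j S)
    then obtain f where f: "f \<in> V" "f \<noteq> 0" "\<And>i. i \<in> S \<Longrightarrow> R i f = 0" by blast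
    define F where "F m = (R j ^^ m) f" for m
    have F_Suc: "F (Suc m) = R j (F m)" and F_0: "F 0 = f" for m by (simp_all add: F_def)
    have FV: "F m \<in> V" for m by (induction m) (auto simp: F_Suc F_0 f V(4))
    have FN: "F m \<in> N" for m using FV V(1) by blast
    have FR: "R i (F m) = 0" if "i \<in> S" for i m
      by (induction m) (simp_all add: F_0 F_Suc f(3) that R_commute[OF FN, of i j] R_0)
    define g where "g m = F m - coord j * F (Suc m)" for m
    \<comment> \<open>Otherwise every \<open>F m\<close> is divisible by \<open>coord j\<close>, and so \<open>f\<close> by all of its powers.\<close>
    have "\<exists>m. g m \<noteq> 0"
    proof (rule ccontr)
      assume "\<nexists>m. g m \<noteq> 0"
      then have "g m = 0" for m by blast
      then have eq: "F m = coord j * F (Suc m)" for m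
        unfolding g_def by (rule right_minus_eq[THEN iffD1])
      have c: "coef (F m) \<alpha> = 0" if "\<alpha> j = k" for m \<alpha> k
        using that
      proof (induction k arbitrary: m \<alpha>)
        case 0
        then show ?case unfolding eq[of m] by (simp add: coef_coord_times FN)
      next
        case (Suc k)
        then show ?case unfolding eq[of m] by (simp add: coef_coord_times FN)
      qed
      have "f = 0" by (rule coef_0_imp_0) (use c[OF refl, of 0] FN[of 0] in \<open>auto simp: F_0\<close>)
      with f show False by simp
    qed
    then obtain m where m: "g m \<noteq> 0" by blast
    have "g m \<in> V" unfolding g_def by (intro V FV)
    moreover have "R i (g m) = 0" if "i \<in> insert j S" for i
    proof (cases "i = j")
      case True
      then show ?thesis by (simp add: g_def R_minus FN N_times R_coord_same R_N F_Suc)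
    next
      case False
      then show ?thesis using that by (simp add: g_def R_minus FN N_times R_coord_other FR)
    qed
    ultimately show ?case using m by blast
  qed
  from this[of UNIV] show ?thesis by simp
qed

lemma R_mon_wandering:
  assumes f: "f \<in> N" "\<forall>i. R i f = 0"
  shows "\<beta> i = 0 \<Longrightarrow> R i (mon \<beta> * f) = 0"
proof (induction \<beta> rule: multi_index_induct)
  case zero
  then show ?case using f by (simp add: mon_0_times)
next
  case (Suc \<beta> j)
  from Suc.prems have ij: "i \<noteq> j" and "\<beta> i = 0" by (auto split: if_splits)
  then have "R i (mon \<beta> * f) = 0" by (intro Suc.IH)
  moreover have "R i (coord i' * (mon \<beta> * f)) = coord i' * R i (mon \<beta> * f)" if "i \<noteq> i'" for i'
    by (intro R_coord_other that N_times f mon_H_infty)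
  ultimately show ?case unfolding mon_Suc_times using ij by simp
qed

text \<open>Cancel common powers of the coordinate \<open>i\<close>; the remaining shift is moved to the other side, where
  it becomes \<open>R i\<close> and annihilates the vector.\<close>

lemma wandering_orthogonal:
  assumes f: "f \<in> N" "\<forall>i. R i f = 0" and i: "\<beta> i < \<alpha> i"
  shows "ip (mon \<alpha> * f) (mon \<beta> * f) = 0"
  using i
proof (induction "\<beta> i" arbitrary: \<alpha> \<beta>)
  case 0
  define \<gamma> where "\<gamma> = \<alpha>(i := \<alpha> i - 1)"
  have \<alpha>: "\<alpha> = \<gamma>(i := Suc (\<gamma> i))" using 0 by (auto simp: \<gamma>_def)
  have H: "mon \<beta> * f \<in> N" "mon \<gamma> * f \<in> N" by (intro N_times f mon_H_infty)+
  have "ip (mon \<beta> * f) (mon \<alpha> * f) = ip (R i (mon \<beta> * f)) (mon \<gamma> * f)"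
    by (subst \<alpha>) (simp add: mon_Suc_times ip_R H)
  also have "\<dots> = 0" using R_mon_wandering[OF f, of \<beta> i] 0 H by (simp add: ip_0_left)
  finally show ?case using ip_commute[of "mon \<beta> * f" "mon \<alpha> * f"] f by (simp add: H2_times)
next
  case (Suc k)
  define \<gamma> where "\<gamma> = \<alpha>(i := \<alpha> i - 1)"
  have \<alpha>: "\<alpha> = \<gamma>(i := Suc (\<gamma> i))" using Suc by (auto simp: \<gamma>_def)
  define \<delta> where "\<delta> = \<beta>(i := \<beta> i - 1)"
  have \<beta>: "\<beta> = \<delta>(i := Suc (\<delta> i))" using Suc by (auto simp: \<delta>_def)
  have "ip (mon \<gamma> * f) (mon \<delta> * f) = 0" using Suc by (intro Suc.hyps) (auto simp: \<gamma>_def \<delta>_def)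
  then show ?case by (subst \<alpha>, subst \<beta>) (simp add: mon_Suc_times ip_coord_coord H2_times f)
qed

text \<open>A unit vector in the wandering subspace of the doubly commuting shifts is an inner function, as
  in Beurling's theorem.\<close>

lemma wandering_isometric:
  assumes f: "f \<in> N" "\<forall>i. R i f = 0" and n: "ip f f = 1"
  shows "isometric f"
  unfolding isometric_def
proof (intro conjI allI)
  fix \<alpha> \<beta> :: "'n \<Rightarrow> nat"
  have fH: "f \<in> H2" using f by simp
  show "ip (mon \<alpha> * f) (mon \<beta> * f) = (if \<alpha> = \<beta> then 1 else 0)"
  proof (cases "\<alpha> = \<beta>")
    case False
    then obtain i where "\<alpha> i \<noteq> \<beta> i" by auto
    then consider "\<beta> i < \<alpha> i" | "\<alpha> i < \<beta> i" by linarith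
    then have "ip (mon \<alpha> * f) (mon \<beta> * f) = 0"
    proof cases
      case 2
      have "ip (mon \<beta> * f) (mon \<alpha> * f) = 0" by (rule wandering_orthogonal[where i = i and \<alpha> = \<beta> and \<beta> = \<alpha>, OF f 2])
      then show ?thesis
        using ip_commute[of "mon \<beta> * f" "mon \<alpha> * f"] fH by (simp add: H2_times)
    qed (rule wandering_orthogonal[where i = i and \<alpha> = \<alpha> and \<beta> = \<beta>, OF f])
    then show ?thesis using False by simp
  qed (simp add: ip_mon_mon fH n)
qed (use f in simp)

lemma wandering_normalize:
  assumes V: "V \<subseteq> N" "\<And>u v. u \<in> V \<Longrightarrow> v \<in> V \<Longrightarrow> u - v \<in> V"
    "\<And>v i. v \<in> V \<Longrightarrow> coord i * v \<in> V" "\<And>v i. v \<in> V \<Longrightarrow> R i v \<in> V"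
    and scl: "\<And>v c. v \<in> V \<Longrightarrow> scl c v \<in> V"
    and v: "v \<in> V" "v \<noteq> 0"
  shows "\<exists>f\<in>V. isometric f \<and> (\<forall>i. R i f = 0)"
proof -
  from wandering_exists[OF V v] obtain f where f: "f \<in> V" "f \<noteq> 0" "\<And>i. R i f = 0" by blast
  have fN: "f \<in> N" using f V by blast
  have fH: "f \<in> H2" using fN by simp
  have n0: "H2_norm f \<noteq> 0" using ip_self_0[OF fH] ip_self[OF fH] f(2) by auto
  define c where "c = complex_of_real (1 / H2_norm f)"
  have "ip (scl c f) (scl c f) = 1"
  proof -
    have "ip (scl c f) (scl c f) = cnj c * (c * ip f f)"
      by (simp only: ip_scl_left ip_scl_right H2_scl fH)
    then show ?thesis using n0 by (simp add: ip_self fH c_def power2_eq_square)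
  qed
  moreover have gV: "scl c f \<in> V" by (intro scl f)
  moreover have "R i (scl c f) = 0" for i
  proof -
    have gN: "scl c f \<in> N" using gV V by blast
    have "ip (R i (scl c f)) (R i (scl c f)) = ip (scl c f) (coord i * R i (scl c f))"
      by (rule ip_R[OF gN R_N[OF gN]])
    also have "\<dots> = c * ip (R i f) (R i (scl c f))"
      using fH fN gN by (simp add: ip_scl_left H2_times R_N ip_R)
    also have "\<dots> = 0" using gN R_N by (simp add: f(3) ip_0_left)
    finally show ?thesis by (rule ip_self_0[OF N_H2[OF R_N[OF gN]]])
  qed
  ultimately show ?thesis using wandering_isometric[of "scl c f"] V(1) by blast
qed

text \<open>Let \<open>f\<close> be a wandering unit vector of \<open>N\<close> and \<open>F\<close> its image under \<open>T\<close>, so that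
  \<open>b * f = a * F\<close> and both are isometric. A second wandering vector orthogonal to the multiples of \<open>f\<close> is
  impossible by \<open>isometric_not_orthogonal\<close>, so \<open>N = f * H2\<close> and \<open>T h = F * adj f h\<close>; as \<open>a\<close>
  lies in \<open>N\<close>, the common factor \<open>\<psi>\<close> is \<open>a / f\<close>. Finally the Toeplitz property of \<open>T\<close> separates the variables: if
  \<open>adj f\<close> commutes with \<open>coord i\<close>, then \<open>f\<close> does not depend on \<open>z $ i\<close>; otherwise some nonzero
  \<open>x\<close> is such that neither \<open>x\<close> nor \<open>F * x\<close> depends on \<open>z $ i\<close>, and then neither does \<open>F\<close>.\<close>

theorem structure_theorem:
  "\<exists>f F \<psi>. isometric f \<and> isometric F \<and> isometric \<psi> \<and> a = f * \<psi> \<and> b = F * \<psi> \<and>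
     (\<forall>i. \<not> depends_on_coord f i \<or> \<not> depends_on_coord F i)"
proof -
  have aH: "a \<in> H2" and bH: "b \<in> H2" by (simp_all add: isometric_H2 isometric_a isometric_b)
  have rab: "rel a b" by (simp add: rel_def aH bH mult.commute)
  then have aN: "a \<in> N" by (auto simp: N_def)
  have "ip a a = 1" using isometric_a mon_0_times[OF aH] unfolding isometric_def by metis
  then have "a \<noteq> 0" using ip_0_left[OF aH] by auto
  have "\<exists>f\<in>N. isometric f \<and> (\<forall>i. R i f = 0)"
    by (rule wandering_normalize[OF _ _ _ _ _ aN \<open>a \<noteq> 0\<close>]) (auto intro: N_minus N_times R_N N_scl)
  then obtain f where fN: "f \<in> N" and f: "isometric f" and Rf: "\<forall>i. R i f = 0" by blast
  note fi [simp] = isometric_H_infty[OF f] and fH [simp] = isometric_H2[OF f]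
  \<comment> \<open>\<open>T\<close> acts on \<open>N\<close> as the quotient \<open>b / a\<close>.\<close>
  define F where "F = T f"
  have rfF: "rel f F" unfolding F_def by (rule N_rel[OF fN])
  have FH: "F \<in> H2" and bfaF: "b * f = a * F" using rfF by (auto simp: rel_def)
  have F: "isometric F" unfolding isometric_def
  proof (intro conjI allI FH)
    fix \<alpha> \<beta> :: "'n \<Rightarrow> nat"
    have "ip (mon \<alpha> * F) (mon \<beta> * F) = ip (a * (mon \<alpha> * F)) (a * (mon \<beta> * F))"
      by (simp add: isometric_ip[OF isometric_a] H2_times FH)
    also have "\<dots> = ip (b * (mon \<alpha> * f)) (b * (mon \<beta> * f))"
      by (simp only: mult.left_commute[of a] mult.left_commute[of b] bfaF)
    also have "\<dots> = (if \<alpha> = \<beta> then 1 else 0)"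
      using f by (simp add: isometric_ip[OF isometric_b] H2_times isometric_def)
    finally show "ip (mon \<alpha> * F) (mon \<beta> * F) = (if \<alpha> = \<beta> then 1 else 0)" .
  qed
  note Fi [simp] = isometric_H_infty[OF F]
  have N_f: "n = f * adj f n" if n: "n \<in> N" for n
  proof -
    \<comment> \<open>The part of \<open>N\<close> orthogonal to the multiples of \<open>f\<close>; it reduces the shifts.\<close>
    define V where "V = {v \<in> N. \<forall>\<alpha>. ip (mon \<alpha> * f) v = 0}"
    have orthV: "u = 0" if u: "u \<in> V" for u
    proof (rule ccontr)
      assume "u \<noteq> 0"
      have monN: "mon \<alpha> * f \<in> N" for \<alpha> by (intro N_times fN mon_H_infty)
      have XV: "coord i * v \<in> V" if v: "v \<in> V" for v i
      proof -
        have vN: "v \<in> N" and v0: "\<And>\<alpha>. ip (mon \<alpha> * f) v = 0" using v by (auto simp: V_def)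
        have "ip (mon \<alpha> * f) (coord i * v) = 0" for \<alpha>
        proof (cases "\<alpha> i = 0")
          case True
          have "ip (mon \<alpha> * f) (coord i * v) = ip (R i (mon \<alpha> * f)) v" by (simp add: ip_R monN vN)
          then show ?thesis using R_mon_wandering[where i = i and \<beta> = \<alpha>, OF fN Rf True] vN by (simp add: ip_0_left)
        next
          case False
          define \<gamma> where "\<gamma> = \<alpha>(i := \<alpha> i - 1)"
          have \<alpha>: "\<alpha> = \<gamma>(i := Suc (\<gamma> i))" using False by (auto simp: \<gamma>_def)
          show ?thesis by (subst \<alpha>) (simp add: mon_Suc_times ip_coord_coord H2_times vN v0)
        qed
        then show ?thesis using vN by (simp add: V_def N_times)
      qed
      have RV: "R i v \<in> V" if v: "v \<in> V" for v i
      proof -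
        have vN: "v \<in> N" and v0: "\<And>\<alpha>. ip (mon \<alpha> * f) v = 0" using v by (auto simp: V_def)
        have "ip (mon \<alpha> * f) (R i v) = 0" for \<alpha>
        proof -
          have "ip (R i v) (mon \<alpha> * f) = ip v (mon (\<alpha>(i := Suc (\<alpha> i))) * f)"
            by (simp add: ip_R vN monN mon_Suc_times)
          also have "\<dots> = cnj (ip (mon (\<alpha>(i := Suc (\<alpha> i))) * f) v)"
            by (rule ip_commute) (use vN monN in auto)
          also have "\<dots> = 0" by (simp add: v0)
          finally show ?thesis using ip_commute[of "R i v" "mon \<alpha> * f"] vN monN R_N by simp
        qed
        then show ?thesis using vN by (simp add: V_def R_N)
      qed
      \<comment> \<open>A second wandering vector, with all its monomial multiples orthogonal to those of \<open>f\<close>.\<close>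
      have "\<exists>g\<in>V. isometric g \<and> (\<forall>i. R i g = 0)"
        by (rule wandering_normalize[OF _ _ XV RV _ u \<open>u \<noteq> 0\<close>])
           (auto simp: V_def N_minus N_scl ip_diff_right ip_scl_right H2_times)
      then obtain g where gV: "g \<in> V" and g: "isometric g" by blast
      have "mon \<beta> * g \<in> V" for \<beta>
      proof (induction \<beta> rule: multi_index_induct)
        case zero
        then show ?case using gV by (simp add: mon_0_times isometric_H2[OF g])
      next
        case (Suc \<beta> i)
        then show ?case unfolding mon_Suc_times by (rule XV)
      qed
      then have "ip (mon \<alpha> * f) (mon \<beta> * g) = 0" for \<alpha> \<beta> by (simp add: V_def)
      from isometric_not_orthogonal[OF f g this] show False .
    qed
    have nH: "n \<in> H2" using n by simp
    have "f * adj f n \<in> N" using rel_times[OF rfF] unfolding N_def rel_def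
      by (auto simp: H2_times adj_H2 nH FH mult.assoc[symmetric] bfaF intro!: exI[of _ "F * adj f n"])
    then have dN: "n - f * adj f n \<in> N" by (intro N_minus n)
    have "ip (mon \<alpha> * f) (n - f * adj f n) = 0" for \<alpha>
    proof -
      have "ip (f * mon \<alpha>) (f * adj f n) = ip (mon \<alpha>) (adj f n)"
        by (intro isometric_ip f) (simp_all add: adj_H2 nH)
      also have "\<dots> = ip (f * mon \<alpha>) n" by (simp add: ip_adj_right nH)
      finally show ?thesis by (simp add: ip_diff_right H2_times adj_H2 nH mult.commute[of "mon \<alpha>"])
    qed
    then have "n - f * adj f n \<in> V" using dN by (simp add: V_def)
    from orthV[OF this] show ?thesis by simp
  qed
  have Tf: "T h = F * adj f h" if h: "h \<in> H2" for h
  proof -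
    have QN: "Q h \<in> N" by (rule Q_N[OF h])
    have "adj f (Q h) = adj f h"
    proof (rule adj_eqI)
      fix g :: "complex ^ 'n \<Rightarrow> complex" assume g: "g \<in> H2"
      have "f * g \<in> N" unfolding N_def rel_def
        using g by (auto simp: H2_times FH mult.assoc[symmetric] bfaF intro!: exI[of _ "F * g"])
      then show "ip (adj f h) g = ip (Q h) (f * g)"
        by (simp add: ip_adj_left h g ip_Q)
    qed (use QN h in \<open>auto simp: adj_H2\<close>)
    with N_f[OF QN] have Qh: "Q h = f * adj f h" by simp
    have "rel (f * adj f h) (F * adj f h)"
      by (simp add: rel_def H2_times adj_H2 h mult.assoc[symmetric] bfaF)
    from rel_T[OF this] show ?thesis using T_Q[OF h] Qh by simp
  qed
  define \<psi> where "\<psi> = adj f a"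
  have \<psi>H: "\<psi> \<in> H2" by (simp add: \<psi>_def adj_H2 aH)
  have a: "a = f * \<psi>" unfolding \<psi>_def by (rule N_f[OF aN])
  have b: "b = F * \<psi>"
  proof -
    have "f * b = f * (F * \<psi>)" using bfaF unfolding a by (simp add: mult_ac)
    then have "adj f (f * b) = adj f (f * (F * \<psi>))" by simp
    then show ?thesis by (simp add: adj_isometric[OF f] bH H2_times \<psi>H)
  qed
  have \<psi>: "isometric \<psi>" unfolding isometric_def
  proof (intro conjI allI \<psi>H)
    fix \<alpha> \<beta> :: "'n \<Rightarrow> nat"
    have "ip (mon \<alpha> * \<psi>) (mon \<beta> * \<psi>) = ip (f * (mon \<alpha> * \<psi>)) (f * (mon \<beta> * \<psi>))"
      by (simp add: isometric_ip[OF f] H2_times \<psi>H)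
    also have "\<dots> = ip (mon \<alpha> * a) (mon \<beta> * a)" by (simp add: a mult.left_commute)
    finally show "ip (mon \<alpha> * \<psi>) (mon \<beta> * \<psi>) = (if \<alpha> = \<beta> then 1 else 0)"
      using isometric_a by (simp add: isometric_def)
  qed
  have sep: "adj (coord i) f = 0 \<or> adj (coord i) F = 0" for i
  proof (cases "\<forall>h\<in>H2. adj f (coord i * h) = coord i * adj f h")
    case True
    have "adj (coord i) f = 0"
    proof (rule adj_eqI)
      fix h :: "complex ^ 'n \<Rightarrow> complex" assume h: "h \<in> H2"
      have "ip (coord i * h) (f * mon (\<lambda>_. 0)) = ip (coord i * adj f h) (mon (\<lambda>_. 0))"
        using True h by (simp add: ip_adj_left[symmetric] H2_times)
      also have "\<dots> = 0" by (simp add: ip_mon coef_coord_times adj_H2 h H2_times)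
      finally have "ip (coord i * h) f = 0" using mon_0_times[OF fH] by (simp add: mult.commute)
      then show "ip 0 h = ip f (coord i * h)"
        using ip_commute[of "coord i * h" f] h by (simp add: H2_times ip_0_left)
    qed (simp_all add: H2_0)
    then show ?thesis ..
  next
    case False
    then obtain h where h: "h \<in> H2" and ne: "adj f (coord i * h) \<noteq> coord i * adj f h" by blast
    define x where "x = adj f (coord i * h) - coord i * adj f h"
    have x: "x \<in> H2" "x \<noteq> 0" unfolding x_def using ne h by (auto intro!: H2_minus simp: adj_H2 H2_times)
    have FxT: "F * x = T (coord i * h) - coord i * T h"
      by (simp add: x_def times_minus Tf h H2_times mult.left_commute)
    have e0: "adj (coord i) (F * x) = 0"
      by (simp add: FxT adj_minus H2_times h adj_coord_T_coord adj_coord_coord)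
    have x0: "adj (coord i) x = 0"
    proof (rule adj_eqI)
      fix g :: "complex ^ 'n \<Rightarrow> complex" assume g: "g \<in> H2"
      have "ip x (coord i * g) = ip (F * x) (F * (coord i * g))" by (simp add: isometric_ip[OF F] x g H2_times)
      also have "\<dots> = ip (adj (coord i) (F * x)) (F * g)"
        by (simp add: ip_adj_left H2_times x g mult.left_commute)
      also have "\<dots> = 0" by (simp add: e0 ip_0_left H2_times g)
      finally show "ip 0 g = ip x (coord i * g)" by (simp add: ip_0_left g)
    qed (simp_all add: H2_0 x)
    define y where "y = adj (coord i) F"
    define F0 where "F0 = F - coord i * y"
    have y: "y \<in> H2" by (simp add: y_def adj_H2 FH)
    have F0H: "F0 \<in> H2" unfolding F0_def by (intro H2_minus FH H2_times coord_H_infty y)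
    have F00: "adj (coord i) F0 = 0"
      by (simp add: F0_def adj_minus FH H2_times y adj_coord_coord y_def[symmetric])
    have nd: "\<not> depends_on_coord (F * x) i" "\<not> depends_on_coord x i" "\<not> depends_on_coord F0 i"
      using e0 x0 F00 by (simp_all add: not_depends_iff H2_times x F0H)
    \<comment> \<open>\<open>coord i * y * x = F * x - F0 * x\<close> does not depend on \<open>z $ i\<close> and vanishes for \<open>z $ i = 0\<close>.\<close>
    have prod0: "(coord i * y) z * x z = 0" if z: "z \<in> polydisc" for z
    proof -
      define w where "w = (\<chi> j. if j = i then 0 else z $ j)"
      have w: "w \<in> polydisc" using z by (auto simp: w_def polydisc_def)
      have zw: "\<forall>j. j \<noteq> i \<longrightarrow> z $ j = w $ j" by (simp add: w_def)
      have eq: "(F * x) z = (F * x) w" "x z = x w" "F0 z = F0 w"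
        using nd z w zw unfolding depends_on_coord_def by blast+
      have "F0 w = F w" by (simp add: F0_def coord_def w_def pointwise)
      have "(coord i * y) z * x z = (F * x) z - F0 z * x z" by (simp add: F0_def pointwise algebra_simps)
      also have "\<dots> = 0" unfolding eq \<open>F0 w = F w\<close> by (simp add: pointwise)
      finally show ?thesis .
    qed
    obtain w where w: "x w \<noteq> 0" using x(2) by (auto simp: pointwise)
    then have wp: "w \<in> polydisc" using x(1) by (auto simp: H2_def)
    have Xy: "coord i * y \<in> H2" by (intro H2_times coord_H_infty y)
    have "(coord i * y) z = 0" for z
    proof (cases "z \<in> polydisc")
      case True
      show ?thesis
        by (rule polydisc_identity[where f = "coord i * y" and g = x and w = w and z = z, OF _ _ prod0 wp w True]) (use Xy x in \<open>auto simp: H2_def\<close>)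
    qed (use Xy in \<open>simp add: H2_def\<close>)
    then have "coord i * y = 0" by (simp add: pointwise)
    then have "y = 0" using adj_coord_coord[OF y, of i] by (simp add: adj_0)
    then show ?thesis by (simp add: y_def)
  qed
  show ?thesis
    using f F \<psi> a b sep by (intro exI[of _ f] exI[of _ F] exI[of _ \<psi>]) (auto simp: not_depends_iff FH)
qed

end

section \<open>Inner functions and projections\<close>

text \<open>A fixed sequence of radii, since the dominated convergence theorem is about sequences.\<close>

definition radii :: "nat \<Rightarrow> real" where "radii n = 1 - 1 / (real n + 2)"

lemma radii: "0 < radii n" "radii n < 1" by (auto simp: radii_def field_simps)

lemma radii_tendsto: "radii \<longlonglongrightarrow> 1"
proof -
  have "(\<lambda>n. inverse (real (Suc (Suc n)))) \<longlonglongrightarrow> 0"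
    using LIMSEQ_Suc[OF LIMSEQ_inverse_real_of_nat] .
  then have "(\<lambda>n. 1 - inverse (real (Suc (Suc n)))) \<longlonglongrightarrow> 1 - 0" by (intro tendsto_diff tendsto_const)
  then show ?thesis by (simp add: radii_def[abs_def] divide_inverse add.commute)
qed

lemma filterlim_radii: "filterlim radii (at_left 1) sequentially"
  unfolding filterlim_at using radii_tendsto radii by (auto simp: less_imp_neq intro!: always_eventually)

text \<open>By dominated convergence the square means tend to the integral of the boundary values, and by
  the coefficient formula they tend to the squared norm.\<close>

lemma H2_norm_limit:
  assumes f: "f \<in> H2" and B: "\<And>z. z \<in> polydisc \<Longrightarrow> cmod (f z) \<le> B"
    and p: "p \<in> borel_measurable borel"
    and lim: "AE \<zeta> in torus_measure. (\<lambda>n. (cmod (f (radii n *\<^sub>R \<zeta>)))\<^sup>2) \<longlonglongrightarrow> p \<zeta>"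
  shows "(H2_norm f)\<^sup>2 = (\<integral>\<zeta>. p \<zeta> \<partial>torus_measure)"
proof -
  note d = H2_disc_fun[OF f]
  have L: "(\<lambda>n. square_mean f (radii n)) \<longlonglongrightarrow> (\<integral>\<zeta>. p \<zeta> \<partial>torus_measure)"
    unfolding square_mean_def
  proof (rule integral_dominated_convergence[where w = "\<lambda>_. B\<^sup>2"])
    show "(\<lambda>\<zeta>. (cmod (f (radii n *\<^sub>R \<zeta>)))\<^sup>2) \<in> borel_measurable torus_measure" for n
      using measurable_scaleR_disc_fun[OF d, of "radii n"] by measurable
    show "AE \<zeta> in torus_measure. norm ((cmod (f (radii n *\<^sub>R \<zeta>)))\<^sup>2) \<le> B\<^sup>2" for n
      using AE_torus
    proof eventually_elim
      case (elim \<zeta>)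
      have "cmod (f (radii n *\<^sub>R \<zeta>)) \<le> B"
        by (intro B torus_scale_polydisc elim) (use radii[of n] in auto)
      then show ?case by (simp add: power_mono)
    qed
  qed (use p lim in simp_all)
  have "(\<integral>\<zeta>. p \<zeta> \<partial>torus_measure) \<le> (H2_norm f)\<^sup>2"
    by (rule LIMSEQ_le_const2[OF L]) (intro exI allI impI square_mean_le[OF d H2_norm_sq[OF f]] less_imp_le[OF radii(1)] radii(2))
  moreover have "(H2_norm f)\<^sup>2 \<le> (\<integral>\<zeta>. p \<zeta> \<partial>torus_measure)"
  proof (rule has_sum_le_finite_sums[OF H2_norm_sq[OF f]])
    fix A :: "('a \<Rightarrow> nat) set" assume A: "finite A"
    have "(\<lambda>n. \<Sum>\<alpha>\<in>A. (cmod (coef f \<alpha>))\<^sup>2 * radii n ^ (2 * deg \<alpha>)) \<longlonglongrightarrow> (\<Sum>\<alpha>\<in>A. (cmod (coef f \<alpha>))\<^sup>2 * 1 ^ (2 * deg \<alpha>))"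
      by (intro tendsto_sum tendsto_mult tendsto_const tendsto_power radii_tendsto)
    then have "(\<lambda>n. \<Sum>\<alpha>\<in>A. (cmod (coef f \<alpha>))\<^sup>2 * radii n ^ (2 * deg \<alpha>)) \<longlonglongrightarrow> (\<Sum>\<alpha>\<in>A. (cmod (coef f \<alpha>))\<^sup>2)" by simp
    then show "(\<Sum>\<alpha>\<in>A. (cmod (coef f \<alpha>))\<^sup>2) \<le> (\<integral>\<zeta>. p \<zeta> \<partial>torus_measure)"
    proof (rule LIMSEQ_le[OF _ L], intro exI allI impI)
      show "(\<Sum>\<alpha>\<in>A. (cmod (coef f \<alpha>))\<^sup>2 * radii n ^ (2 * deg \<alpha>)) \<le> square_mean f (radii n)" for n
        by (rule finite_sum_le_has_sum[OF square_mean_has_sum[OF d radii]]) (use A in auto)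
    qed
  qed
  ultimately show ?thesis by simp
qed

lemma restr_eq: "restr \<phi> = \<phi> * mon (\<lambda>_. 0)"
  by (auto simp: pointwise restr_def mon_def monom_fun_def)

lemma restr_H2: "\<phi> \<in> H_infty \<Longrightarrow> restr \<phi> \<in> H2"
  unfolding restr_eq by (intro H2_times H2_mon)

lemma restr_ray: "\<zeta> \<in> torus \<Longrightarrow> 0 < r \<Longrightarrow> r < 1 \<Longrightarrow> restr \<phi> (r *\<^sub>R \<zeta>) = \<phi> (r *\<^sub>R \<zeta>)"
  by (simp add: restr_def torus_scale_polydisc)

lemma eventually_at_left_1: "\<forall>\<^sub>F r in at_left (1::real). 0 < r \<and> r < 1"
  using eventually_at_left_real[of 0 1] by simp

lemma inner_function_modulus:
  assumes "inner_function \<phi>"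
  shows "AE \<zeta> in torus_measure. ((\<lambda>r. cmod (\<phi> (r *\<^sub>R \<zeta>))) \<longlongrightarrow> 1) (at_left 1)"
proof -
  have "AE \<zeta> in torus_measure. \<exists>w. ((\<lambda>r. \<phi> (r *\<^sub>R \<zeta>)) \<longlongrightarrow> w) (at_left 1) \<and> cmod w = 1"
    using assms by (simp add: inner_function_def)
  then show ?thesis
  proof eventually_elim
    case (elim \<zeta>)
    then obtain w where "((\<lambda>r. \<phi> (r *\<^sub>R \<zeta>)) \<longlongrightarrow> w) (at_left 1)" "cmod w = 1" by blast
    then show ?case using tendsto_norm by fastforce
  qed
qed

text \<open>Norms of \<open>mon \<alpha> * \<phi> + \<i>\<^sup>k mon \<beta> * \<phi>\<close> are integrals over the torus in which the boundary
  values of \<open>\<phi>\<close> have modulus one and disappear. Polarization gives the inner products.\<close>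

lemma inner_imp_isometric:
  fixes \<phi> :: "complex ^ 'n \<Rightarrow> complex"
  assumes \<phi>: "inner_function \<phi>"
  shows "isometric (restr \<phi>)"
  unfolding isometric_def
proof (intro conjI allI)
  have \<phi>i: "\<phi> \<in> H_infty" using \<phi> by (simp add: inner_function_def)
  show \<psi>: "restr \<phi> \<in> H2" by (rule restr_H2[OF \<phi>i])
  obtain B where B: "0 \<le> B" "\<And>z. z \<in> polydisc \<Longrightarrow> cmod (\<phi> z) \<le> B" by (rule H_infty_bound[OF \<phi>i]) (rule that)
  fix \<alpha> \<beta> :: "'n \<Rightarrow> nat"
  define p where "p k \<zeta> = (cmod (monom_fun \<alpha> \<zeta> + \<i> ^ k * monom_fun \<beta> \<zeta>))\<^sup>2" for k and \<zeta> :: "complex ^ 'n"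
  have pm [measurable]: "p k \<in> borel_measurable borel" for k unfolding p_def by measurable
  have pb: "p k \<zeta> \<le> 4" if "\<zeta> \<in> torus" for k \<zeta>
  proof -
    have "cmod (monom_fun \<alpha> \<zeta> + \<i> ^ k * monom_fun \<beta> \<zeta>) \<le> 2"
      using norm_triangle_ineq[of "monom_fun \<alpha> \<zeta>" "\<i> ^ k * monom_fun \<beta> \<zeta>"]
      by (simp add: norm_mult norm_power norm_monom_fun_torus[OF that])
    then have "p k \<zeta> \<le> 2\<^sup>2" unfolding p_def by (intro power_mono) auto
    then show ?thesis by simp
  qed
  have pint: "integrable torus_measure (p k)" for k
  proof (rule torus.integrable_const_bound)
    show "AE \<zeta> in torus_measure. norm (p k \<zeta>) \<le> 4"
      using AE_torus by eventually_elim (use pb in \<open>simp add: p_def\<close>)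
  qed simp
  have nrm: "(H2_norm (\<lambda>z. (mon \<alpha> * restr \<phi>) z + \<i> ^ k * (mon \<beta> * restr \<phi>) z))\<^sup>2 = (\<integral>\<zeta>. p k \<zeta> \<partial>torus_measure)" for k
  proof (rule H2_norm_limit)
    show "(\<lambda>z. (mon \<alpha> * restr \<phi>) z + \<i> ^ k * (mon \<beta> * restr \<phi>) z) \<in> H2"
      by (intro H2_add H2_cmult H2_times mon_H_infty \<psi>)
    show "cmod ((mon \<alpha> * restr \<phi>) z + \<i> ^ k * (mon \<beta> * restr \<phi>) z) \<le> 2 * B" if z: "z \<in> polydisc" for z
    proof -
      have "cmod (monom_fun \<gamma> z * \<phi> z) \<le> 1 * B" for \<gamma>
        unfolding norm_mult by (intro mult_mono norm_monom_fun_le_1 z B) auto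
      from this[of \<alpha>] this[of \<beta>] have "cmod (monom_fun \<alpha> z * \<phi> z) + cmod (\<i> ^ k * (monom_fun \<beta> z * \<phi> z)) \<le> 2 * B"
        by (simp add: norm_mult norm_power)
      then show ?thesis
        using z norm_triangle_ineq[of "monom_fun \<alpha> z * \<phi> z" "\<i> ^ k * (monom_fun \<beta> z * \<phi> z)"]
        by (simp add: times_fun_apply mon_def restr_def)
    qed
    show "AE \<zeta> in torus_measure. (\<lambda>n. (cmod ((mon \<alpha> * restr \<phi>) (radii n *\<^sub>R \<zeta>) + \<i> ^ k * (mon \<beta> * restr \<phi>) (radii n *\<^sub>R \<zeta>)))\<^sup>2) \<longlonglongrightarrow> p k \<zeta>"
      using AE_torus inner_function_modulus[OF \<phi>]
    proof eventually_elim
      case (elim \<zeta>)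
      have e: "(cmod ((mon \<alpha> * restr \<phi>) (radii n *\<^sub>R \<zeta>) + \<i> ^ k * (mon \<beta> * restr \<phi>) (radii n *\<^sub>R \<zeta>)))\<^sup>2 =
        (cmod (\<phi> (radii n *\<^sub>R \<zeta>)))\<^sup>2 * (cmod (of_real (radii n) ^ deg \<alpha> * monom_fun \<alpha> \<zeta> + \<i> ^ k * (of_real (radii n) ^ deg \<beta> * monom_fun \<beta> \<zeta>)))\<^sup>2" for n
      proof -
        have "radii n *\<^sub>R \<zeta> \<in> polydisc" using radii[of n] by (intro torus_scale_polydisc elim(1)) auto
        then have "(mon \<alpha> * restr \<phi>) (radii n *\<^sub>R \<zeta>) + \<i> ^ k * (mon \<beta> * restr \<phi>) (radii n *\<^sub>R \<zeta>) =
          \<phi> (radii n *\<^sub>R \<zeta>) * (of_real (radii n) ^ deg \<alpha> * monom_fun \<alpha> \<zeta> + \<i> ^ k * (of_real (radii n) ^ deg \<beta> * monom_fun \<beta> \<zeta>))"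
          by (simp add: times_fun_apply mon_def restr_def monom_fun_scaleR algebra_simps)
        then show ?thesis by (simp only: norm_mult power_mult_distrib)
      qed
      have "(\<lambda>n. (cmod (\<phi> (radii n *\<^sub>R \<zeta>)))\<^sup>2 * (cmod (of_real (radii n) ^ deg \<alpha> * monom_fun \<alpha> \<zeta> + \<i> ^ k * (of_real (radii n) ^ deg \<beta> * monom_fun \<beta> \<zeta>)))\<^sup>2)
        \<longlonglongrightarrow> 1\<^sup>2 * (cmod (of_real 1 ^ deg \<alpha> * monom_fun \<alpha> \<zeta> + \<i> ^ k * (of_real 1 ^ deg \<beta> * monom_fun \<beta> \<zeta>)))\<^sup>2"
        by (intro tendsto_mult tendsto_power tendsto_norm tendsto_add tendsto_const tendsto_of_real radii_tendsto
            filterlim_compose[OF elim(2) filterlim_radii])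
      then show ?case unfolding e p_def by simp
    qed
  qed (rule pm)
  have "ip (mon \<alpha> * restr \<phi>) (mon \<beta> * restr \<phi>) =
      (\<Sum>k<4. \<i> ^ k * (\<integral>\<zeta>. complex_of_real (p k \<zeta>) \<partial>torus_measure)) / 4"
    unfolding H2_inner_def nrm by simp
  also have "\<dots> = (\<integral>\<zeta>. (\<Sum>k<4. \<i> ^ k * complex_of_real (p k \<zeta>)) / 4 \<partial>torus_measure)"
    by (simp add: pint)
  also have "\<dots> = (\<integral>\<zeta>. monom_fun \<alpha> \<zeta> * cnj (monom_fun \<beta> \<zeta>) \<partial>torus_measure)"
    unfolding p_def polarization_complex ..
  also have "\<dots> = (if \<alpha> = \<beta> then 1 else 0)" by (rule integral_monom_fun)
  finally show "ip (mon \<alpha> * restr \<phi>) (mon \<beta> * restr \<phi>) = (if \<alpha> = \<beta> then 1 else 0)" .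
qed

lemma H2_proj_eq:
  assumes \<phi>: "isometric (restr \<phi>)" and h: "h \<in> H2"
  shows "H2_proj (mult_H2 \<phi>) h = restr \<phi> * adj (restr \<phi>) h"
proof -
  define a where "a = restr \<phi>"
  have a: "isometric a" using \<phi> by (simp add: a_def)
  note ai [simp] = isometric_H_infty[OF a]
  have M: "mult_H2 \<phi> = (\<lambda>f. a * f) ` H2"
    unfolding mult_H2_def
    by (rule image_cong) (auto simp: a_def restr_def pointwise H2_def)
  have diff: "(\<lambda>z. f z - g z) = f - g" for f g :: "complex ^ 'a \<Rightarrow> complex" by (simp add: pointwise)
  show ?thesis unfolding H2_proj_def M diff a_def[symmetric]
  proof (rule the_equality)
    show "a * adj a h \<in> (*) a ` H2 \<and> (\<forall>ha\<in>(*) a ` H2. ip (h - a * adj a h) ha = 0)"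
    proof (intro conjI ballI)
      show "a * adj a h \<in> (*) a ` H2" using h by (simp add: adj_H2)
      fix g assume "g \<in> (*) a ` H2"
      then obtain k where k: "k \<in> H2" "g = a * k" by blast
      then show "ip (h - a * adj a h) g = 0"
        by (simp add: ip_diff_left h H2_times adj_H2 isometric_ip[OF a] ip_adj_left)
    qed
    fix g assume g: "g \<in> (*) a ` H2 \<and> (\<forall>ha\<in>(*) a ` H2. ip (h - g) ha = 0)"
    then obtain k where k: "k \<in> H2" "g = a * k" by blast
    have "k = adj a h"
    proof (rule ip_ext)
      fix x :: "complex ^ 'a \<Rightarrow> complex" assume x: "x \<in> H2"
      from g have "\<forall>y\<in>(*) a ` H2. ip (h - g) y = 0" by blast
      from bspec[OF this imageI[OF x]] have "ip (h - a * k) (a * x) = 0" unfolding k(2) .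
      then show "ip k x = ip (adj a h) x"
        using x k h by (simp add: ip_diff_left H2_times isometric_ip[OF a] ip_adj_left)
    qed (use k h in \<open>auto simp: adj_H2\<close>)
    then show "g = a * adj a h" using k by simp
  qed
qed

lemma commutator_iff:
  assumes \<phi>: "isometric (restr \<phi>)" "isometric (restr \<psi>)"
  defines "a \<equiv> restr \<phi>" and "b \<equiv> restr \<psi>"
  shows "(\<forall>f\<in>H2. commutator (H2_proj (mult_H2 \<phi>)) (H2_proj (mult_H2 \<psi>)) f = (\<lambda>_. 0)) \<longleftrightarrow>
    (\<forall>h\<in>H2. a * adj a (b * adj b h) = b * adj b (a * adj a h))"
proof (rule ball_cong[OF refl])
  fix h :: "complex ^ 'a \<Rightarrow> complex" assume h: "h \<in> H2"
  have ab: "a \<in> H_infty" "b \<in> H_infty" using \<phi> by (auto simp: a_def b_def isometric_H_infty)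
  have "commutator (H2_proj (mult_H2 \<phi>)) (H2_proj (mult_H2 \<psi>)) h =
     (\<lambda>z. (a * adj a (b * adj b h)) z - (b * adj b (a * adj a h)) z)"
  proof -
    have "H2_proj (mult_H2 \<phi>) x = a * adj a x" "H2_proj (mult_H2 \<psi>) x = b * adj b x" if "x \<in> H2" for x
      unfolding a_def b_def using that by (simp_all add: H2_proj_eq \<phi>)
    then show ?thesis using h ab by (simp add: commutator_def H2_times adj_H2)
  qed
  then show "(commutator (H2_proj (mult_H2 \<phi>)) (H2_proj (mult_H2 \<psi>)) h = (\<lambda>_. 0)) =
     (a * adj a (b * adj b h) = b * adj b (a * adj a h))"
    by (simp add: fun_eq_iff)
qed

section \<open>Separated factors give commuting projections\<close>

text \<open>By duality this says that the backward shift in direction \<open>i\<close> commutes with multiplication by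
  \<open>f\<close>. Split \<open>g\<close> into a part that does not depend on \<open>z $ i\<close> and a multiple of \<open>coord i\<close>; multiplication by \<open>f\<close>
  respects the splitting.\<close>

lemma adj_times_coord:
  assumes f: "f \<in> H_infty" and nd: "\<not> depends_on_coord f i" and h: "h \<in> H2"
  shows "adj f (coord i * h) = coord i * adj f h"
proof -
  have key: "adj (coord i) (f * g) = f * adj (coord i) g" if g: "g \<in> H2" for g
  proof -
    define y where "y = adj (coord i) g"
    have y: "y \<in> H2" using g by (simp add: y_def adj_H2)
    define g0 where "g0 = g - coord i * y"
    have g0: "g0 \<in> H2" unfolding g0_def by (intro H2_minus g H2_times coord_H_infty y)
    have "adj (coord i) g0 = 0" by (simp add: g0_def adj_minus g H2_times y adj_coord_coord y_def[symmetric])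
    then have "\<not> depends_on_coord g0 i" using not_depends_iff[OF g0] by blast
    with nd have "\<not> depends_on_coord (f * g0) i"
      unfolding depends_on_coord_def times_fun_apply by metis
    then have "adj (coord i) (f * g0) = 0" using not_depends_iff H2_times[OF f g0] by blast
    moreover have "f * g0 = f * g - coord i * (f * y)" by (simp add: g0_def times_minus mult.left_commute)
    ultimately have "adj (coord i) (f * g) - f * y = 0"
      by (simp add: adj_minus H2_times f g y adj_coord_coord)
    then show ?thesis by (simp add: y_def)
  qed
  show ?thesis
    by (rule adj_eqI) (simp_all add: f h H2_times adj_H2 ip_adj_right[symmetric] key[symmetric] ip_adj_left
       ip_adj_right[of "coord i" _ h, symmetric])
qed

lemma adj_times_mon:
  assumes f: "f \<in> H_infty" and h: "h \<in> H2" and nd: "\<And>i. \<gamma> i \<noteq> 0 \<Longrightarrow> \<not> depends_on_coord f i"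
  shows "adj f (mon \<gamma> * h) = mon \<gamma> * adj f h"
  using nd
proof (induction \<gamma> rule: multi_index_induct)
  case zero
  then show ?case using f h by (simp add: mon_0_times adj_H2)
next
  case (Suc \<gamma> i)
  have nd: "\<not> depends_on_coord f k" if "\<gamma> k \<noteq> 0 \<or> k = i" for k
    using Suc.prems[of k] that by (cases "k = i") auto
  then have "adj f (mon \<gamma> * h) = mon \<gamma> * adj f h" by (intro Suc.IH) blast
  moreover have "adj f (coord i * (mon \<gamma> * h)) = coord i * adj f (mon \<gamma> * h)"
    by (rule adj_times_coord) (use f h nd in \<open>auto intro: H2_times\<close>)
  ultimately show ?case unfolding mon_Suc_times by simp
qed

lemma coef_0_of_not_depends:
  assumes F: "F \<in> H2" and nd: "\<not> depends_on_coord F i" and \<gamma>: "\<gamma> i \<noteq> 0"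
  shows "coef F \<gamma> = 0"
proof -
  have "coef (adj (coord i) F) (\<gamma>(i := \<gamma> i - 1)) = coef F \<gamma>"
    using \<gamma> by (simp add: coef_adj_coord F)
  moreover have "adj (coord i) F = 0" using nd not_depends_iff[OF F] by blast
  moreover have "coef 0 \<beta> = 0" for \<beta> :: "'a \<Rightarrow> nat"
    using ip_mon[OF H2_0, of \<beta>] ip_0_left[OF H2_mon, of \<beta>] by simp
  ultimately show ?thesis by simp
qed

text \<open>The Taylor polynomials of \<open>F\<close> contain only variables on which \<open>f\<close> does not depend, and for
  those monomials \<open>adj_times_mon\<close> applies. At a fixed point \<open>w\<close> both sides are bounded functionals, first of \<open>F\<close>
  and then of \<open>h\<close>, so the identity passes to the limit.\<close>

lemma adj_times_separated:
  assumes f: "f \<in> H_infty" and F: "F \<in> H_infty" "F \<in> H2"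
    and sep: "\<And>i. \<not> depends_on_coord f i \<or> \<not> depends_on_coord F i" and h: "h \<in> H2"
  shows "adj f (F * h) = F * adj f h"
proof
  fix w :: "complex ^ 'a"
  have H: "adj f (F * h) \<in> H2" "F * adj f h \<in> H2" using f F h by (auto intro: H2_times adj_H2)
  show "adj f (F * h) w = (F * adj f h) w"
  proof (cases "w \<in> polydisc")
    case False
    then show ?thesis using H by (simp add: H2_def)
  next
    case w: True
    note kw = Szego_kernel_H2[OF w]
    have fk: "f * Szego_kernel w \<in> H2" by (intro H2_times f kw)
    have ev: "adj f x w = ip x (f * Szego_kernel w)" if "x \<in> H2" for x
      using ip_Szego_kernel[OF w adj_H2[OF f that]] ip_adj_left[OF f that kw] by simp
    have poly: "ip (mon \<beta> * F) (f * Szego_kernel w) = F w * ip (mon \<beta>) (f * Szego_kernel w)" for \<beta>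
    proof -
      obtain C where "bounded_functional (\<lambda>x. ip (mon \<beta> * x) (f * Szego_kernel w)) C"
        using bounded_functional_times[OF mon_H_infty fk] by blast
      from functional_expand[OF this F(2)]
      have 1: "((\<lambda>\<gamma>. coef F \<gamma> * ip (mon \<beta> * mon \<gamma>) (f * Szego_kernel w)) has_sum ip (mon \<beta> * F) (f * Szego_kernel w)) UNIV" .
      have tt: "coef F \<gamma> * ip (mon \<beta> * mon \<gamma>) (f * Szego_kernel w) = coef F \<gamma> * monom_fun \<gamma> w * ip (mon \<beta>) (f * Szego_kernel w)" for \<gamma>
      proof (cases "coef F \<gamma> = 0")
        case False
        then have nd: "\<not> depends_on_coord f i" if "\<gamma> i \<noteq> 0" for i
          using coef_0_of_not_depends[where i = i and \<gamma> = \<gamma>, OF F(2) _ that] sep[of i] False by blast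
        have "ip (mon \<gamma> * mon \<beta>) (f * Szego_kernel w) = (mon \<gamma> * adj f (mon \<beta>)) w"
          using adj_times_mon[OF f H2_mon nd, of \<gamma> \<beta>] ev[of "mon \<gamma> * mon \<beta>"] by (simp add: H2_times)
        also have "\<dots> = monom_fun \<gamma> w * ip (mon \<beta>) (f * Szego_kernel w)"
          using w by (simp add: times_fun_apply ev mon_def restr_def H2_mon[unfolded mon_def restr_def])
        finally show ?thesis by (simp add: mult.commute mult.left_commute)
      qed simp
      have 2: "((\<lambda>\<gamma>. coef F \<gamma> * monom_fun \<gamma> w * ip (mon \<beta>) (f * Szego_kernel w)) has_sum ip (mon \<beta> * F) (f * Szego_kernel w)) UNIV"
        using 1 unfolding tt .
      have "((\<lambda>\<gamma>. coef F \<gamma> * monom_fun \<gamma> w * ip (mon \<beta>) (f * Szego_kernel w)) has_sum F w * ip (mon \<beta>) (f * Szego_kernel w)) UNIV"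
        by (intro has_sum_cmult_left power_series H2_disc_fun F w)
      from has_sum_unique[OF 2 this] show ?thesis .
    qed
    obtain C where "bounded_functional (\<lambda>x. ip (F * x) (f * Szego_kernel w)) C"
      using bounded_functional_times[OF F(1) fk] by blast
    from functional_expand[OF this h]
    have 1: "((\<lambda>\<beta>. F w * (coef h \<beta> * ip (mon \<beta>) (f * Szego_kernel w))) has_sum ip (F * h) (f * Szego_kernel w)) UNIV"
      using poly by (simp add: mult.commute[of F] mult.left_commute)
    obtain C' where "bounded_functional (\<lambda>x. ip (mon (\<lambda>_. 0) * x) (f * Szego_kernel w)) C'"
      using bounded_functional_times[OF mon_H_infty fk] by blast
    from functional_expand[OF this h]
    have "((\<lambda>\<beta>. coef h \<beta> * ip (mon \<beta>) (f * Szego_kernel w)) has_sum ip h (f * Szego_kernel w)) UNIV"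
      by (simp add: mon_0_times h)
    from has_sum_unique[OF 1 has_sum_cmult_right[OF this]]
    have "ip (F * h) (f * Szego_kernel w) = F w * ip h (f * Szego_kernel w)" .
    then show ?thesis using h by (simp add: ev H2_times F times_fun_apply)
  qed
qed

section \<open>Radial limits of the factors\<close>

text \<open>Change the coordinates one after another.\<close>

lemma agree_on_dependent_coords:
  fixes f :: "complex ^ 'n \<Rightarrow> complex"
  assumes nd: "\<And>i. z $ i \<noteq> w $ i \<Longrightarrow> \<not> depends_on_coord f i"
    and z: "z \<in> polydisc" and w: "w \<in> polydisc"
  shows "f z = f w"
proof -
  have "f (mix_coords S w z) = f z" if "finite S" for S
    using that
  proof induction
    case empty
    have "mix_coords {} w z = z" by (simp add: mix_coords_def vec_eq_iff)
    then show ?case by simp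
  next
    case (insert i S)
    have p: "mix_coords S w z \<in> polydisc" for S
      using z w by (auto simp: mix_coords_def polydisc_def)
    have "f (mix_coords (insert i S) w z) = f (mix_coords S w z)"
    proof (cases "z $ i = w $ i")
      case True
      then have "mix_coords (insert i S) w z = mix_coords S w z"
        by (auto simp: mix_coords_def vec_eq_iff)
      then show ?thesis by simp
    next
      case False
      have "\<forall>j. j \<noteq> i \<longrightarrow> mix_coords (insert i S) w z $ j = mix_coords S w z $ j"
        by (simp add: mix_coords_def)
      with nd[OF False] p show ?thesis unfolding depends_on_coord_def by blast
    qed
    then show ?case using insert.IH by simp
  qed
  from this[of UNIV] have "f (mix_coords UNIV w z) = f z" by simp
  moreover have "mix_coords UNIV w z = w" by (simp add: mix_coords_def vec_eq_iff)
  ultimately show ?thesis by simp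
qed

lemma integral_rotated_coef:
  fixes F :: "complex ^ 'n \<Rightarrow> complex"
  assumes F: "disc_fun F" and r: "0 < r" "r < 1" and \<zeta>: "\<zeta> \<in> torus"
  shows "(\<integral>\<eta>. cnj (F (r *\<^sub>R torus_rot \<zeta> \<eta>)) * monom_fun \<alpha> \<eta> \<partial>torus_measure) =
    cnj (monom_fun \<alpha> \<zeta>) * of_real r ^ deg \<alpha> * cnj (coef F \<alpha>)"
proof -
  note [measurable] = measurable_scaleR_disc_fun[OF F]
  have u: "cnj (monom_fun \<alpha> \<zeta>) * monom_fun \<alpha> \<zeta> = 1"
    using norm_monom_fun_torus[OF \<zeta>, of \<alpha>] complex_norm_square[of "monom_fun \<alpha> \<zeta>"] by (simp add: mult.commute)
  define G where "G \<xi> = cnj (F (r *\<^sub>R \<xi>)) * monom_fun \<alpha> \<xi> * cnj (monom_fun \<alpha> \<zeta>)" for \<xi>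
  have Gm: "G \<in> borel_measurable borel" unfolding G_def by measurable
  have "cnj (F (r *\<^sub>R torus_rot \<zeta> \<eta>)) * monom_fun \<alpha> \<eta> = G (torus_rot \<zeta> \<eta>)" for \<eta>
  proof -
    have "G (torus_rot \<zeta> \<eta>) = cnj (F (r *\<^sub>R torus_rot \<zeta> \<eta>)) * monom_fun \<alpha> \<eta> * (cnj (monom_fun \<alpha> \<zeta>) * monom_fun \<alpha> \<zeta>)"
      by (simp add: G_def monom_fun_rotate mult_ac)
    then show ?thesis by (simp add: u)
  qed
  then have "(\<integral>\<eta>. cnj (F (r *\<^sub>R torus_rot \<zeta> \<eta>)) * monom_fun \<alpha> \<eta> \<partial>torus_measure) = (\<integral>\<eta>. G (torus_rot \<zeta> \<eta>) \<partial>torus_measure)"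
    by simp
  also have "\<dots> = (\<integral>\<xi>. G \<xi> \<partial>torus_measure)" by (rule integral_torus_rotate[OF \<zeta> Gm])
  also have "\<dots> = (\<integral>\<xi>. cnj (F (r *\<^sub>R \<xi>) * cnj (monom_fun \<alpha> \<xi>)) \<partial>torus_measure) * cnj (monom_fun \<alpha> \<zeta>)"
    by (simp add: G_def)
  also have "\<dots> = cnj (\<integral>\<xi>. F (r *\<^sub>R \<xi>) * cnj (monom_fun \<alpha> \<xi>) \<partial>torus_measure) * cnj (monom_fun \<alpha> \<zeta>)"
    unfolding Bochner_Integration.integral_cnj ..
  finally show ?thesis unfolding integral_circle_coef[OF F r] by simp
qed

text \<open>For every fixed \<open>\<eta>\<close> the rotation that moves only the coordinates outside \<open>D\<close> preserves the
  measure; exchange the order of the two quantifiers by Fubini's theorem. In the application the coordinates in \<open>D\<close>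
  belong to one factor and the others to the other factor.\<close>

lemma AE_rotate_coordinates:
  fixes D :: "'n::finite set"
  assumes P: "AE \<zeta> in (torus_measure :: (complex ^ 'n) measure). P \<zeta>"
  shows "AE \<zeta> in torus_measure. AE \<eta> in torus_measure. P (torus_rot (\<chi> i. if i \<in> D then 1 else \<eta> $ i) \<zeta>)"
proof -
  define \<mu> where "\<mu> = (torus_measure :: (complex ^ 'n) measure)"
  define m where "m \<eta> = (\<chi> i. if i \<in> D then 1 else \<eta> $ i)" for \<eta> :: "complex ^ 'n"
  interpret \<mu>: prob_space \<mu> unfolding \<mu>_def by (rule prob_space_torus)
  interpret PP: pair_prob_space \<mu> \<mu> ..
  from P obtain E where E: "{\<zeta>. \<not> P \<zeta>} \<subseteq> E" "emeasure \<mu> E = 0" "E \<in> sets borel"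
    unfolding \<mu>_def by (auto elim!: AE_E)
  have nE: "AE \<zeta> in \<mu>. \<zeta> \<notin> E"
    using E by (intro AE_not_in) (simp add: null_sets_def \<mu>_def)
  have 1: "AE \<zeta> in \<mu>. torus_rot (m \<eta>) \<zeta> \<notin> E" if "\<eta> \<in> torus" for \<eta>
  proof -
    have "m \<eta> \<in> torus" using that by (auto simp: m_def torus_def)
    then have eq: "distr \<mu> borel (torus_rot (m \<eta>)) = \<mu>" unfolding \<mu>_def by (rule torus_rotate)
    have "AE \<zeta> in distr \<mu> borel (torus_rot (m \<eta>)). \<zeta> \<notin> E" unfolding eq by (rule nE)
    then show ?thesis by (rule AE_distrD[rotated]) (simp add: \<mu>_def)
  qed
  have "AE \<eta> in \<mu>. \<eta> \<in> torus" unfolding \<mu>_def by (rule AE_torus)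
  then have 2: "AE \<eta> in \<mu>. AE \<zeta> in \<mu>. torus_rot (m \<eta>) \<zeta> \<notin> E"
    by eventually_elim (rule 1)
  have "AE \<zeta> in \<mu>. AE \<eta> in \<mu>. torus_rot (m \<eta>) \<zeta> \<notin> E"
  proof (subst PP.AE_commute)
    have "continuous_on UNIV (\<lambda>p :: (complex ^ 'n) \<times> (complex ^ 'n). if i \<in> D then 1 else snd p $ i)" for i
      by (cases "i \<in> D") (auto intro!: continuous_intros)
    then have "continuous_on UNIV (\<lambda>p :: (complex ^ 'n) \<times> (complex ^ 'n). torus_rot (m (snd p)) (fst p))"
      unfolding torus_rot_def m_def by (auto intro!: continuous_intros)
    then have meas: "(\<lambda>p :: (complex ^ 'n) \<times> (complex ^ 'n). torus_rot (m (snd p)) (fst p)) \<in> borel_measurable (borel \<Otimes>\<^sub>M borel)"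
      unfolding borel_prod by (rule borel_measurable_continuous_onI)
    have s: "sets (\<mu> \<Otimes>\<^sub>M \<mu>) = sets (borel \<Otimes>\<^sub>M borel)"
      by (intro sets_pair_measure_cong) (simp_all add: \<mu>_def)
    have "(\<lambda>p. torus_rot (m (snd p)) (fst p)) -` (- E) \<inter> space (borel \<Otimes>\<^sub>M borel) \<in> sets (borel \<Otimes>\<^sub>M borel)"
      using E(3) by (intro measurable_sets[OF meas]) auto
    then show "{x \<in> space (\<mu> \<Otimes>\<^sub>M \<mu>). torus_rot (m (snd x)) (fst x) \<notin> E} \<in> sets (\<mu> \<Otimes>\<^sub>M \<mu>)"
      unfolding s by (simp add: vimage_def space_pair_measure \<mu>_def)
  qed (rule 2)
  then have "AE \<zeta> in \<mu>. AE \<eta> in \<mu>. P (torus_rot (m \<eta>) \<zeta>)"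
  proof eventually_elim
    case (elim \<zeta>)
    then show ?case by eventually_elim (use E(1) in blast)
  qed
  then show ?thesis unfolding \<mu>_def m_def .
qed

lemma tendsto_factor_modulus:
  assumes lim: "((\<lambda>r. cmod (h r)) \<longlongrightarrow> 1) (at_left 1)"
    and h: "\<And>r. 0 < r \<Longrightarrow> r < 1 \<Longrightarrow> h r = f r * (g r :: complex)"
    and le: "\<And>r. 0 < r \<Longrightarrow> r < 1 \<Longrightarrow> cmod (f r) \<le> 1" "\<And>r. 0 < r \<Longrightarrow> r < 1 \<Longrightarrow> cmod (g r) \<le> 1"
  shows "((\<lambda>r. cmod (f r)) \<longlongrightarrow> 1) (at_left (1::real))"
proof (rule tendsto_sandwich[OF _ _ lim tendsto_const])
  show "\<forall>\<^sub>F r in at_left 1. cmod (h r) \<le> cmod (f r)"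
    using eventually_at_left_1 by eventually_elim (simp add: h norm_mult le mult_left_le)
  show "\<forall>\<^sub>F r in at_left 1. cmod (f r) \<le> 1"
    using eventually_at_left_1 by eventually_elim (simp add: le)
qed

lemma isometric_nonzero_coef:
  assumes "isometric F"
  obtains \<alpha> where "coef F \<alpha> \<noteq> 0"
proof -
  have "F \<noteq> 0"
  proof
    assume 0: "F = 0"
    have "ip F F = 1" using assms mon_0_times[OF isometric_H2[OF assms]] unfolding isometric_def by metis
    then show False using ip_0_left[OF isometric_H2[OF assms]] 0 by simp
  qed
  then show ?thesis using coef_0_imp_0[OF isometric_H2[OF assms]] that by blast
qed

text \<open>The two inner functions only give radial limits of \<open>f * cnj F\<close>, since
  \<open>\<phi>1 * cnj \<phi>2 = f * cnj F * |\<psi>|\<^sup>2\<close>. As \<open>f\<close> and \<open>F\<close> depend on disjoint sets of coordinates, the variables of \<open>F\<close> can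
  be rotated independently, by \<open>AE_rotate_coordinates\<close>. Integrating over these rotations against a monomial replaces \<open>F\<close> by one of
  its Taylor coefficients; choosing a nonzero one leaves the radial limit of \<open>f\<close> alone.\<close>

lemma inner_factor_limit:
  fixes f F \<psi> \<phi>1 \<phi>2 :: "complex ^ 'n \<Rightarrow> complex"
  assumes f: "isometric f" and F: "isometric F" and \<psi>: "isometric \<psi>"
    and \<phi>1: "inner_function \<phi>1" "restr \<phi>1 = f * \<psi>" and \<phi>2: "inner_function \<phi>2" "restr \<phi>2 = F * \<psi>"
    and sep: "\<And>i. \<not> depends_on_coord f i \<or> \<not> depends_on_coord F i"
  shows "inner_function f"
proof -
  obtain \<alpha> where \<alpha>: "coef F \<alpha> \<noteq> 0" by (rule isometric_nonzero_coef[OF F])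
  have Fd: "disc_fun F" by (rule H2_disc_fun[OF isometric_H2[OF F]])
  have le1: "cmod (g (r *\<^sub>R \<zeta>)) \<le> 1" if "isometric g" "\<zeta> \<in> torus" "0 < r" "r < 1" for g :: "complex ^ 'n \<Rightarrow> complex" and \<zeta> r
    using that by (intro isometric_le_1 torus_scale_polydisc) auto
  have ray1: "\<phi>1 (r *\<^sub>R \<zeta>) = f (r *\<^sub>R \<zeta>) * \<psi> (r *\<^sub>R \<zeta>)" and ray2: "\<phi>2 (r *\<^sub>R \<zeta>) = F (r *\<^sub>R \<zeta>) * \<psi> (r *\<^sub>R \<zeta>)"
    if "\<zeta> \<in> torus" "0 < r" "r < 1" for \<zeta> r
    using restr_ray[OF that, of \<phi>1] restr_ray[OF that, of \<phi>2] by (simp_all add: \<phi>1(2) \<phi>2(2) times_fun_apply)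
  define P where "P \<zeta> \<longleftrightarrow> (\<exists>w. ((\<lambda>r. f (r *\<^sub>R \<zeta>) * cnj (F (r *\<^sub>R \<zeta>))) \<longlongrightarrow> w) (at_left 1))" for \<zeta>
  have "AE \<zeta> in torus_measure. P \<zeta>"
    using AE_torus \<phi>1(1)[unfolded inner_function_def, THEN conjunct2] \<phi>2(1)[unfolded inner_function_def, THEN conjunct2]
      inner_function_modulus[OF \<phi>1(1)]
  proof eventually_elim
    case (elim \<zeta>)
    then obtain w1 w2 where w: "((\<lambda>r. \<phi>1 (r *\<^sub>R \<zeta>)) \<longlongrightarrow> w1) (at_left 1)" "((\<lambda>r. \<phi>2 (r *\<^sub>R \<zeta>)) \<longlongrightarrow> w2) (at_left 1)" by blast
    have m\<psi>: "((\<lambda>r. cmod (\<psi> (r *\<^sub>R \<zeta>))) \<longlongrightarrow> 1) (at_left 1)"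
      by (rule tendsto_factor_modulus[OF elim(4), where g = "\<lambda>r. f (r *\<^sub>R \<zeta>)"])
         (auto simp: ray1 elim(1) le1 f \<psi>)
    have "((\<lambda>r. \<phi>1 (r *\<^sub>R \<zeta>) * cnj (\<phi>2 (r *\<^sub>R \<zeta>)) / of_real ((cmod (\<psi> (r *\<^sub>R \<zeta>)))\<^sup>2)) \<longlongrightarrow> w1 * cnj w2 / of_real (1\<^sup>2)) (at_left 1)"
      by (intro tendsto_divide tendsto_mult tendsto_cnj tendsto_of_real tendsto_power m\<psi> w) simp
    moreover have "\<forall>\<^sub>F r in at_left 1. \<phi>1 (r *\<^sub>R \<zeta>) * cnj (\<phi>2 (r *\<^sub>R \<zeta>)) / of_real ((cmod (\<psi> (r *\<^sub>R \<zeta>)))\<^sup>2) = f (r *\<^sub>R \<zeta>) * cnj (F (r *\<^sub>R \<zeta>))"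
      using eventually_at_left_1 order_tendstoD(1)[OF m\<psi>, of 0, simplified]
    proof eventually_elim
      case (elim r)
      then have "\<psi> (r *\<^sub>R \<zeta>) \<noteq> 0" by auto
      then show ?case using elim \<open>\<zeta> \<in> torus\<close> by (simp add: ray1 ray2 complex_norm_square del: of_real_power)
    qed
    ultimately have "((\<lambda>r. f (r *\<^sub>R \<zeta>) * cnj (F (r *\<^sub>R \<zeta>))) \<longlongrightarrow> w1 * cnj w2 / of_real (1\<^sup>2)) (at_left 1)"
      by (rule Lim_transform_eventually)
    then show ?case unfolding P_def by blast
  qed
  define D where "D = {i. depends_on_coord f i}"
  from AE_rotate_coordinates[OF \<open>AE \<zeta> in torus_measure. P \<zeta>\<close>, of D]
  have mix: "AE \<zeta> in torus_measure. AE \<eta> in torus_measure. P (torus_rot (\<chi> i. if i \<in> D then 1 else \<eta> $ i) \<zeta>)" .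
  have lim: "AE \<zeta> in torus_measure. \<exists>w. ((\<lambda>r. f (r *\<^sub>R \<zeta>)) \<longlongrightarrow> w) (at_left 1)"
    using AE_torus mix
  proof eventually_elim
    case (elim \<zeta>)
    note \<zeta> = elim(1)
    define h where "h r \<eta> = f (r *\<^sub>R \<zeta>) * cnj (F (r *\<^sub>R torus_rot \<zeta> \<eta>)) * monom_fun \<alpha> \<eta>" for r \<eta>
    have hm: "h r \<in> borel_measurable borel" for r
    proof -
      have "(\<lambda>\<eta>. F (r *\<^sub>R torus_rot \<zeta> \<eta>)) \<in> borel_measurable borel"
        by (rule measurable_compose[OF measurable_rotate measurable_scaleR_disc_fun[OF Fd]])
      then show ?thesis unfolding h_def by measurable
    qed
    have rt: "torus_rot \<zeta> \<eta> \<in> torus" if "\<eta> \<in> torus" for \<eta>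
      using that \<zeta> by (auto simp: torus_rot_def torus_def norm_mult)
    have hb: "cmod (h r \<eta>) \<le> 1" if "\<eta> \<in> torus" "0 < r" "r < 1" for r \<eta>
      using le1[OF f \<zeta> that(2,3)] le1[OF F rt[OF that(1)] that(2,3)]
      by (simp add: h_def norm_mult norm_monom_fun_torus[OF that(1)] mult_le_one)
    have conv: "AE \<eta> in torus_measure. \<exists>w. ((\<lambda>r. h r \<eta>) \<longlongrightarrow> w) (at_left 1)"
      using elim(2) AE_torus
    proof eventually_elim
      case (elim \<eta>)
      define \<xi> where "\<xi> = torus_rot (\<chi> i. if i \<in> D then 1 else \<eta> $ i) \<zeta>"
      have \<xi>: "\<xi> \<in> torus" using \<zeta> elim(2) by (auto simp: \<xi>_def torus_rot_def torus_def norm_mult)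
      have f\<xi>: "f (r *\<^sub>R \<xi>) = f (r *\<^sub>R \<zeta>)" if "0 < r" "r < 1" for r
      proof (rule agree_on_dependent_coords)
        show "\<not> depends_on_coord f i" if "(r *\<^sub>R \<xi>) $ i \<noteq> (r *\<^sub>R \<zeta>) $ i" for i
          using that by (auto simp: \<xi>_def torus_rot_def D_def split: if_splits)
      qed (use that \<xi> \<zeta> in \<open>auto intro: torus_scale_polydisc\<close>)
      have F\<xi>: "F (r *\<^sub>R \<xi>) = F (r *\<^sub>R torus_rot \<zeta> \<eta>)" if "0 < r" "r < 1" for r
      proof (rule agree_on_dependent_coords)
        show "\<not> depends_on_coord F i" if "(r *\<^sub>R \<xi>) $ i \<noteq> (r *\<^sub>R torus_rot \<zeta> \<eta>) $ i" for i
          using that sep[of i] by (auto simp: \<xi>_def torus_rot_def D_def mult.commute split: if_splits)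
      qed (use that \<xi> rt[OF elim(2)] in \<open>auto intro: torus_scale_polydisc\<close>)
      from elim(1) obtain w where w: "((\<lambda>r. f (r *\<^sub>R \<xi>) * cnj (F (r *\<^sub>R \<xi>))) \<longlongrightarrow> w) (at_left 1)"
        unfolding P_def \<xi>_def by blast
      have "((\<lambda>r. f (r *\<^sub>R \<xi>) * cnj (F (r *\<^sub>R \<xi>)) * monom_fun \<alpha> \<eta>) \<longlongrightarrow> w * monom_fun \<alpha> \<eta>) (at_left 1)"
        by (intro tendsto_mult w tendsto_const)
      moreover have "\<forall>\<^sub>F r in at_left 1. f (r *\<^sub>R \<xi>) * cnj (F (r *\<^sub>R \<xi>)) * monom_fun \<alpha> \<eta> = h r \<eta>"
        using eventually_at_left_1 by eventually_elim (simp add: h_def f\<xi> F\<xi>)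
      ultimately have "((\<lambda>r. h r \<eta>) \<longlongrightarrow> w * monom_fun \<alpha> \<eta>) (at_left 1)"
        by (rule Lim_transform_eventually)
      then show ?case by (rule exI)
    qed
    \<comment> \<open>The sequence of radii makes the limit function measurable.\<close>
    define W where "W \<eta> = lim (\<lambda>n. h (radii n) \<eta>)" for \<eta>
    have Wm: "W \<in> borel_measurable borel"
      unfolding W_def by (rule borel_measurable_lim_metric) (rule hm)
    have hW: "AE \<eta> in torus_measure. ((\<lambda>r. h r \<eta>) \<longlongrightarrow> W \<eta>) (at_left 1)"
      using conv
    proof eventually_elim
      case (elim \<eta>)
      then obtain w where w: "((\<lambda>r. h r \<eta>) \<longlongrightarrow> w) (at_left 1)" by blast
      have "W \<eta> = w" unfolding W_def by (rule limI[OF filterlim_compose[OF w filterlim_radii]])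
      with w show ?case by simp
    qed
    define I where "I = (\<integral>\<eta>. W \<eta> \<partial>torus_measure)"
    have "((\<lambda>r. \<integral>\<eta>. h r \<eta> \<partial>torus_measure) \<longlongrightarrow> I) (at_left 1)"
    proof (rule tendsto_at_left_sequentially[of 0])
      fix S :: "nat \<Rightarrow> real" assume S: "\<And>n. S n < 1" "\<And>n. 0 < S n" "S \<longlonglongrightarrow> 1"
      have fS: "filterlim S (at_left 1) sequentially"
        unfolding filterlim_at using S by (auto simp: less_imp_neq intro!: always_eventually)
      show "(\<lambda>n. \<integral>\<eta>. h (S n) \<eta> \<partial>torus_measure) \<longlonglongrightarrow> I"
        unfolding I_def
      proof (rule integral_dominated_convergence[where w = "\<lambda>_. 1"])
        show "AE \<eta> in torus_measure. (\<lambda>n. h (S n) \<eta>) \<longlonglongrightarrow> W \<eta>"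
          using hW by eventually_elim (rule filterlim_compose[OF _ fS])
        show "AE \<eta> in torus_measure. cmod (h (S n) \<eta>) \<le> 1" for n
          using AE_torus by eventually_elim (rule hb[OF _ S(2,1)])
      qed (use Wm hm in simp_all)
    qed simp
    moreover have "\<forall>\<^sub>F r in at_left 1. (\<integral>\<eta>. h r \<eta> \<partial>torus_measure) =
        f (r *\<^sub>R \<zeta>) * (cnj (monom_fun \<alpha> \<zeta>) * of_real r ^ deg \<alpha> * cnj (coef F \<alpha>))"
      using eventually_at_left_1
    proof eventually_elim
      case (elim r)
      show ?case unfolding h_def mult.assoc integral_mult_right_zero
        using integral_rotated_coef[OF Fd _ _ \<zeta>, of r \<alpha>] elim by (simp add: mult.assoc)
    qed
    ultimately have 1: "((\<lambda>r. f (r *\<^sub>R \<zeta>) * (cnj (monom_fun \<alpha> \<zeta>) * of_real r ^ deg \<alpha> * cnj (coef F \<alpha>))) \<longlongrightarrow> I) (at_left 1)"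
      by (rule Lim_transform_eventually)
    have ne: "cnj (monom_fun \<alpha> \<zeta>) * of_real 1 ^ deg \<alpha> * cnj (coef F \<alpha>) \<noteq> 0"
      using norm_monom_fun_torus[OF \<zeta>, of \<alpha>] \<alpha> by auto
    have "((\<lambda>r. cnj (monom_fun \<alpha> \<zeta>) * of_real r ^ deg \<alpha> * cnj (coef F \<alpha>)) \<longlongrightarrow>
        cnj (monom_fun \<alpha> \<zeta>) * of_real 1 ^ deg \<alpha> * cnj (coef F \<alpha>)) (at_left 1)"
      by (intro tendsto_mult tendsto_const tendsto_power tendsto_of_real tendsto_ident_at)
    from tendsto_divide[OF 1 this ne]
    have 2: "((\<lambda>r. f (r *\<^sub>R \<zeta>) * (cnj (monom_fun \<alpha> \<zeta>) * of_real r ^ deg \<alpha> * cnj (coef F \<alpha>)) /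
        (cnj (monom_fun \<alpha> \<zeta>) * of_real r ^ deg \<alpha> * cnj (coef F \<alpha>))) \<longlongrightarrow>
        I / (cnj (monom_fun \<alpha> \<zeta>) * of_real 1 ^ deg \<alpha> * cnj (coef F \<alpha>))) (at_left 1)" .
    have "\<forall>\<^sub>F r in at_left 1. f (r *\<^sub>R \<zeta>) * (cnj (monom_fun \<alpha> \<zeta>) * of_real r ^ deg \<alpha> * cnj (coef F \<alpha>)) /
        (cnj (monom_fun \<alpha> \<zeta>) * of_real r ^ deg \<alpha> * cnj (coef F \<alpha>)) = f (r *\<^sub>R \<zeta>)"
      using eventually_at_left_1
    proof eventually_elim
      case (elim r)
      then have "cnj (monom_fun \<alpha> \<zeta>) * of_real r ^ deg \<alpha> * cnj (coef F \<alpha>) \<noteq> 0" using ne by simp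
      then show ?case by (rule nonzero_mult_div_cancel_right)
    qed
    from Lim_transform_eventually[OF 2 this] show ?case by (rule exI)
  qed
  show ?thesis unfolding inner_function_def
  proof (intro conjI isometric_H_infty f)
    show "AE \<zeta> in torus_measure. \<exists>w. ((\<lambda>r. f (r *\<^sub>R \<zeta>)) \<longlongrightarrow> w) (at_left 1) \<and> cmod w = 1"
      using AE_torus lim inner_function_modulus[OF \<phi>1(1)]
    proof eventually_elim
      case (elim \<zeta>)
      then obtain w where w: "((\<lambda>r. f (r *\<^sub>R \<zeta>)) \<longlongrightarrow> w) (at_left 1)" by blast
      have "((\<lambda>r. cmod (f (r *\<^sub>R \<zeta>))) \<longlongrightarrow> 1) (at_left 1)"
        by (rule tendsto_factor_modulus[OF elim(3), where g = "\<lambda>r. \<psi> (r *\<^sub>R \<zeta>)"])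
           (auto simp: ray1 elim(1) le1 f \<psi>)
      from tendsto_unique[OF _ tendsto_norm[OF w] this] have "cmod w = 1" by simp
      with w show ?case by blast
    qed
  qed
qed

lemma inner_cofactor:
  assumes f: "inner_function f" and \<psi>: "isometric \<psi>" and \<phi>: "inner_function \<phi>" "restr \<phi> = f * \<psi>"
  shows "inner_function \<psi>"
  unfolding inner_function_def
proof (intro conjI isometric_H_infty \<psi>)
  show "AE \<zeta> in torus_measure. \<exists>w. ((\<lambda>r. \<psi> (r *\<^sub>R \<zeta>)) \<longlongrightarrow> w) (at_left 1) \<and> cmod w = 1"
    using AE_torus \<phi>(1)[unfolded inner_function_def, THEN conjunct2] f[unfolded inner_function_def, THEN conjunct2]
  proof eventually_elim
    case (elim \<zeta>)
    then obtain w1 w2 where w: "((\<lambda>r. \<phi> (r *\<^sub>R \<zeta>)) \<longlongrightarrow> w1) (at_left 1)" "((\<lambda>r. f (r *\<^sub>R \<zeta>)) \<longlongrightarrow> w2) (at_left 1)"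
      "cmod w1 = 1" "cmod w2 = 1" by blast
    then have w2: "w2 \<noteq> 0" by auto
    have "((\<lambda>r. \<phi> (r *\<^sub>R \<zeta>) / f (r *\<^sub>R \<zeta>)) \<longlongrightarrow> w1 / w2) (at_left 1)"
      by (rule tendsto_divide[OF w(1,2) w2])
    moreover have "\<forall>\<^sub>F r in at_left 1. \<phi> (r *\<^sub>R \<zeta>) / f (r *\<^sub>R \<zeta>) = \<psi> (r *\<^sub>R \<zeta>)"
      using eventually_at_left_1 tendsto_imp_eventually_ne[OF w(2) w2]
    proof eventually_elim
      case (elim r)
      have "\<phi> (r *\<^sub>R \<zeta>) = f (r *\<^sub>R \<zeta>) * \<psi> (r *\<^sub>R \<zeta>)"
        using restr_ray[OF \<open>\<zeta> \<in> torus\<close>, of r \<phi>] elim(1) by (simp add: \<phi>(2) times_fun_apply)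
      then show ?case using elim(2) by simp
    qed
    ultimately have "((\<lambda>r. \<psi> (r *\<^sub>R \<zeta>)) \<longlongrightarrow> w1 / w2) (at_left 1)"
      by (rule Lim_transform_eventually)
    moreover have "cmod (w1 / w2) = 1" using w by (simp add: norm_divide)
    ultimately show ?case by blast
  qed
qed

section \<open>The main theorem\<close>

lemma separated_products_commute:
  assumes f: "isometric f" and F: "isometric F" and p: "isometric p"
    and sep: "\<And>i. \<not> depends_on_coord f i \<or> \<not> depends_on_coord F i" and h: "h \<in> H2"
  shows "(p * f) * adj (p * f) ((p * F) * adj (p * F) h) = (p * F) * adj (p * F) ((p * f) * adj (p * f) h)"
proof -
  note i [simp] = isometric_H_infty[OF f] isometric_H_infty[OF F] isometric_H_infty[OF p]
  define k where "k = adj p h"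
  have k: "k \<in> H2" by (simp add: k_def adj_H2 h)
  have swap: "(p * f) * adj (p * f) ((p * F) * adj (p * F) h) = p * (f * F * adj F (adj f k))"
    if "isometric f" "isometric F" "\<And>i. \<not> depends_on_coord f i \<or> \<not> depends_on_coord F i" for f F
  proof -
    note [simp] = isometric_H_infty[OF that(1)] isometric_H_infty[OF that(2)]
    define x where "x = F * adj F k"
    have x: "x \<in> H2" by (simp add: x_def H2_times adj_H2 k)
    have "(p * F) * adj (p * F) h = p * x"
      by (simp add: adj_times h x_def k_def mult.assoc)
    moreover have "(p * f) * adj (p * f) (p * x) = p * (f * adj f x)"
      by (simp add: adj_times H2_times x adj_isometric[OF p] mult.assoc)
    moreover have "adj f x = F * adj f (adj F k)"
      unfolding x_def by (rule adj_times_separated) (use that k in \<open>simp_all add: isometric_H2 adj_H2\<close>)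
    moreover have "adj f (adj F k) = adj F (adj f k)" by (rule adj_commute) (simp_all add: k)
    ultimately show ?thesis by (simp add: mult.assoc)
  qed
  have sep': "\<not> depends_on_coord F i \<or> \<not> depends_on_coord f i" for i using sep by blast
  show ?thesis
    unfolding swap[OF f F sep] swap[OF F f sep'] by (simp add: adj_commute[OF i(1,2) k] mult.commute[of f F])
qed

lemma depends_on_coord_restr: "depends_on_coord (restr \<phi>) i \<longleftrightarrow> depends_on_coord \<phi> i"
  unfolding depends_on_coord_def by (auto simp: restr_def)

lemma restr_factor: "(\<And>z. z \<in> polydisc \<Longrightarrow> \<phi> z = f z * \<psi> z) \<Longrightarrow> restr \<phi> = restr \<psi> * restr f"
  by (auto simp: restr_def pointwise)

text \<open>The range of multiplication by \<open>b\<close> is contained in that of \<open>a\<close>, so the product of the projections in either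
  order is the smaller one.\<close>

lemma divides_commute:
  assumes a: "isometric a" and b: "isometric b" and \<phi>: "\<phi> \<in> H_infty" and eq: "b = \<phi> * a" and h: "h \<in> H2"
  shows "a * adj a (b * adj b h) = b * adj b (a * adj a h)"
proof -
  note i [simp] = isometric_H_infty[OF a] isometric_H_infty[OF b]
  have ba: "b * g = a * (\<phi> * g)" for g by (simp add: eq mult_ac)
  have "a * adj a (b * adj b h) = b * adj b h"
    unfolding ba by (simp add: adj_isometric[OF a] H2_times \<phi> adj_H2 h)
  moreover have "adj b (a * adj a h) = adj b h"
  proof (rule adj_eqI)
    fix g :: "complex ^ 'a \<Rightarrow> complex" assume g: "g \<in> H2"
    show "ip (adj b h) g = ip (a * adj a h) (b * g)"
      by (simp add: ip_adj_left h g) (simp add: ba isometric_ip[OF a] H2_times \<phi> g adj_H2 h ip_adj_left)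
  qed (simp_all add: H2_times adj_H2 h)
  ultimately show ?thesis by simp
qed

text \<open>If \<open>f\<close> depends on no coordinate it is a nonzero constant \<open>c\<close>, and the quotient is \<open>F / c\<close>. In one
  variable this applies to one member of every separated pair.\<close>

lemma divides_of_constant_factor:
  fixes f F \<psi> \<phi>1 \<phi>2 :: "complex ^ 'n \<Rightarrow> complex"
  assumes f: "isometric f" and F: "isometric F"
    and \<phi>: "restr \<phi>1 = f * \<psi>" "restr \<phi>2 = F * \<psi>" and nd: "\<And>i. \<not> depends_on_coord f i"
  shows "inner_divides \<phi>1 \<phi>2"
proof -
  define c where "c = f 0"
  have fc: "f z = c" if "z \<in> polydisc" for z
    unfolding c_def by (rule agree_on_dependent_coords) (use nd that in \<open>auto simp: polydisc_def\<close>)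
  have "c \<noteq> 0"
  proof
    assume "c = 0"
    then have "f = 0" using fc isometric_H2[OF f] by (force simp: pointwise H2_def)
    then have "coef f \<alpha> = 0" for \<alpha>
      using ip_mon[OF isometric_H2[OF f], of \<alpha>] ip_0_left[OF H2_mon, of \<alpha>] by simp
    with isometric_nonzero_coef[OF f] show False by blast
  qed
  have "scl (1 / c) F \<in> H_infty"
  proof (rule H_inftyI)
    show "analytic_polydisc (scl (1 / c) F)" unfolding scl_def
      using isometric_H_infty[OF F] by (intro analytic_polydisc_mult analytic_polydisc_const) (simp add: H_infty_def)
    show "cmod (scl (1 / c) F z) \<le> cmod (1 / c) * 1" if "z \<in> polydisc" for z
      unfolding scl_apply norm_mult by (intro mult_left_mono isometric_le_1 F that) simp
  qed
  moreover have "\<phi>2 z = scl (1 / c) F z * \<phi>1 z" if z: "z \<in> polydisc" for z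
    using fun_cong[OF \<phi>(1), of z] fun_cong[OF \<phi>(2), of z] z \<open>c \<noteq> 0\<close> by (simp add: restr_def times_fun_apply fc)
  ultimately show ?thesis unfolding inner_divides_def by blast
qed

theorem theorem1p3:
  fixes \<phi>1 \<phi>2 :: "complex ^ 'n \<Rightarrow> complex"
  assumes "inner_function \<phi>1" and "inner_function \<phi>2"
    and "\<not> \<phi>1 constant_on polydisc" and "\<not> \<phi>2 constant_on polydisc"
  shows "(CARD('n) = 1 \<longrightarrow>
            ((\<forall>f\<in>H2. commutator (H2_proj (mult_H2 \<phi>1)) (H2_proj (mult_H2 \<phi>2)) f = (\<lambda>_. 0))
             \<longleftrightarrow> inner_divides \<phi>1 \<phi>2 \<or> inner_divides \<phi>2 \<phi>1)) \<and>
         (CARD('n) > 1 \<longrightarrow>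
            ((\<forall>f\<in>H2. commutator (H2_proj (mult_H2 \<phi>1)) (H2_proj (mult_H2 \<phi>2)) f = (\<lambda>_. 0))
             \<longleftrightarrow> (\<exists>\<phi>1' \<phi>2' \<psi>.
                    inner_function \<phi>1' \<and> inner_function \<phi>2' \<and> inner_function \<psi> \<and>
                    separated \<phi>1' \<phi>2' \<and>
                    (\<forall>z\<in>polydisc. \<phi>1 z = \<phi>1' z * \<psi> z) \<and>
                    (\<forall>z\<in>polydisc. \<phi>2 z = \<phi>2' z * \<psi> z))))"
proof -
  define a where "a = restr \<phi>1"
  define b where "b = restr \<phi>2"
  have a: "isometric a" and b: "isometric b" unfolding a_def b_def by (intro inner_imp_isometric assms)+
  let ?comm = "\<forall>f\<in>H2. commutator (H2_proj (mult_H2 \<phi>1)) (H2_proj (mult_H2 \<phi>2)) f = (\<lambda>_. 0)"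
  have comm_iff: "?comm \<longleftrightarrow> (\<forall>h\<in>H2. a * adj a (b * adj b h) = b * adj b (a * adj a h))"
    unfolding a_def b_def by (rule commutator_iff) (use a b in \<open>simp_all add: a_def b_def\<close>)
  have factorization: "\<exists>f F \<psi>. isometric f \<and> isometric F \<and> isometric \<psi> \<and> a = f * \<psi> \<and> b = F * \<psi> \<and>
     (\<forall>i. \<not> depends_on_coord f i \<or> \<not> depends_on_coord F i)" if ?comm
  proof -
    interpret commuting_pair a b
      using that[unfolded comm_iff] a b by unfold_locales blast+
    show ?thesis by (rule structure_theorem)
  qed
  have one: "?comm \<longleftrightarrow> inner_divides \<phi>1 \<phi>2 \<or> inner_divides \<phi>2 \<phi>1" if card: "CARD('n) = 1"
  proof
    assume ?comm
    from factorization[OF this] obtain f F \<psi> where s: "isometric f" "isometric F" "a = f * \<psi>" "b = F * \<psi>"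
      "\<And>i. \<not> depends_on_coord f i \<or> \<not> depends_on_coord F i" by blast
    obtain k :: 'n where k: "UNIV = {k}" using card by (rule card_1_singletonE)
    have k: "i = k" for i using k by blast
    from s(5)[of k] show "inner_divides \<phi>1 \<phi>2 \<or> inner_divides \<phi>2 \<phi>1"
    proof
      assume "\<not> depends_on_coord f k"
      then have "\<not> depends_on_coord f i" for i using k[of i] by simp
      from divides_of_constant_factor[OF s(1,2) s(3,4)[unfolded a_def b_def] this] show ?thesis ..
    next
      assume "\<not> depends_on_coord F k"
      then have "\<not> depends_on_coord F i" for i using k[of i] by simp
      from divides_of_constant_factor[OF s(2,1) s(4,3)[unfolded a_def b_def] this] show ?thesis ..
    qed
  next
    assume "inner_divides \<phi>1 \<phi>2 \<or> inner_divides \<phi>2 \<phi>1"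
    then show ?comm
    proof
      assume "inner_divides \<phi>1 \<phi>2"
      then obtain \<phi> where \<phi>: "\<phi> \<in> H_infty" "\<And>z. z \<in> polydisc \<Longrightarrow> \<phi>2 z = \<phi> z * \<phi>1 z"
        unfolding inner_divides_def by blast
      then have "b = \<phi> * a" by (auto simp: a_def b_def restr_def pointwise)
      from divides_commute[OF a b \<phi>(1) this] show ?comm unfolding comm_iff by blast
    next
      assume "inner_divides \<phi>2 \<phi>1"
      then obtain \<phi> where \<phi>: "\<phi> \<in> H_infty" "\<And>z. z \<in> polydisc \<Longrightarrow> \<phi>1 z = \<phi> z * \<phi>2 z"
        unfolding inner_divides_def by blast
      then have "a = \<phi> * b" by (auto simp: a_def b_def restr_def pointwise)
      from divides_commute[OF b a \<phi>(1) this] show ?comm unfolding comm_iff by simp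
    qed
  qed
  have many: "?comm \<longleftrightarrow> (\<exists>\<phi>1' \<phi>2' \<psi>. inner_function \<phi>1' \<and> inner_function \<phi>2' \<and> inner_function \<psi> \<and>
      separated \<phi>1' \<phi>2' \<and> (\<forall>z\<in>polydisc. \<phi>1 z = \<phi>1' z * \<psi> z) \<and> (\<forall>z\<in>polydisc. \<phi>2 z = \<phi>2' z * \<psi> z))"
    (is "_ \<longleftrightarrow> ?factors")
  proof
    assume ?comm
    from factorization[OF this] obtain f F \<psi> where s: "isometric f" "isometric F" "isometric \<psi>" "a = f * \<psi>" "b = F * \<psi>"
      "\<And>i. \<not> depends_on_coord f i \<or> \<not> depends_on_coord F i" by blast
    have s6: "\<not> depends_on_coord F i \<or> \<not> depends_on_coord f i" for i using s(6) by blast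
    have f: "inner_function f"
      by (rule inner_factor_limit[OF s(1-3) assms(1) s(4)[unfolded a_def] assms(2) s(5)[unfolded b_def] s(6)])
    have F: "inner_function F"
      by (rule inner_factor_limit[OF s(2,1,3) assms(2) s(5)[unfolded b_def] assms(1) s(4)[unfolded a_def] s6])
    have \<psi>: "inner_function \<psi>"
      by (rule inner_cofactor[OF f s(3) assms(1) s(4)[unfolded a_def]])
    have "separated f F" unfolding separated_def using s(6) by blast
    moreover have "\<phi>1 z = f z * \<psi> z" "\<phi>2 z = F z * \<psi> z" if "z \<in> polydisc" for z
      using fun_cong[OF s(4), of z] fun_cong[OF s(5), of z] that
      by (simp_all add: a_def b_def restr_def times_fun_apply)
    ultimately show ?factors using f F \<psi> by blast
  next
    assume ?factors
    then obtain f F \<psi> where s: "inner_function f" "inner_function F" "inner_function \<psi>" "separated f F"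
      "\<And>z. z \<in> polydisc \<Longrightarrow> \<phi>1 z = f z * \<psi> z" "\<And>z. z \<in> polydisc \<Longrightarrow> \<phi>2 z = F z * \<psi> z" by blast
    have ab: "a = restr \<psi> * restr f" "b = restr \<psi> * restr F"
      unfolding a_def b_def using s(5,6) by (intro restr_factor; simp)+
    have sep: "\<not> depends_on_coord (restr f) i \<or> \<not> depends_on_coord (restr F) i" for i
      using s(4) unfolding separated_def depends_on_coord_restr by blast
    show ?comm unfolding comm_iff ab
      using separated_products_commute[OF inner_imp_isometric[OF s(1)] inner_imp_isometric[OF s(2)] inner_imp_isometric[OF s(3)] sep] by blast
  qed
  from one many show ?thesis by blast
qed

end
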